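(* Let $M=M(N)$ be positive integers with $N/M\to 0$ as $N\to\infty$, and let $X=[X_{jk}]_{M\times N}$ be an $M\times N$ real random matrix with i.i.d. entries of mean zero and variance $1$, such that $\mathbb{E}|X_{11}|^{5+\delta}<\infty$ for some small positive $\delta$. Let $H_N=\sqrt{\frac{M}{N}}\left(\frac1M X^TX-I_N\right)$ and $f_N(z)=\mathbb{E}\left\{\frac1N \mathrm{Tr}(H_N-z)^{-1}\right\}$. Then for any fixed $z\in\mathbb{C}$ with $\eta=\mathrm{Im}\,z>0$, as $N\to\infty$, $$f_N(z)=f(z)\left\{1-\sqrt{\frac NM}\,\frac{f^3(z)}{1-f^2(z)}+\frac1N\left(\frac{f^2(z)}{(1-f^2(z))^2}+\kappa_4\frac{f^2(z)}{1-f^2(z)}\right)\right\}+o\left(\sqrt{\frac NM}\vee\frac1N\right).$$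
   Context: The common distribution of the entries $X_{jk}$ does not depend on $N$. $\kappa_4=\mathbb{E}\{X_{11}^4\}-3$ is the fourth cumulant of $X_{11}$. The function $f(z)=\frac{-z+\sqrt{z^2-4}}{2}$ is the Stieltjes transform of the standard semicircle law (density $\frac1{2\pi}\sqrt{4-x^2}$ on $[-2,2]$, with the convention that the Stieltjes transform of a measure $\mu$ is $\int (x-z)^{-1}d\mu(x)$), where the square root is the one with positive imaginary part. $a\vee b=\max(a,b)$. *)

theory Defs
  imports "HOL-Probability.Probability" "HOL-Library.Landau_Symbols"
    "Jordan_Normal_Form.Gauss_Jordan_Elimination"
begin

text \<open>Random matrices are given by their entries \<open>x j k\<close>, with row index
  \<open>j < m\<close> and column index \<open>k < n\<close> (counted from 0).\<close>

definition renorm_cov :: "nat \<Rightarrow> nat \<Rightarrow> (nat \<Rightarrow> nat \<Rightarrow> real) \<Rightarrow> real mat" where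
  "renorm_cov m n x =
     (let X = Matrix.mat m n (\<lambda>(j, k). x j k)
      in sqrt (real m / real n) \<cdot>\<^sub>m ((1 / real m) \<cdot>\<^sub>m (X\<^sup>T * X) - 1\<^sub>m n))"

definition mat_trace :: "'a::comm_monoid_add mat \<Rightarrow> 'a" where
  "mat_trace A = (\<Sum>i<dim_row A. A $$ (i, i))"

text \<open>The matrix inverse exists whenever \<open>A\<close> is symmetric and \<open>z\<close> is not real,
  so \<open>the\<close> is harmless for the arguments of interest.\<close>

definition resolvent :: "real mat \<Rightarrow> complex \<Rightarrow> complex mat" where
  "resolvent A z =
     the (mat_inverse (map_mat complex_of_real A - z \<cdot>\<^sub>m 1\<^sub>m (dim_row A)))"

definition expected_stieltjes ::
  "'a measure \<Rightarrow> nat \<Rightarrow> nat \<Rightarrow> (nat \<Rightarrow> nat \<Rightarrow> 'a \<Rightarrow> real) \<Rightarrow> complex \<Rightarrow> complex" where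
  "expected_stieltjes P m n X z =
     (LINT \<omega>|P. mat_trace (resolvent (renorm_cov m n (\<lambda>j k. X j k \<omega>)) z) / of_nat n)"

definition upper_sqrt :: "complex \<Rightarrow> complex" where
  "upper_sqrt w = (THE s. s\<^sup>2 = w \<and> Im s > 0)"

text \<open>Such a root exists and is unique unless \<open>w\<close> is a nonnegative real;
  for \<open>w = z\<^sup>2 - 4\<close> this covers every \<open>z\<close> off the real axis.\<close>

lemma ex1_upper_sqrt:
  assumes "w \<notin> \<real>\<^sub>\<ge>\<^sub>0"
  shows "\<exists>!s. s\<^sup>2 = w \<and> Im s > 0"
proof -
  define c where "c = csqrt w"
  have c: "c\<^sup>2 = w" by (simp add: c_def)
  have "Im c \<noteq> 0"
  proof
    assume "Im c = 0"
    then have "c = of_real (Re c)" by (simp add: complex_eq_iff)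
    then have "c\<^sup>2 = (of_real (Re c))\<^sup>2" by (rule arg_cong)
    then have "w = of_real ((Re c)\<^sup>2)"
      by (simp only: of_real_power c)
    moreover have "complex_of_real ((Re c)\<^sup>2) \<in> \<real>\<^sub>\<ge>\<^sub>0"
      by (simp only: nonneg_Reals_of_real_iff zero_le_power2)
    ultimately show False using assms by simp
  qed
  then have "\<exists>s. s\<^sup>2 = w \<and> Im s > 0"
    using c by (intro exI[of _ "if Im c > 0 then c else - c"]) auto
  then obtain s where s: "s\<^sup>2 = w \<and> Im s > 0" ..
  have unique: "s = t" if "s\<^sup>2 = w \<and> Im s > 0" "t\<^sup>2 = w \<and> Im t > 0" for s t
  proof -
    have "s\<^sup>2 = t\<^sup>2" using that by simp
    then have "s = t \<or> s = - t" by (simp only: power2_eq_iff)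
    moreover have "s \<noteq> - t"
    proof
      assume "s = - t"
      then have "Im s = - Im t" by simp
      then show False using that by linarith
    qed
    ultimately show ?thesis by blast
  qed
  show ?thesis
  proof (rule ex1I)
    show "s\<^sup>2 = w \<and> Im s > 0" by (rule s)
  qed (rule unique[OF _ s])
qed

lemma sq_minus_4_not_nonneg:
  assumes "Im z \<noteq> 0"
  shows "z\<^sup>2 - 4 \<notin> \<real>\<^sub>\<ge>\<^sub>0"
proof
  assume "z\<^sup>2 - 4 \<in> \<real>\<^sub>\<ge>\<^sub>0"
  then have *: "(Re z)\<^sup>2 - (Im z)\<^sup>2 \<ge> 4" "Re z * Im z = 0"
    by (auto simp: complex_nonneg_Reals_iff power2_eq_square)
  then have "Re z = 0" using assms by simp
  then have "(Im z)\<^sup>2 \<le> - 4" using * by simp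
  then show False using zero_le_power2[of "Im z"] by linarith
qed

definition semicircle_stieltjes :: "complex \<Rightarrow> complex" where
  "semicircle_stieltjes z = (- z + upper_sqrt (z\<^sup>2 - 4)) / 2"

text \<open>Fourth cumulant of a law with mean 0 and variance 1.\<close>

definition kappa4 :: "real measure \<Rightarrow> real" where
  "kappa4 \<mu> = (LINT x|\<mu>. x ^ 4) - 3"

end

theory Submission
  imports Defs "Jordan_Normal_Form.Determinant"
begin

text \<open>
  Write \<open>a = 1 / sqrt (M N)\<close>, \<open>c = sqrt (N / M)\<close>, so that \<open>H = a (\<Sum>\<^sub>j x\<^sub>j x\<^sub>j\<^sup>T - M)\<close> with independent rows
  \<open>x\<^sub>j\<close>, and \<open>G = (H - z)\<^sup>-\<^sup>1\<close>. Removing the row \<open>x = x\<^sub>j\<close> gives a resolvent \<open>G\<^sub>0\<close> independent of \<open>x\<close>, and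
  \<open>x\<^sup>T G x = q / (1 + a q)\<close> with \<open>q = x\<^sup>T G\<^sub>0 x\<close>. Taking expectations in
  \<open>N + z Tr G = a (\<Sum>\<^sub>j x\<^sub>j\<^sup>T G x\<^sub>j - Tr G)\<close> and expanding in \<open>a q\<close> up to third order gives, for \<open>m = Tr G / N\<close>,
  \[ E m^2 + z\,E m + 1 = c\,E m^3 - \frac1N E\Bigl(\frac1N Tr\,G^2 + \kappa_4 \frac1N \sum_k G_{kk}^2\Bigr) + o(c \vee 1/N). \]
  Large values of \<open>\<bar>x\<bar>\<^sup>2 - N\<close> are controlled by the uniform integrability of \<open>(\<bar>x\<bar>\<^sup>2 - N)\<^sup>2 / N\<close>, which
  needs only four moments of the entries. The variances of \<open>m\<close> and of \<open>G\<^sub>k\<^sub>k\<close> are bounded by the Efron-Stein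
  inequality, and \<open>E G\<^sub>k\<^sub>k = E m\<close> by exchangeability of the columns. Since
  \<open>w\<^sup>2 + z w + 1 = (w - f) (w - 1/f)\<close> with \<open>1/f\<close> in the lower half-plane, the equation is stable: first
  \<open>E m \<rightarrow> f\<close> for every \<open>z\<close>, then \<open>E Tr G\<^sup>2 / N \<rightarrow> f' = f\<^sup>2 / (1 - f\<^sup>2)\<close> by difference quotients in \<open>z\<close>, and
  dividing by \<open>w - 1/f\<close> yields the expansion.
\<close>

section \<open>Resolvents of symmetric matrices\<close>

text \<open>Note c = a N. Summing over M rows and multiplying by a / N scales a per-row mean by 1 /
  (c N). The per-row terms a (Tr G)^2, a^2 (Tr G)^3 and a Tr G^2 have sizes c N, c^2 N and c, which
  become 1, c and 1/N; so a per-row error must be o(c) or o(c^2 N). Two places are tight. The trace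
  changes by at most 1 / Im z with one row, but multiplied by Tr G this would leave an error of
  order 1/N; its mean, of order c, is needed instead. And E m^2 may be replaced by (E m)^2 only if
  the variance of m is o(max(c, 1/N)), while Efron-Stein with Tr G_0 alone yields 1/N; subtracting a
  Tr G_0^2 too removes the leading part. The coefficient 1 of Tr G^2 is 2, from the second moment of
  the quadratic form, minus 1, from the change of the trace. Taylor remainders are bounded twice: to
  high order in a where |x|^2 <= 2N, and by at most the square of |x|^2 elsewhere, since what is
  uniformly integrable is (|x|^2 - N)^2 / N. Its tail tends to 0 without a rate; this suffices, as
  it enters the normalized equation with a factor 1/N.\<close>

lemma cmod_sum_mult_power2_le:
  fixes a b :: "'i \<Rightarrow> complex"
  shows "(cmod (\<Sum>k\<in>I. a k * b k))\<^sup>2 \<le> (\<Sum>k\<in>I. (cmod (a k))\<^sup>2) * (\<Sum>k\<in>I. (cmod (b k))\<^sup>2)"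
proof -
  have "cmod (\<Sum>k\<in>I. a k * b k) \<le> (\<Sum>k\<in>I. \<bar>cmod (a k)\<bar> * \<bar>cmod (b k)\<bar>)"
    by (rule order_trans[OF norm_sum]) (simp add: norm_mult)
  also have "\<dots> \<le> L2_set (\<lambda>k. cmod (a k)) I * L2_set (\<lambda>k. cmod (b k)) I"
    by (rule L2_set_mult_ineq)
  finally have "(cmod (\<Sum>k\<in>I. a k * b k))\<^sup>2 \<le> (L2_set (\<lambda>k. cmod (a k)) I * L2_set (\<lambda>k. cmod (b k)) I)\<^sup>2"
    by (rule power_mono) simp
  then show ?thesis
    by (simp add: power_mult_distrib L2_set_def sum_nonneg)
qed

lemma sum_delta_mult:
  fixes v :: "nat \<Rightarrow> 'a::semiring_1"
  assumes "k < n"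
  shows "(\<Sum>l<n. (if k = l then 1 else 0) * v l) = v k" "(\<Sum>l<n. v l * (if l = k then 1 else 0)) = v k"
proof -
  have "(\<Sum>l<n. (if k = l then 1 else 0) * v l) = (\<Sum>l<n. if k = l then v l else 0)"
    by (intro sum.cong) auto
  then show "(\<Sum>l<n. (if k = l then 1 else 0) * v l) = v k" using assms by simp
  have "(\<Sum>l<n. v l * (if l = k then 1 else 0)) = (\<Sum>l<n. if l = k then v l else 0)"
    by (intro sum.cong) auto
  then show "(\<Sum>l<n. v l * (if l = k then 1 else 0)) = v k" using assms by simp
qed

text \<open>The system \<open>(A - z) u = v\<close> in coordinates. Columns of a resolvent and its
  action on a vector are both instances, so one energy estimate serves all norm bounds.\<close>

definition shifted_eq :: "nat \<Rightarrow> (nat \<Rightarrow> nat \<Rightarrow> real) \<Rightarrow> complex \<Rightarrow> (nat \<Rightarrow> complex) \<Rightarrow> (nat \<Rightarrow> complex) \<Rightarrow> bool" where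
  "shifted_eq n A z u v \<longleftrightarrow> (\<forall>k<n. (\<Sum>i<n. of_real (A k i) * u i) - z * u k = v k)"

text \<open>The form \<open>u^* A u\<close> is real because \<open>A\<close> is real symmetric, so
  pairing the system with \<open>u\<close> leaves only the contribution of \<open>- z\<close> to the
  imaginary part.\<close>

lemma shifted_eq_energy:
  assumes sym: "\<And>k l. k < n \<Longrightarrow> l < n \<Longrightarrow> A k l = A l k"
    and eq: "shifted_eq n A z u v"
  shows "Im (\<Sum>k<n. cnj (u k) * v k) = - Im z * (\<Sum>k<n. (cmod (u k))\<^sup>2)"
proof -
  define W where "W = (\<Sum>k<n. \<Sum>i<n. of_real (A k i) * cnj (u k) * u i)"
  have "cnj W = (\<Sum>k<n. \<Sum>i<n. of_real (A k i) * u k * cnj (u i))"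
    by (simp add: W_def)
  also have "\<dots> = (\<Sum>i<n. \<Sum>k<n. of_real (A k i) * u k * cnj (u i))"
    by (rule sum.swap)
  also have "\<dots> = W"
    unfolding W_def by (intro sum.cong refl) (auto simp: sym ac_simps)
  finally have W: "Im W = 0"
    by (metis add.right_neutral cancel_comm_monoid_add_class.diff_cancel complex_cnj cnj.sel(2) equation_minus_iff neg_equal_zero)
  have "(\<Sum>k<n. cnj (u k) * v k) = (\<Sum>k<n. cnj (u k) * ((\<Sum>i<n. of_real (A k i) * u i) - z * u k))"
    using eq by (intro sum.cong refl) (auto simp: shifted_eq_def)
  also have "\<dots> = W - z * (\<Sum>k<n. u k * cnj (u k))"
    by (simp add: W_def algebra_simps sum_subtractf sum_distrib_left)
  also have "(\<Sum>k<n. u k * cnj (u k)) = of_real (\<Sum>k<n. (cmod (u k))\<^sup>2)"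
    by (simp only: complex_norm_square of_real_sum)
  finally show ?thesis using W by simp
qed

text \<open>The energy identity and Cauchy-Schwarz give \<open>Im z |u|^2 <= |u| |v|\<close>. This
  is the operator norm bound \<open>1 / Im z\<close>, obtained without diagonalizing
  \<open>A\<close>.\<close>

lemma shifted_eq_norm:
  assumes sym: "\<And>k l. k < n \<Longrightarrow> l < n \<Longrightarrow> A k l = A l k"
    and eq: "shifted_eq n A z u v" and z: "Im z > 0"
  shows "(\<Sum>k<n. (cmod (u k))\<^sup>2) \<le> (\<Sum>k<n. (cmod (v k))\<^sup>2) / (Im z)\<^sup>2"
proof -
  define U where "U = (\<Sum>k<n. (cmod (u k))\<^sup>2)"
  define V where "V = (\<Sum>k<n. (cmod (v k))\<^sup>2)"
  have U0: "U \<ge> 0" by (simp add: U_def sum_nonneg)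
  have "Im z * U = \<bar>Im (\<Sum>k<n. cnj (u k) * v k)\<bar>"
    using shifted_eq_energy[OF sym eq] z U0 by (simp add: U_def abs_mult)
  also have "\<dots> \<le> cmod (\<Sum>k<n. cnj (u k) * v k)" by (rule abs_Im_le_cmod)
  finally have "(Im z * U)\<^sup>2 \<le> (cmod (\<Sum>k<n. cnj (u k) * v k))\<^sup>2"
    using z U0 by (intro power_mono) auto
  also have "\<dots> \<le> U * V"
    using cmod_sum_mult_power2_le[of "\<lambda>k. cnj (u k)" v "{..<n}"] by (simp add: U_def V_def)
  finally have "U * ((Im z)\<^sup>2 * U) \<le> U * V" by (simp add: power2_eq_square algebra_simps)
  then have "(Im z)\<^sup>2 * U \<le> V \<or> U = 0"
    using U0 by (auto simp: mult_le_cancel_left)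
  moreover have "V \<ge> 0" by (simp add: V_def sum_nonneg)
  ultimately have "U \<le> V / (Im z)\<^sup>2"
    using z by (auto simp: field_simps)
  then show ?thesis by (simp add: U_def V_def)
qed

text \<open>The difference of two solutions solves the homogeneous system, whose norm bound is zero.
  Besides uniqueness of resolvents, this later gives their existence.\<close>

lemma shifted_eq_unique:
  assumes sym: "\<And>k l. k < n \<Longrightarrow> l < n \<Longrightarrow> A k l = A l k"
    and eq: "shifted_eq n A z u v" "shifted_eq n A z u' v" and z: "Im z > 0" and k: "k < n"
  shows "u k = u' k"
proof -
  have "shifted_eq n A z (\<lambda>k. u k - u' k) (\<lambda>k. 0)"
    using eq by (auto simp: shifted_eq_def algebra_simps sum_subtractf)
  from shifted_eq_norm[OF sym this z]
  have "(\<Sum>k<n. (cmod (u k - u' k))\<^sup>2) \<le> 0" by simp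
  then have "(\<Sum>k<n. (cmod (u k - u' k))\<^sup>2) = 0"
    by (intro antisym sum_nonneg) auto
  then show ?thesis using k by (subst (asm) sum_nonneg_eq_0_iff) auto
qed

text \<open>\<open>G\<close> is the inverse of \<open>A - z\<close>, with matrices as functions restricted to indices below \<open>n\<close>.\<close>

locale resolvent_fun =
  fixes n :: nat and A :: "nat \<Rightarrow> nat \<Rightarrow> real" and z :: complex and G :: "nat \<Rightarrow> nat \<Rightarrow> complex"
  assumes sym: "\<And>k l. k < n \<Longrightarrow> l < n \<Longrightarrow> A k l = A l k"
    and Im_z: "Im z > 0"
    and inv: "\<And>k l. k < n \<Longrightarrow> l < n \<Longrightarrow>
      (\<Sum>i<n. of_real (A k i) * G i l) - z * G k l = (if k = l then 1 else 0)"
begin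

definition app :: "(nat \<Rightarrow> complex) \<Rightarrow> nat \<Rightarrow> complex" where
  "app v k = (\<Sum>l<n. G k l * v l)"

lemma shifted_eq_app: "shifted_eq n A z (app v) v"
  unfolding shifted_eq_def
proof safe
  fix k assume k: "k < n"
  have "(\<Sum>i<n. of_real (A k i) * app v i) - z * app v k
      = (\<Sum>l<n. ((\<Sum>i<n. of_real (A k i) * G i l) - z * G k l) * v l)"
    unfolding app_def sum_distrib_left sum_distrib_right left_diff_distrib sum_subtractf
    by (subst sum.swap) (simp add: ac_simps)
  also have "\<dots> = (\<Sum>l<n. (if k = l then 1 else 0) * v l)"
    using k by (intro sum.cong refl) (simp add: inv)
  also have "\<dots> = v k" using k by (rule sum_delta_mult)
  finally show "(\<Sum>i<n. of_real (A k i) * app v i) - z * app v k = v k" .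
qed

lemma shifted_eq_column: "l < n \<Longrightarrow> shifted_eq n A z (\<lambda>k. G k l) (\<lambda>k. if k = l then 1 else 0)"
  by (simp add: shifted_eq_def inv)

text \<open>With \<open>B = A - z\<close>, which is complex symmetric but not Hermitian,
  \<open>G^T B G\<close> is evaluated in both orders. Only \<open>B G = 1\<close> is available at
  this point.\<close>

lemma symG: assumes k: "k < n" and l: "l < n" shows "G k l = G l k"
proof -
  define B where "B k i = of_real (A k i) - (if k = i then z else 0)" for k i
  have B: "(\<Sum>i<n. B k i * G i l) = (if k = l then 1 else 0)" if "k < n" "l < n" for k l
  proof -
    have "(\<Sum>i<n. B k i * G i l) = (\<Sum>i<n. of_real (A k i) * G i l - (if k = i then z * G i l else 0))"
      by (intro sum.cong refl) (simp add: B_def algebra_simps)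
    also have "\<dots> = (\<Sum>i<n. of_real (A k i) * G i l) - z * G k l"
      using that by (simp add: sum_subtractf)
    finally show ?thesis by (simp add: inv that)
  qed
  have Bs: "B i j = B j i" if "i < n" "j < n" for i j
    using sym that by (auto simp: B_def)
  have "(\<Sum>i<n. G i l * (\<Sum>j<n. B i j * G j k)) = (\<Sum>i<n. G i l * (if i = k then 1 else 0))"
    using k l by (intro sum.cong refl) (simp add: B)
  then have 1: "(\<Sum>i<n. G i l * (\<Sum>j<n. B i j * G j k)) = G k l"
    using k by (simp add: sum_delta_mult)
  have "(\<Sum>i<n. G i l * (\<Sum>j<n. B i j * G j k)) = (\<Sum>j<n. G j k * (\<Sum>i<n. B j i * G i l))"
    unfolding sum_distrib_left by (subst sum.swap) (auto intro!: sum.cong simp: Bs ac_simps)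
  also have "\<dots> = (\<Sum>j<n. G j k * (if j = l then 1 else 0))"
    using k l by (intro sum.cong refl) (simp add: B)
  also have "\<dots> = G l k" using l by (rule sum_delta_mult)
  finally show ?thesis using 1 by simp
qed

lemma app_norm: "(\<Sum>k<n. (cmod (app v k))\<^sup>2) \<le> (\<Sum>k<n. (cmod (v k))\<^sup>2) / (Im z)\<^sup>2"
  by (rule shifted_eq_norm[OF sym shifted_eq_app Im_z])

lemma column_norm: assumes "l < n" shows "(\<Sum>k<n. (cmod (G k l))\<^sup>2) \<le> 1 / (Im z)\<^sup>2"
proof -
  have "(\<Sum>k<n. (cmod (if k = l then 1 else 0 :: complex))\<^sup>2) = (\<Sum>k<n. if k = l then 1 else 0)"
    by (intro sum.cong) auto
  then show ?thesis
    using shifted_eq_norm[OF sym shifted_eq_column[OF assms] Im_z] assms by simp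
qed

lemma row_norm: "k < n \<Longrightarrow> (\<Sum>l<n. (cmod (G k l))\<^sup>2) \<le> 1 / (Im z)\<^sup>2"
  using column_norm[of k] symG[of _ k] by simp

lemma entry_norm: assumes "k < n" "l < n" shows "cmod (G k l) \<le> 1 / Im z"
proof -
  have "(cmod (G k l))\<^sup>2 \<le> (\<Sum>k<n. (cmod (G k l))\<^sup>2)"
    using assms by (intro member_le_sum) auto
  also have "\<dots> \<le> (1 / Im z)\<^sup>2" using column_norm[OF assms(2)] by (simp add: power_divide)
  finally show ?thesis using Im_z by (simp add: power2_le_iff_abs_le)
qed

definition trace :: complex where "trace = (\<Sum>k<n. G k k)"
text \<open>Squares without modulus: by the symmetry of \<open>G\<close> this is the trace of
  \<open>G^2\<close>, not the Frobenius norm.\<close>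

definition trace_sq :: complex where "trace_sq = (\<Sum>k<n. \<Sum>l<n. (G k l)\<^sup>2)"
definition diag_sq :: complex where "diag_sq = (\<Sum>k<n. (G k k)\<^sup>2)"

lemma trace_norm: "cmod trace \<le> real n / Im z"
proof -
  have "cmod trace \<le> (\<Sum>k<n. 1 / Im z)"
    unfolding trace_def by (rule order_trans[OF norm_sum sum_mono]) (simp add: entry_norm)
  then show ?thesis by simp
qed

lemma frobenius_norm: "(\<Sum>k<n. \<Sum>l<n. (cmod (G k l))\<^sup>2) \<le> real n / (Im z)\<^sup>2"
  using sum_mono[of "{..<n}" "\<lambda>k. \<Sum>l<n. (cmod (G k l))\<^sup>2" "\<lambda>k. 1 / (Im z)\<^sup>2"] row_norm by simp

lemma trace_sq_norm: "cmod trace_sq \<le> real n / (Im z)\<^sup>2"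
proof -
  have "cmod trace_sq \<le> (\<Sum>k<n. \<Sum>l<n. (cmod (G k l))\<^sup>2)"
    unfolding trace_sq_def
    by (intro order_trans[OF norm_sum sum_mono]) (simp add: norm_power)
  then show ?thesis using frobenius_norm by linarith
qed

lemma diag_sq_norm: "cmod diag_sq \<le> real n / (Im z)\<^sup>2"
proof -
  have "cmod diag_sq \<le> (\<Sum>k<n. (1 / Im z)\<^sup>2)"
    unfolding diag_sq_def
    by (rule order_trans[OF norm_sum sum_mono]) (auto simp: norm_power intro!: power_mono entry_norm)
  then show ?thesis by (simp add: power_divide)
qed

end

lemma resolvent_fun_unique:
  assumes "resolvent_fun n A z G" "resolvent_fun n A z G'" "k < n" "l < n"
  shows "G k l = G' k l"
proof -
  interpret G: resolvent_fun n A z G by fact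
  interpret G': resolvent_fun n A z G' by fact
  show ?thesis
    using shifted_eq_unique[OF G.sym G.shifted_eq_column[OF assms(4)] G'.shifted_eq_column[OF assms(4)] G.Im_z assms(3)] .
qed

lemma resolvent_fun_cong:
  assumes "resolvent_fun n A z G" "\<And>k l. k < n \<Longrightarrow> l < n \<Longrightarrow> A k l = B k l"
    "\<And>k l. k < n \<Longrightarrow> l < n \<Longrightarrow> G k l = G' k l"
  shows "resolvent_fun n B z G'"
  using assms unfolding resolvent_fun_def by simp

text \<open>By the resolvent identity \<open>G2 - G1 = h G1 G2\<close>, the remainder is
  \<open>h Tr (G1 (G2 - G1))\<close>, and the identity is used once more inside the trace. The order
  of the imaginary parts lets every bound be stated with \<open>Im z1\<close>.\<close>

lemma resolvent_trace_difference:
  assumes "resolvent_fun n A z1 G1" "resolvent_fun n A z2 G2" and le: "Im z1 \<le> Im z2"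
  shows "cmod (resolvent_fun.trace n G2 - resolvent_fun.trace n G1 - (z2 - z1) * resolvent_fun.trace_sq n G1)
      \<le> (cmod (z2 - z1))\<^sup>2 * real n / (Im z1) ^ 3"
proof -
  interpret G1: resolvent_fun n A z1 G1 by fact
  interpret G2: resolvent_fun n A z2 G2 by fact
  define h where "h = z2 - z1"
  have eq: "G2 k l - G1 k l = h * G1.app (\<lambda>i. G2 i l) k" if "k < n" "l < n" for k l
  proof -
    \<comment> \<open>The resolvent identity follows by uniqueness: both sides solve the system at
      \<open>z1\<close> with right-hand side \<open>e_l + h G2 e_l\<close>.\<close>
    have "shifted_eq n A z1 (\<lambda>k. G1 k l + h * G1.app (\<lambda>i. G2 i l) k)
            (\<lambda>k. (if k = l then 1 else 0) + h * G2 k l)"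
      using G1.shifted_eq_column[OF that(2)] G1.shifted_eq_app[of "\<lambda>i. G2 i l"]
      unfolding shifted_eq_def
      by (simp add: distrib_left sum.distrib mult.left_commute[of _ h] flip: sum_distrib_left)
         (auto simp: algebra_simps)
    moreover have "shifted_eq n A z1 (\<lambda>k. G2 k l) (\<lambda>k. (if k = l then 1 else 0) + h * G2 k l)"
      using G2.shifted_eq_column[OF that(2)] unfolding shifted_eq_def h_def
      by (simp add: algebra_simps)
    ultimately have "G1 k l + h * G1.app (\<lambda>i. G2 i l) k = G2 k l"
      by (intro shifted_eq_unique[OF G1.sym _ _ G1.Im_z that(1)])
    then show ?thesis by (simp add: algebra_simps)
  qed
  have "G2.trace - G1.trace = h * (\<Sum>k<n. \<Sum>i<n. G1 k i * G2 i k)"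
    by (simp add: G1.trace_def G2.trace_def eq G1.app_def sum_distrib_left flip: sum_subtractf)
  moreover have "G1.trace_sq = (\<Sum>k<n. \<Sum>i<n. G1 k i * G1 i k)"
    unfolding G1.trace_sq_def by (intro sum.cong refl) (simp add: power2_eq_square G1.symG)
  ultimately have diff: "G2.trace - G1.trace - h * G1.trace_sq
     = h * (\<Sum>k<n. \<Sum>i<n. G1 k i * (G2 i k - G1 i k))"
    by (simp add: right_diff_distrib sum_subtractf)
  have bound: "cmod (\<Sum>i<n. G1 k i * (G2 i k - G1 i k)) \<le> cmod h / (Im z1) ^ 3" if k: "k < n" for k
  proof -
    have "(\<Sum>i<n. (cmod (G2 i k - G1 i k))\<^sup>2) = (cmod h)\<^sup>2 * (\<Sum>i<n. (cmod (G1.app (\<lambda>i. G2 i k) i))\<^sup>2)"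
      using k by (simp add: eq norm_mult power_mult_distrib sum_distrib_left)
    also have "\<dots> \<le> (cmod h)\<^sup>2 * ((\<Sum>i<n. (cmod (G2 i k))\<^sup>2) / (Im z1)\<^sup>2)"
      by (intro mult_left_mono G1.app_norm) auto
    also have "\<dots> \<le> (cmod h)\<^sup>2 * ((1 / (Im z2)\<^sup>2) / (Im z1)\<^sup>2)"
      by (intro mult_left_mono divide_right_mono G2.column_norm k) auto
    also have "\<dots> \<le> (cmod h)\<^sup>2 * ((1 / (Im z1)\<^sup>2) / (Im z1)\<^sup>2)"
      using le G1.Im_z by (intro mult_left_mono divide_right_mono divide_left_mono power_mono) auto
    finally have 1: "(\<Sum>i<n. (cmod (G2 i k - G1 i k))\<^sup>2) \<le> (cmod h)\<^sup>2 * ((1 / (Im z1)\<^sup>2) / (Im z1)\<^sup>2)" .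
    have "(cmod (\<Sum>i<n. G1 k i * (G2 i k - G1 i k)))\<^sup>2
        \<le> (\<Sum>i<n. (cmod (G1 k i))\<^sup>2) * (\<Sum>i<n. (cmod (G2 i k - G1 i k))\<^sup>2)"
      by (rule cmod_sum_mult_power2_le)
    also have "\<dots> \<le> (1 / (Im z1)\<^sup>2) * ((cmod h)\<^sup>2 * ((1 / (Im z1)\<^sup>2) / (Im z1)\<^sup>2))"
      by (intro mult_mono 1 G1.row_norm k sum_nonneg) auto
    also have "\<dots> = (cmod h / (Im z1) ^ 3)\<^sup>2"
      by (simp add: power_divide power2_eq_square power3_eq_cube)
    finally show ?thesis
      by (rule power2_le_imp_le) (use G1.Im_z in auto)
  qed
  have "cmod (h * (\<Sum>k<n. \<Sum>i<n. G1 k i * (G2 i k - G1 i k))) \<le> cmod h * (\<Sum>k<n. cmod h / (Im z1) ^ 3)"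
    unfolding norm_mult using bound
    by (intro mult_left_mono order_trans[OF norm_sum sum_mono]) auto
  then show ?thesis unfolding diff[symmetric] by (simp add: h_def power2_eq_square ac_simps)
qed

section \<open>Rank-one perturbations\<close>

context resolvent_fun
begin

text \<open>The energy identity for \<open>u = G x\<close>. Since \<open>x\<close> is real, the
  pairing there is the conjugate of \<open>x^T G x\<close>, which turns the sign positive.\<close>

lemma quadratic_Im:
  fixes x :: "nat \<Rightarrow> real"
  shows "Im (\<Sum>k<n. of_real (x k) * app (\<lambda>k. of_real (x k)) k)
    = Im z * (\<Sum>k<n. (cmod (app (\<lambda>k. of_real (x k)) k))\<^sup>2)"
proof -
  define u where "u = app (\<lambda>k. of_real (x k))"
  have "Im (\<Sum>k<n. cnj (u k) * of_real (x k)) = - Im z * (\<Sum>k<n. (cmod (u k))\<^sup>2)"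
    using shifted_eq_energy[OF sym shifted_eq_app[of "\<lambda>k. of_real (x k)"]] by (simp add: u_def)
  moreover have "(\<Sum>k<n. cnj (u k) * of_real (x k)) = cnj (\<Sum>k<n. of_real (x k) * u k)"
    by (simp add: ac_simps)
  ultimately have "Im (cnj (\<Sum>k<n. of_real (x k) * u k)) = - Im z * (\<Sum>k<n. (cmod (u k))\<^sup>2)"
    by (simp only:)
  then have "Im (\<Sum>k<n. of_real (x k) * u k) = Im z * (\<Sum>k<n. (cmod (u k))\<^sup>2)"
    by (simp only: cnj.simps)
  then show ?thesis unfolding u_def .
qed

lemma bilinear_norm:
  "cmod (\<Sum>k<n. v k * app v k) \<le> (\<Sum>k<n. (cmod (v k))\<^sup>2) / Im z"
proof -
  have "(cmod (\<Sum>k<n. v k * app v k))\<^sup>2 \<le> (\<Sum>k<n. (cmod (v k))\<^sup>2) * (\<Sum>k<n. (cmod (app v k))\<^sup>2)"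
    by (rule cmod_sum_mult_power2_le)
  also have "\<dots> \<le> (\<Sum>k<n. (cmod (v k))\<^sup>2) * ((\<Sum>k<n. (cmod (v k))\<^sup>2) / (Im z)\<^sup>2)"
    by (intro mult_left_mono app_norm sum_nonneg) auto
  also have "\<dots> = ((\<Sum>k<n. (cmod (v k))\<^sup>2) / Im z)\<^sup>2"
    by (simp add: power_divide power2_eq_square)
  finally show ?thesis
    by (rule power2_le_imp_le) (use Im_z in \<open>auto intro!: divide_nonneg_pos sum_nonneg\<close>)
qed

end

locale rank_one_update = resolvent_fun +
  fixes a :: real and x :: "nat \<Rightarrow> real"
  assumes a_pos: "a > 0"
begin

text \<open>Here \<open>u = G x\<close>, \<open>q = x^T G x\<close> and
  \<open>s = x^T G^2 x\<close>, with no conjugation because \<open>G\<close> is complex symmetric.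
  \<open>\<beta>\<close> is the Sherman-Morrison factor and \<open>G'\<close> the inverse after
  adding \<open>a x x^T\<close>.\<close>

definition u where "u = app (\<lambda>k. of_real (x k))"
definition q where "q = (\<Sum>k<n. of_real (x k) * u k)"
definition s where "s = (\<Sum>k<n. (u k)\<^sup>2)"
definition normsq where "normsq = (\<Sum>k<n. (x k)\<^sup>2)"
definition \<beta> where "\<beta> = of_real a / (1 + of_real a * q)"
definition G' where "G' = (\<lambda>k l. G k l - \<beta> * u k * u l)"
definition unorm where "unorm = (\<Sum>k<n. (cmod (u k))\<^sup>2)"

lemma normsq_nonneg: "normsq \<ge> 0" by (simp add: normsq_def sum_nonneg)

lemma Im_q: "Im q = Im z * unorm"
  unfolding q_def u_def unorm_def by (rule quadratic_Im)

lemma unorm_le: "unorm \<le> normsq / (Im z)\<^sup>2"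
  using app_norm[of "\<lambda>k. of_real (x k)"] by (simp add: unorm_def u_def normsq_def)

lemma q_le: "cmod q \<le> normsq / Im z"
  using bilinear_norm[of "\<lambda>k. of_real (x k)"] by (simp add: q_def u_def normsq_def)

lemma s_le_unorm: "cmod s \<le> unorm"
  unfolding s_def unorm_def by (rule order_trans[OF norm_sum]) (simp add: norm_power)

lemma s_le: "cmod s \<le> normsq / (Im z)\<^sup>2"
  using s_le_unorm unorm_le by linarith

lemma u_zero: assumes "unorm = 0" "k < n" shows "u k = 0"
  using assms unfolding unorm_def by (subst (asm) sum_nonneg_eq_0_iff) auto

text \<open>The imaginary part of the denominator is \<open>a Im z |u|^2\<close>. It vanishes only
  for \<open>u = 0\<close>, and then the denominator is 1.\<close>

lemma denom_nonzero: "1 + of_real a * q \<noteq> 0"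
proof
  assume *: "1 + of_real a * q = 0"
  then have "Im (1 + of_real a * q) = 0" by simp
  then have "unorm = 0" using Im_q a_pos Im_z by simp
  then have "q = 0" by (simp add: q_def u_zero)
  then show False using * by simp
qed

lemma a_unorm_le: "a * unorm * Im z \<le> cmod (1 + of_real a * q)"
proof -
  have "a * unorm * Im z = Im (1 + of_real a * q)" by (simp add: Im_q)
  also have "\<dots> \<le> cmod (1 + of_real a * q)" using abs_Im_le_cmod[of "1 + of_real a * q"] by linarith
  finally show ?thesis .
qed

text \<open>The denominator is at least its imaginary part, which contains the same
  \<open>|u|^2\<close>. All changes caused by one row are thereby bounded whatever the size of
  \<open>x\<close>.\<close>

lemma beta_unorm_le: "cmod \<beta> * unorm \<le> 1 / Im z"
proof -
  have "cmod (1 + of_real a * q) > 0" using denom_nonzero by simp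
  then show ?thesis
    using a_unorm_le Im_z a_pos unfolding \<beta>_def norm_divide by (simp add: field_simps)
qed

lemma update: "resolvent_fun n (\<lambda>k l. A k l + a * x k * x l) z G'"
proof
  show "A k l + a * x k * x l = A l k + a * x l * x k" if "k < n" "l < n" for k l
    using sym that by simp
  show "Im z > 0" by (rule Im_z)
  fix k l assume kl: "k < n" "l < n"
  have xG: "(\<Sum>i<n. of_real (x i) * G i l) = u l"
    using kl unfolding u_def app_def by (intro sum.cong refl) (simp add: symG)
  have Au: "(\<Sum>i<n. of_real (A k i) * u i) = of_real (x k) + z * u k"
    using shifted_eq_app[of "\<lambda>k. of_real (x k)"] kl by (simp add: shifted_eq_def u_def algebra_simps)
  have AG: "(\<Sum>i<n. of_real (A k i) * G i l) = (if k = l then 1 else 0) + z * G k l"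
    using inv[OF kl] by (simp add: algebra_simps)
  have "(\<Sum>i<n. of_real (A k i + a * x k * x i) * G' i l) =
      (\<Sum>i<n. of_real (A k i) * G i l) - \<beta> * u l * (\<Sum>i<n. of_real (A k i) * u i)
      + of_real a * of_real (x k) * (\<Sum>i<n. of_real (x i) * G i l)
      - \<beta> * of_real a * of_real (x k) * u l * (\<Sum>i<n. of_real (x i) * u i)"
    by (simp add: G'_def sum_distrib_left algebra_simps sum.distrib sum_subtractf)
  also have "\<dots> = (if k = l then 1 else 0) + z * G k l - \<beta> * u l * (of_real (x k) + z * u k)
      + of_real a * of_real (x k) * u l - \<beta> * of_real a * of_real (x k) * u l * q"
    unfolding AG Au xG q_def ..
  also have "\<dots> = (if k = l then 1 else 0) + z * G' k l + of_real (x k) * u l * (of_real a - \<beta> * (1 + of_real a * q))"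
    by (simp add: G'_def algebra_simps)
  also have "of_real a - \<beta> * (1 + of_real a * q) = 0"
    using denom_nonzero by (simp add: \<beta>_def)
  finally show "(\<Sum>i<n. of_real (A k i + a * x k * x i) * G' i l) - z * G' k l = (if k = l then 1 else 0)"
    by simp
qed

sublocale upd: resolvent_fun n "\<lambda>k l. A k l + a * x k * x l" z G' by (rule update)

lemma trace_update: "upd.trace = trace - \<beta> * s"
  unfolding upd.trace_def trace_def by (simp add: G'_def s_def sum_subtractf sum_distrib_left power2_eq_square ac_simps)

lemma quadratic_update:
  "(\<Sum>k<n. of_real (x k) * upd.app (\<lambda>k. of_real (x k)) k) = q / (1 + of_real a * q)"
proof -
  have "upd.app (\<lambda>k. of_real (x k)) k = u k - \<beta> * q * u k" for k
  proof -
    have "upd.app (\<lambda>k. of_real (x k)) k = (\<Sum>l<n. G k l * of_real (x l)) - \<beta> * (\<Sum>l<n. of_real (x l) * u l) * u k"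
      unfolding upd.app_def by (simp add: G'_def left_diff_distrib right_diff_distrib sum_subtractf sum_distrib_left sum_distrib_right ac_simps)
    then show ?thesis unfolding q_def by (simp add: u_def app_def)
  qed
  then have "(\<Sum>k<n. of_real (x k) * upd.app (\<lambda>k. of_real (x k)) k) = q - \<beta> * q * q"
    by (simp add: right_diff_distrib sum_subtractf q_def sum_distrib_left ac_simps)
  also have "\<dots> = q / (1 + of_real a * q)"
    using denom_nonzero by (simp add: \<beta>_def field_simps)
  finally show ?thesis .
qed

text \<open>The quotient is the quadratic form of the updated resolvent, so the general bound for
  quadratic forms applies even where the denominator is small.\<close>

lemma quotient_le: "cmod (q / (1 + of_real a * q)) \<le> normsq / Im z"
  using upd.bilinear_norm[of "\<lambda>k. of_real (x k)"] quadratic_update by (simp add: normsq_def)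

lemma beta_s_le: "cmod (\<beta> * s) \<le> 1 / Im z"
proof -
  have "cmod \<beta> * cmod s \<le> cmod \<beta> * unorm" by (intro mult_left_mono s_le_unorm) auto
  then show ?thesis using beta_unorm_le by (simp add: norm_mult)
qed

lemma entry_update_le: assumes "k < n" shows "cmod (\<beta> * (u k)\<^sup>2) \<le> 1 / Im z"
proof -
  have "(cmod (u k))\<^sup>2 \<le> unorm" unfolding unorm_def using assms by (intro member_le_sum) auto
  then have "cmod \<beta> * (cmod (u k))\<^sup>2 \<le> cmod \<beta> * unorm" by (intro mult_left_mono) auto
  then show ?thesis using beta_unorm_le by (simp add: norm_mult norm_power)
qed

text \<open>The change is \<open>- 2 \<beta> u^T G u + (\<beta> s)^2\<close>, and each term carries
  the factor \<open>|\<beta>| |u|^2\<close> that \<open>beta_unorm_le\<close> controls.\<close>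

lemma trace_sq_update: "cmod (upd.trace_sq - trace_sq) \<le> 3 / (Im z)\<^sup>2"
proof -
  define w where "w = (\<Sum>k<n. u k * app u k)"
  have ss: "(\<Sum>k<n. \<Sum>l<n. (u k)\<^sup>2 * (u l)\<^sup>2) = s\<^sup>2"
    by (simp add: s_def power2_eq_square sum_product)
  have "upd.trace_sq - trace_sq = (\<Sum>k<n. \<Sum>l<n. - 2 * \<beta> * (u k * (G k l * u l)) + \<beta>\<^sup>2 * ((u k)\<^sup>2 * (u l)\<^sup>2))"
    unfolding upd.trace_sq_def trace_sq_def sum_subtractf[symmetric]
    by (intro sum.cong refl) (simp add: G'_def power2_eq_square algebra_simps)
  also have "\<dots> = - 2 * \<beta> * w + \<beta>\<^sup>2 * s\<^sup>2"
    by (simp only: sum.distrib w_def app_def sum_distrib_left flip: ss)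
  finally have eq: "upd.trace_sq - trace_sq = - 2 * \<beta> * w + (\<beta> * s)\<^sup>2"
    by (simp add: power_mult_distrib)
  have "cmod w \<le> unorm / Im z"
    unfolding w_def unorm_def by (rule bilinear_norm)
  then have "cmod \<beta> * cmod w \<le> cmod \<beta> * (unorm / Im z)" by (intro mult_left_mono) auto
  also have "\<dots> = (cmod \<beta> * unorm) / Im z" by simp
  also have "\<dots> \<le> (1 / Im z) / Im z" using Im_z by (intro divide_right_mono beta_unorm_le) auto
  finally have 1: "cmod (- 2 * \<beta> * w) \<le> 2 / (Im z)\<^sup>2" by (simp add: norm_mult power2_eq_square)
  have "(cmod (\<beta> * s))\<^sup>2 \<le> (1 / Im z)\<^sup>2" by (intro power_mono beta_s_le) auto
  then have 2: "cmod ((\<beta> * s)\<^sup>2) \<le> 1 / (Im z)\<^sup>2" by (simp add: norm_power power_divide)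
  show ?thesis unfolding eq using norm_triangle_ineq[of "- 2 * \<beta> * w" "(\<beta> * s)\<^sup>2"] 1 2
    by (simp add: add_divide_distrib[symmetric])
qed

lemma diag_sq_update: "cmod (upd.diag_sq - diag_sq) \<le> 2 / (Im z)\<^sup>2"
proof -
  have eq: "upd.diag_sq - diag_sq = (\<Sum>k<n. (\<beta> * (u k)\<^sup>2) * - (G' k k + G k k))"
    unfolding upd.diag_sq_def diag_sq_def sum_subtractf[symmetric]
    by (intro sum.cong refl) (simp add: G'_def power2_eq_square algebra_simps)
  have "cmod (upd.diag_sq - diag_sq) \<le> (\<Sum>k<n. cmod \<beta> * (cmod (u k))\<^sup>2 * (2 / Im z))"
    unfolding eq
  proof (rule order_trans[OF norm_sum sum_mono])
    fix k assume "k \<in> {..<n}"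
    then have "cmod (G' k k + G k k) \<le> 2 / Im z"
      using upd.entry_norm[of k k] entry_norm[of k k] norm_triangle_ineq[of "G' k k" "G k k"] by simp
    then show "cmod ((\<beta> * (u k)\<^sup>2) * - (G' k k + G k k)) \<le> cmod \<beta> * (cmod (u k))\<^sup>2 * (2 / Im z)"
      unfolding norm_mult norm_power norm_minus_cancel by (intro mult_left_mono) auto
  qed
  also have "\<dots> = cmod \<beta> * unorm * (2 / Im z)"
    unfolding unorm_def by (subst sum_distrib_left, subst sum_distrib_right) (rule refl)
  also have "\<dots> \<le> (1 / Im z) * (2 / Im z)"
    using Im_z by (intro mult_right_mono[OF beta_unorm_le]) auto
  finally show ?thesis by (simp add: power2_eq_square)
qed

section \<open>Taylor remainders of the rank-one update\<close>

lemma inverse_denom_le: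
  assumes "a * cmod q \<le> 1 / 2" shows "cmod (1 / (1 + of_real a * q)) \<le> 2"
proof -
  have "cmod (of_real a * q) \<le> 1 / 2" using assms a_pos by (simp add: norm_mult)
  then have "cmod (1 + of_real a * q) \<ge> 1 / 2"
    using norm_triangle_ineq4[of "1 + of_real a * q" "of_real a * q"] by simp
  then have "1 / cmod (1 + of_real a * q) \<le> 1 / (1 / 2)" by (intro divide_left_mono) auto
  then show ?thesis by (simp add: norm_divide)
qed

text \<open>Equal to \<open>a^2 q s / (1 + a q)\<close> and \<open>a^2 q^3 / (1 + a q)\<close>: the
  errors of replacing the trace change \<open>\<beta> s\<close> by \<open>a s\<close> and the
  updated quadratic form by \<open>q - a q^2\<close>.\<close>

definition R4 where "R4 = of_real a * s - \<beta> * s"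
definition R3 where "R3 = q / (1 + of_real a * q) - q + of_real a * q\<^sup>2"

text \<open>For \<open>\<bar>a q\<bar> \<le> 1/2\<close> these are Taylor remainders; otherwise \<open>1 < 2 a normsq / Im z\<close>,
  which is multiplied into the a priori bounds on the single terms.\<close>

lemma large_q: assumes "\<not> a * cmod q \<le> 1 / 2" shows "1 \<le> 2 * a * normsq / Im z"
proof -
  have "a * cmod q \<le> a * (normsq / Im z)" using a_pos by (intro mult_left_mono q_le) auto
  then show ?thesis using assms by simp
qed

lemma R4_small: assumes "a * cmod q \<le> 1 / 2"
  shows "cmod R4 \<le> 2 * a * (a * cmod q) * cmod s"
proof -
  have "R4 = of_real a * (of_real a * q) * s * (1 / (1 + of_real a * q))"
    using denom_nonzero by (simp add: R4_def \<beta>_def field_simps)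
  also have "cmod \<dots> = a * (a * cmod q) * cmod s * cmod (1 / (1 + of_real a * q))"
    using a_pos unfolding norm_mult by simp
  also have "\<dots> \<le> a * (a * cmod q) * cmod s * 2"
    using a_pos by (intro mult_left_mono inverse_denom_le assms) auto
  finally show ?thesis by simp
qed

lemma R4_le1: "cmod R4 \<le> 3 * a * normsq / (Im z)\<^sup>2"
proof (cases "a * cmod q \<le> 1 / 2")
  case True
  have "2 * a * (a * cmod q) * cmod s \<le> 2 * a * (1 / 2) * (normsq / (Im z)\<^sup>2)"
    using a_pos True by (intro mult_mono s_le) auto
  then have "cmod R4 \<le> a * normsq / (Im z)\<^sup>2" using R4_small[OF True] by simp
  moreover have "0 \<le> a * normsq / (Im z)\<^sup>2" using a_pos normsq_nonneg by simp
  ultimately show ?thesis by simp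
next
  case False
  have "cmod R4 \<le> a * cmod s + cmod (\<beta> * s)"
    unfolding R4_def using norm_triangle_ineq4[of "of_real a * s" "\<beta> * s"] a_pos by (simp add: norm_mult)
  also have "a * cmod s \<le> a * (normsq / (Im z)\<^sup>2)" using a_pos by (intro mult_left_mono s_le) auto
  also have "cmod (\<beta> * s) \<le> (1 / Im z) * 1" using beta_s_le by simp
  also have "(1 / Im z) * 1 \<le> (1 / Im z) * (2 * a * normsq / Im z)"
    using Im_z by (intro mult_left_mono large_q False) auto
  finally show ?thesis by (simp add: power2_eq_square)
qed

lemma R4_le2: "cmod R4 \<le> 6 * a\<^sup>2 * normsq\<^sup>2 / (Im z) ^ 3"
proof (cases "a * cmod q \<le> 1 / 2")
  case True
  have "2 * a * (a * cmod q) * cmod s \<le> 2 * a * (a * (normsq / Im z)) * (normsq / (Im z)\<^sup>2)"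
    using a_pos Im_z normsq_nonneg by (intro mult_mono s_le q_le mult_nonneg_nonneg divide_nonneg_nonneg) auto
  also have "\<dots> = 2 * (a\<^sup>2 * normsq\<^sup>2 / (Im z) ^ 3)"
    by (simp add: power2_eq_square power3_eq_cube)
  finally have "cmod R4 \<le> 2 * (a\<^sup>2 * normsq\<^sup>2 / (Im z) ^ 3)" using R4_small[OF True] by simp
  moreover have "0 \<le> a\<^sup>2 * normsq\<^sup>2 / (Im z) ^ 3" using Im_z by simp
  ultimately show ?thesis by simp
next
  case False
  have "cmod R4 \<le> (3 * a * normsq / (Im z)\<^sup>2) * 1" using R4_le1 by simp
  also have "\<dots> \<le> (3 * a * normsq / (Im z)\<^sup>2) * (2 * a * normsq / Im z)"
    using a_pos normsq_nonneg by (intro mult_left_mono large_q False) auto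
  also have "\<dots> = 6 * a\<^sup>2 * normsq\<^sup>2 / (Im z) ^ 3"
    by (simp add: power2_eq_square power3_eq_cube)
  finally show ?thesis .
qed

lemma R3_eq: "R3 = (of_real a)\<^sup>2 * q ^ 3 * (1 / (1 + of_real a * q))"
proof -
  define D where "D = 1 + of_real a * q"
  have "D \<noteq> 0" unfolding D_def by (rule denom_nonzero)
  then have "R3 = (q - q * D + of_real a * q\<^sup>2 * D) / D"
    by (simp add: R3_def D_def[symmetric] add_divide_distrib diff_divide_distrib)
  also have "q - q * D + of_real a * q\<^sup>2 * D = (of_real a)\<^sup>2 * q ^ 3"
    by (simp add: D_def algebra_simps power2_eq_square power3_eq_cube)
  finally show ?thesis by (simp add: D_def)
qed

lemma R3_small: assumes "a * cmod q \<le> 1 / 2"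
  shows "cmod R3 \<le> 2 * a\<^sup>2 * cmod q ^ 3"
proof -
  have "cmod R3 = a\<^sup>2 * cmod q ^ 3 * cmod (1 / (1 + of_real a * q))"
    using a_pos unfolding R3_eq norm_mult norm_power by simp
  also have "\<dots> \<le> a\<^sup>2 * cmod q ^ 3 * 2"
    using a_pos by (intro mult_left_mono inverse_denom_le assms) auto
  finally show ?thesis by simp
qed

text \<open>Only the square of \<open>normsq\<close> appears, so this version is integrable under
  four moments of the entries; the price is the low order in \<open>a\<close>. \<open>R3_le2\<close>
  is for rows of bounded \<open>normsq / n\<close>.\<close>

lemma R3_le1: "cmod R3 \<le> 5 * a * normsq\<^sup>2 / (Im z)\<^sup>2"
proof (cases "a * cmod q \<le> 1 / 2")
  case True
  have "2 * a\<^sup>2 * cmod q ^ 3 = 2 * a * (a * cmod q) * (cmod q)\<^sup>2"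
    by (simp add: power2_eq_square power3_eq_cube)
  also have "\<dots> \<le> 2 * a * (1 / 2) * (normsq / Im z)\<^sup>2"
    using a_pos True by (intro mult_mono power_mono q_le) auto
  finally have "cmod R3 \<le> a * normsq\<^sup>2 / (Im z)\<^sup>2" using R3_small[OF True] by (simp add: power_divide)
  moreover have "0 \<le> a * normsq\<^sup>2 / (Im z)\<^sup>2" using a_pos by simp
  ultimately show ?thesis by simp
next
  case False
  have "cmod R3 \<le> cmod (q / (1 + of_real a * q)) + cmod q + a * (cmod q)\<^sup>2"
    unfolding R3_def using norm_triangle_ineq[of "q / (1 + of_real a * q) - q" "of_real a * q\<^sup>2"]
      norm_triangle_ineq4[of "q / (1 + of_real a * q)" q] a_pos by (simp add: norm_mult norm_power)
  also have "\<dots> \<le> normsq / Im z * 1 + normsq / Im z * 1 + a * (normsq / Im z)\<^sup>2"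
    using a_pos quotient_le q_le by (intro add_mono mult_left_mono power_mono) auto
  also have "\<dots> \<le> normsq / Im z * (2 * a * normsq / Im z) + normsq / Im z * (2 * a * normsq / Im z) + a * (normsq / Im z)\<^sup>2"
    using Im_z normsq_nonneg by (intro add_mono mult_left_mono large_q False order_refl) auto
  also have "\<dots> = 5 * a * normsq\<^sup>2 / (Im z)\<^sup>2"
    by (simp add: power2_eq_square)
  finally show ?thesis .
qed

lemma R3_le2: "cmod (R3 - (of_real a)\<^sup>2 * q ^ 3) \<le> 22 * a ^ 3 * normsq ^ 4 / (Im z) ^ 4"
proof (cases "a * cmod q \<le> 1 / 2")
  case True
  have "R3 - (of_real a)\<^sup>2 * q ^ 3 = - ((of_real a) ^ 3 * q ^ 4 * (1 / (1 + of_real a * q)))"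
    using denom_nonzero by (simp add: R3_eq field_simps power2_eq_square power3_eq_cube power4_eq_xxxx)
  then have "cmod (R3 - (of_real a)\<^sup>2 * q ^ 3) = a ^ 3 * cmod q ^ 4 * cmod (1 / (1 + of_real a * q))"
    using a_pos by (simp add: norm_mult norm_power norm_divide)
  also have "\<dots> \<le> a ^ 3 * (normsq / Im z) ^ 4 * 2"
    using a_pos by (intro mult_mono inverse_denom_le True power_mono q_le) auto
  also have "\<dots> = 2 * (a ^ 3 * normsq ^ 4 / (Im z) ^ 4)" by (simp add: power_divide)
  also have "\<dots> \<le> 22 * (a ^ 3 * normsq ^ 4 / (Im z) ^ 4)"
    using a_pos by (intro mult_right_mono) auto
  finally show ?thesis by simp
next
  case False
  have "cmod (R3 - (of_real a)\<^sup>2 * q ^ 3) \<le> cmod R3 + a\<^sup>2 * cmod q ^ 3"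
    using norm_triangle_ineq4[of R3 "(of_real a)\<^sup>2 * q ^ 3"] a_pos by (simp add: norm_mult norm_power)
  also have "\<dots> \<le> 5 * a * normsq\<^sup>2 / (Im z)\<^sup>2 * 1 + a\<^sup>2 * (normsq / Im z) ^ 3"
    using a_pos R3_le1 by (intro add_mono mult_left_mono power_mono q_le) auto
  also have "\<dots> \<le> 5 * a * normsq\<^sup>2 / (Im z)\<^sup>2 * (2 * a * normsq / Im z) + a\<^sup>2 * (normsq / Im z) ^ 3"
    using a_pos by (intro add_mono mult_left_mono large_q False order_refl) auto
  \<comment> \<open>The 11 is 10 + 1. A second factor from \<open>large_q\<close> raises the order
    to \<open>a ^ 3\<close> and doubles it to 22.\<close>
  also have "\<dots> = 11 * a\<^sup>2 * normsq ^ 3 / (Im z) ^ 3 * 1"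
    by (simp add: power2_eq_square power3_eq_cube)
  also have "\<dots> \<le> 11 * a\<^sup>2 * normsq ^ 3 / (Im z) ^ 3 * (2 * a * normsq / Im z)"
    using a_pos Im_z normsq_nonneg by (intro mult_left_mono large_q False) auto
  also have "\<dots> = 22 * a ^ 3 * normsq ^ 4 / (Im z) ^ 4"
    by (simp add: power2_eq_square power3_eq_cube power4_eq_xxxx)
  finally show ?thesis .
qed

text \<open>The assumption on \<open>a n\<close> makes \<open>a |q| > 1/2\<close> force
  \<open>normsq > 2 n\<close>. There the a priori bound is paid for by
  \<open>normsq <= 2 (normsq - n)\<close>, so the exceptional term lives on the tail event
  only.\<close>

lemma entry_update_sq_le:
  assumes k: "k < n" and n: "4 * a * real n \<le> Im z"
  shows "(cmod (\<beta> * (u k)\<^sup>2))\<^sup>2 \<le> 4 * a\<^sup>2 * cmod (u k) ^ 4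
    + (if \<bar>normsq - real n\<bar> > real n then 16 * a\<^sup>2 * (normsq - real n)\<^sup>2 / (Im z) ^ 4 else 0)"
proof (cases "a * cmod q \<le> 1 / 2")
  case True
  have "cmod (\<beta> * (u k)\<^sup>2) = a * (cmod (u k))\<^sup>2 * cmod (1 / (1 + of_real a * q))"
    using a_pos by (simp add: \<beta>_def norm_mult norm_power norm_divide)
  also have "\<dots> \<le> a * (cmod (u k))\<^sup>2 * 2"
    using a_pos by (intro mult_left_mono inverse_denom_le True) auto
  finally have "(cmod (\<beta> * (u k)\<^sup>2))\<^sup>2 \<le> (a * (cmod (u k))\<^sup>2 * 2)\<^sup>2" by (intro power_mono) auto
  also have "\<dots> = 4 * a\<^sup>2 * cmod (u k) ^ 4" by (simp add: power2_eq_square power4_eq_xxxx)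
  finally have "(cmod (\<beta> * (u k)\<^sup>2))\<^sup>2 \<le> 4 * a\<^sup>2 * cmod (u k) ^ 4" .
  moreover have "0 \<le> (if \<bar>normsq - real n\<bar> > real n then 16 * a\<^sup>2 * (normsq - real n)\<^sup>2 / (Im z) ^ 4 else 0)"
    by auto
  ultimately show ?thesis by linarith
next
  case False
  have "Im z < 2 * a * normsq"
  proof -
    have "a * cmod q \<le> a * (normsq / Im z)" using a_pos by (intro mult_left_mono q_le) auto
    then have "1 / 2 < a * (normsq / Im z)" using False by linarith
    then show ?thesis using Im_z by (simp add: field_simps)
  qed
  then have "2 * a * (2 * real n) < 2 * a * normsq" using n by simp
  then have big: "2 * real n < normsq" using a_pos by (simp add: mult_less_cancel_left_disj)
  have le: "normsq \<le> 2 * (normsq - real n)" using big by simp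
  have "cmod (\<beta> * (u k)\<^sup>2) \<le> (1 / Im z) * 1" using entry_update_le[OF k] by simp
  also have "\<dots> \<le> (1 / Im z) * (2 * a * normsq / Im z)"
    using Im_z by (intro mult_left_mono large_q False) auto
  also have "\<dots> \<le> (1 / Im z) * (2 * a * (2 * (normsq - real n)) / Im z)"
    using Im_z a_pos le by (intro mult_left_mono divide_right_mono) auto
  finally have "(cmod (\<beta> * (u k)\<^sup>2))\<^sup>2 \<le> ((1 / Im z) * (2 * a * (2 * (normsq - real n)) / Im z))\<^sup>2"
    by (intro power_mono) auto
  also have "\<dots> = 16 * a\<^sup>2 * (normsq - real n)\<^sup>2 / (Im z) ^ 4"
  proof -
    have "((1 / Im z) * (2 * a * (2 * d) / Im z))\<^sup>2 = 16 * a\<^sup>2 * d\<^sup>2 / (Im z) ^ 4" for d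
      by (simp add: power2_eq_square power4_eq_xxxx ac_simps)
    then show ?thesis .
  qed
  finally show ?thesis using big by (simp add: add_increasing)
qed

end

section \<open>Existence and measurability of the resolvent\<close>

definition shifted_mat :: "nat \<Rightarrow> (nat \<Rightarrow> nat \<Rightarrow> real) \<Rightarrow> complex \<Rightarrow> complex mat" where
  "shifted_mat n A z = Matrix.mat n n (\<lambda>(k, l). of_real (A k l) - (if k = l then z else 0))"

lemma shifted_mat_carrier [simp]: "shifted_mat n A z \<in> carrier_mat n n"
  by (simp add: shifted_mat_def)

lemma shifted_mat_index: "k < n \<Longrightarrow> l < n \<Longrightarrow> shifted_mat n A z $$ (k, l) = of_real (A k l) - (if k = l then z else 0)"
  by (simp add: shifted_mat_def)

lemma shifted_mat_sum:
  assumes "k < n"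
  shows "(\<Sum>i<n. shifted_mat n A z $$ (k, i) * f i) = (\<Sum>i<n. of_real (A k i) * f i) - z * f k"
proof -
  have "(\<Sum>i<n. shifted_mat n A z $$ (k, i) * f i) = (\<Sum>i<n. of_real (A k i) * f i - (if k = i then z * f i else 0))"
    using assms by (intro sum.cong refl) (simp add: shifted_mat_index left_diff_distrib)
  then show ?thesis using assms by (simp add: sum_subtractf)
qed

lemma shifted_mat_eq:
  "map_mat complex_of_real (Matrix.mat n n (\<lambda>(k, l). A k l)) - z \<cdot>\<^sub>m 1\<^sub>m n = shifted_mat n A z"
  by (rule eq_matI) (auto simp: shifted_mat_def)

lemma index_mult_mat_sum:
  assumes "B \<in> carrier_mat n n" "C \<in> carrier_mat n n" "k < n" "l < n"
  shows "(B * C) $$ (k, l) = (\<Sum>i<n. B $$ (k, i) * C $$ (i, l))"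
  using assms by (auto simp: scalar_prod_def lessThan_atLeast0 intro!: sum.cong)

text \<open>A kernel vector would solve the homogeneous system, which has only the zero
  solution.\<close>

lemma det_shifted_mat_nonzero:
  assumes sym: "\<And>k l. k < n \<Longrightarrow> l < n \<Longrightarrow> A k l = A l k" and z: "Im z > 0"
  shows "Determinant.det (shifted_mat n A z) \<noteq> 0"
proof
  assume "Determinant.det (shifted_mat n A z) = 0"
  then obtain v where v: "v \<in> carrier_vec n" "v \<noteq> 0\<^sub>v n" "shifted_mat n A z *\<^sub>v v = 0\<^sub>v n"
    using det_0_iff_vec_prod_zero_field[OF shifted_mat_carrier] by blast
  have 1: "shifted_eq n A z (\<lambda>i. v $ i) (\<lambda>i. 0)"
    unfolding shifted_eq_def
  proof safe
    fix k assume k: "k < n"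
    have "(\<Sum>i<n. shifted_mat n A z $$ (k, i) * v $ i) = (shifted_mat n A z *\<^sub>v v) $ k"
      using k v(1) by (auto simp: scalar_prod_def lessThan_atLeast0 shifted_mat_def intro!: sum.cong)
    also have "\<dots> = 0" using v(3) k by simp
    finally show "(\<Sum>i<n. of_real (A k i) * v $ i) - z * v $ k = 0"
      using k by (simp add: shifted_mat_sum)
  qed
  have 2: "shifted_eq n A z (\<lambda>i. 0) (\<lambda>i. 0)" by (simp add: shifted_eq_def)
  have "v $ k = 0" if "k < n" for k
    using shifted_eq_unique[of n A z "\<lambda>i. v $ i" "\<lambda>i. 0" "\<lambda>i. 0" k, OF sym 1 2 z that] by simp
  then have "v = 0\<^sub>v n" using v(1) by (intro eq_vecI) auto
  then show False using v(2) by simp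
qed

text \<open>Cramer's rule expresses the inverse rationally in the entries of \<open>A\<close>; this
  form is what makes measurability accessible.\<close>

lemma resolvent_fun_adj_mat:
  assumes sym: "\<And>k l. k < n \<Longrightarrow> l < n \<Longrightarrow> A k l = A l k" and z: "Im z > 0"
  shows "resolvent_fun n A z
    (\<lambda>k l. adj_mat (shifted_mat n A z) $$ (k, l) / Determinant.det (shifted_mat n A z))"
proof (rule resolvent_fun.intro)
  let ?B = "shifted_mat n A z"
  fix k l assume kl: "k < n" "l < n"
  have "(\<Sum>i<n. ?B $$ (k, i) * adj_mat ?B $$ (i, l)) = (?B * adj_mat ?B) $$ (k, l)"
    using kl by (intro index_mult_mat_sum[symmetric] adj_mat(1)) auto
  also have "\<dots> = (if k = l then Determinant.det ?B else 0)"
    using kl by (subst adj_mat(2)[OF shifted_mat_carrier]) auto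
  finally have "(\<Sum>i<n. ?B $$ (k, i) * (adj_mat ?B $$ (i, l) / Determinant.det ?B)) = (if k = l then 1 else 0)"
    using det_shifted_mat_nonzero[OF sym z] by (simp flip: sum_divide_distrib)
  then show "(\<Sum>i<n. of_real (A k i) * (adj_mat ?B $$ (i, l) / Determinant.det ?B))
      - z * (adj_mat ?B $$ (k, l) / Determinant.det ?B) = (if k = l then 1 else 0)"
    using kl by (simp only: shifted_mat_sum)
qed (use assms in auto)

text \<open>The bridge from the matrix \<open>resolvent\<close> to index functions: all analysis is
  done on the latter and transferred back only for the expected trace.\<close>

definition resolvent_entry :: "nat \<Rightarrow> (nat \<Rightarrow> nat \<Rightarrow> real) \<Rightarrow> complex \<Rightarrow> nat \<Rightarrow> nat \<Rightarrow> complex" where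
  "resolvent_entry n A z k l = resolvent (Matrix.mat n n (\<lambda>(k, l). A k l)) z $$ (k, l)"

lemma resolvent_carrier_fun:
  assumes sym: "\<And>k l. k < n \<Longrightarrow> l < n \<Longrightarrow> A k l = A l k" and z: "Im z > 0"
  shows resolvent_carrier: "resolvent (Matrix.mat n n (\<lambda>(k, l). A k l)) z \<in> carrier_mat n n"
    and resolvent_fun_resolvent_entry: "resolvent_fun n A z (resolvent_entry n A z)"
proof -
  let ?B = "shifted_mat n A z"
  have "?B \<in> Units (ring_mat TYPE(complex) n ())"
    by (rule det_non_zero_imp_unit[OF shifted_mat_carrier det_shifted_mat_nonzero[OF sym z]])
  then obtain C where "mat_inverse ?B = Some C"
    using mat_inverse(1)[OF shifted_mat_carrier[of n A z], of "()"] by (cases "mat_inverse ?B") auto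
  moreover from mat_inverse(2)[OF shifted_mat_carrier this]
  have C: "?B * C = 1\<^sub>m n" "C \<in> carrier_mat n n" by auto
  ultimately have res: "resolvent (Matrix.mat n n (\<lambda>(k, l). A k l)) z = C"
    by (simp add: resolvent_def shifted_mat_eq)
  show "resolvent (Matrix.mat n n (\<lambda>(k, l). A k l)) z \<in> carrier_mat n n"
    unfolding res by (rule C(2))
  have "resolvent_fun n A z (\<lambda>k l. C $$ (k, l))"
  proof (rule resolvent_fun.intro)
    fix k l assume kl: "k < n" "l < n"
    have "(\<Sum>i<n. ?B $$ (k, i) * C $$ (i, l)) = (?B * C) $$ (k, l)"
      using kl C by (intro index_mult_mat_sum[symmetric]) auto
    then show "(\<Sum>i<n. of_real (A k i) * C $$ (i, l)) - z * C $$ (k, l) = (if k = l then 1 else 0)"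
      using kl by (simp add: shifted_mat_sum C)
  qed (use assms in auto)
  then show "resolvent_fun n A z (resolvent_entry n A z)"
    by (simp add: resolvent_entry_def[abs_def] res)
qed

lemma borel_measurable_det:
  fixes C :: "'a \<Rightarrow> complex mat"
  assumes car: "\<And>\<omega>. C \<omega> \<in> carrier_mat d d"
    and meas: "\<And>i j. i < d \<Longrightarrow> j < d \<Longrightarrow> (\<lambda>\<omega>. C \<omega> $$ (i, j)) \<in> borel_measurable M"
  shows "(\<lambda>\<omega>. Determinant.det (C \<omega>)) \<in> borel_measurable M"
proof -
  have "(\<lambda>\<omega>. \<Sum>p \<in> {p. p permutes {0..<d}}. signof p * (\<Prod>i = 0..<d. C \<omega> $$ (i, p i))) \<in> borel_measurable M"
    by (intro borel_measurable_sum borel_measurable_times borel_measurable_const borel_measurable_prod meas)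
       (auto simp: permutes_in_image dest: permutes_in_image[THEN iffD2])
  then show ?thesis by (simp add: det_def'[OF car])
qed

text \<open>By uniqueness the entry agrees with the quotient of a cofactor and the determinant, both
  polynomials in the entries of \<open>A\<close>.\<close>

lemma borel_measurable_resolvent_entry:
  assumes sym: "\<And>\<omega> k l. k < n \<Longrightarrow> l < n \<Longrightarrow> A \<omega> k l = A \<omega> l k" and z: "Im z > 0"
    and meas: "\<And>k l. k < n \<Longrightarrow> l < n \<Longrightarrow> (\<lambda>\<omega>. A \<omega> k l) \<in> borel_measurable M"
    and kl: "k < n" "l < n"
  shows "(\<lambda>\<omega>. resolvent_entry n (A \<omega>) z k l) \<in> borel_measurable M"
proof -
  \<comment> \<open>The adjugate transposes the cofactors, hence the order
    \<open>l k\<close>.\<close>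
  have eq: "resolvent_entry n (A \<omega>) z k l
     = cofactor (shifted_mat n (A \<omega>) z) l k / Determinant.det (shifted_mat n (A \<omega>) z)" for \<omega>
  proof -
    have "resolvent_entry n (A \<omega>) z k l
     = adj_mat (shifted_mat n (A \<omega>) z) $$ (k, l) / Determinant.det (shifted_mat n (A \<omega>) z)"
      by (rule resolvent_fun_unique[OF resolvent_fun_resolvent_entry resolvent_fun_adj_mat kl]) (fact sym z)+
    then show ?thesis using kl by (simp add: adj_mat_def shifted_mat_def)
  qed
  have idx: "(\<lambda>\<omega>. shifted_mat n (A \<omega>) z $$ (i, j)) \<in> borel_measurable M" if "i < n" "j < n" for i j
    unfolding shifted_mat_index[OF that] using meas[OF that] by measurable
  have "(\<lambda>\<omega>. Determinant.det (mat_delete (shifted_mat n (A \<omega>) z) l k)) \<in> borel_measurable M"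
  proof (rule borel_measurable_det)
    show "mat_delete (shifted_mat n (A \<omega>) z) l k \<in> carrier_mat (n - 1) (n - 1)" for \<omega>
      by (simp add: mat_delete_def shifted_mat_def)
    show "(\<lambda>\<omega>. mat_delete (shifted_mat n (A \<omega>) z) l k $$ (i, j)) \<in> borel_measurable M"
      if "i < n - 1" "j < n - 1" for i j
    proof -
      have "mat_delete (shifted_mat n (A \<omega>) z) l k $$ (i, j)
          = shifted_mat n (A \<omega>) z $$ (if i < l then i else Suc i, if j < k then j else Suc j)" for \<omega>
        using that by (simp add: mat_delete_def shifted_mat_def)
      then show ?thesis using idx that by simp
    qed
  qed
  then show ?thesis
    unfolding eq cofactor_def
    by (intro borel_measurable_divide borel_measurable_times borel_measurable_const
        borel_measurable_det[OF shifted_mat_carrier] idx)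
qed

section \<open>The Efron-Stein inequality\<close>

text \<open>Expand \<open>|f - k|^2 = |f|^2 - 2 Re (cnj k f) + |k|^2\<close>. The choice
  \<open>k = E f\<close> gives the variance, and its nonnegativity is Jensen's inequality for the
  square.\<close>

lemma (in prob_space)
  fixes f :: "'a \<Rightarrow> complex"
  assumes f: "integrable M f" and f2: "integrable M (\<lambda>x. (cmod (f x))\<^sup>2)"
  shows integral_cmod_diff_power2:
      "(\<integral>x. (cmod (f x - k))\<^sup>2 \<partial>M) = (\<integral>x. (cmod (f x))\<^sup>2 \<partial>M) - (cmod (\<integral>x. f x \<partial>M))\<^sup>2 + (cmod ((\<integral>x. f x \<partial>M) - k))\<^sup>2"
    and integrable_cmod_diff_power2: "integrable M (\<lambda>x. (cmod (f x - k))\<^sup>2)"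
    and cmod_integral_power2_le: "(cmod (\<integral>x. f x \<partial>M))\<^sup>2 \<le> (\<integral>x. (cmod (f x))\<^sup>2 \<partial>M)"
proof -
  have ex: "(cmod (w - k))\<^sup>2 = (cmod w)\<^sup>2 - 2 * Re (cnj k * w) + (cmod k)\<^sup>2" for w k :: complex
    by (simp only: cmod_power2) (simp add: power2_eq_square algebra_simps)
  have int1: "integrable M (\<lambda>x. Re (cnj k * f x))" for k
    using f by simp
  have val: "(\<integral>x. (cmod (f x - k))\<^sup>2 \<partial>M) = (\<integral>x. (cmod (f x))\<^sup>2 \<partial>M) - 2 * Re (cnj k * (\<integral>x. f x \<partial>M)) + (cmod k)\<^sup>2" for k
  proof -
    have "(\<integral>x. Re (cnj k * f x) \<partial>M) = Re (\<integral>x. cnj k * f x \<partial>M)"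
      using f by (intro integral_Re) simp
    then have r: "(\<integral>x. Re (cnj k * f x) \<partial>M) = Re (cnj k * (\<integral>x. f x \<partial>M))"
      by (simp only: integral_mult_right_zero)
    have "(\<integral>x. (cmod (f x))\<^sup>2 - 2 * r x + c \<partial>M) = (\<integral>x. (cmod (f x))\<^sup>2 \<partial>M) - 2 * (\<integral>x. r x \<partial>M) + c"
      if "integrable M r" for r and c :: real
      using f2 that by (simp add: prob_space)
    from this[OF int1[of k], of "(cmod k)\<^sup>2"] show ?thesis unfolding ex r .
  qed
  show "integrable M (\<lambda>x. (cmod (f x - k))\<^sup>2)" for k
    unfolding ex using f2 int1 by (intro Bochner_Integration.integrable_add Bochner_Integration.integrable_diff integrable_mult_right) auto
  show "(\<integral>x. (cmod (f x - k))\<^sup>2 \<partial>M) = (\<integral>x. (cmod (f x))\<^sup>2 \<partial>M) - (cmod (\<integral>x. f x \<partial>M))\<^sup>2 + (cmod ((\<integral>x. f x \<partial>M) - k))\<^sup>2" for k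
    unfolding val ex[of "\<integral>x. f x \<partial>M"] by simp
  from this[of "\<integral>x. f x \<partial>M"] have "(\<integral>x. (cmod (f x))\<^sup>2 \<partial>M) - (cmod (\<integral>x. f x \<partial>M))\<^sup>2 = (\<integral>x. (cmod (f x - (\<integral>x. f x \<partial>M)))\<^sup>2 \<partial>M)"
    by simp
  also have "\<dots> \<ge> 0" by (intro integral_nonneg_AE) auto
  finally show "(cmod (\<integral>x. f x \<partial>M))\<^sup>2 \<le> (\<integral>x. (cmod (f x))\<^sup>2 \<partial>M)" by simp
qed

lemma (in prob_space) integrable_bounded_complex:
  fixes f :: "'a \<Rightarrow> complex"
  assumes "f \<in> borel_measurable M" "\<And>x. x \<in> space M \<Longrightarrow> cmod (f x) \<le> B"
  shows "integrable M f" "integrable M (\<lambda>x. (cmod (f x))\<^sup>2)"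
proof -
  show "integrable M f" using assms by (intro integrable_const_bound[of _ B]) auto
  show "integrable M (\<lambda>x. (cmod (f x))\<^sup>2)"
    using assms by (intro integrable_const_bound[of _ "B\<^sup>2"]) (auto intro!: power_mono)
qed

lemma (in prob_space) integral_cmod_le_bound:
  fixes f :: "'a \<Rightarrow> complex"
  assumes "f \<in> borel_measurable M" "\<And>x. x \<in> space M \<Longrightarrow> cmod (f x) \<le> B"
  shows "cmod (\<integral>x. f x \<partial>M) \<le> B"
proof -
  have "cmod (\<integral>x. f x \<partial>M) \<le> (\<integral>x. cmod (f x) \<partial>M)" by (rule integral_norm_bound)
  also have "\<dots> \<le> (\<integral>x. B \<partial>M)"
    using integrable_bounded_complex[OF assms] assms(2) by (intro integral_mono) auto
  also have "\<dots> = B" by (simp add: prob_space)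
  finally show ?thesis .
qed

text \<open>The variance tensorises: the induction splits off one coordinate and uses Jensen's
  inequality to pass the approximations \<open>g j\<close> to the partial integrals.\<close>

theorem efron_stein:
  fixes M :: "'i \<Rightarrow> 'a measure" and F :: "('i \<Rightarrow> 'a) \<Rightarrow> complex" and g :: "'i \<Rightarrow> ('i \<Rightarrow> 'a) \<Rightarrow> complex"
  assumes prob: "\<And>i. prob_space (M i)" and fin: "finite I"
    and F: "F \<in> borel_measurable (Pi\<^sub>M I M)" "\<And>x. x \<in> space (Pi\<^sub>M I M) \<Longrightarrow> cmod (F x) \<le> B"
    and g: "\<And>i. i \<in> I \<Longrightarrow> g i \<in> borel_measurable (Pi\<^sub>M I M)"
      "\<And>i x. i \<in> I \<Longrightarrow> x \<in> space (Pi\<^sub>M I M) \<Longrightarrow> cmod (g i x) \<le> B"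
    and const: "\<And>i x y y'. i \<in> I \<Longrightarrow> g i (x(i := y)) = g i (x(i := y'))"
  shows "(\<integral>x. (cmod (F x))\<^sup>2 \<partial>Pi\<^sub>M I M) - (cmod (\<integral>x. F x \<partial>Pi\<^sub>M I M))\<^sup>2
    \<le> (\<Sum>i\<in>I. \<integral>x. (cmod (F x - g i x))\<^sup>2 \<partial>Pi\<^sub>M I M)"
  using fin F g const
proof (induction I arbitrary: F g)
  case empty
  interpret P: prob_space "Pi\<^sub>M {} M" by (rule prob_space_PiM) (rule prob)
  have "(\<integral>x. F x \<partial>Pi\<^sub>M {} M) = (\<integral>x. F (\<lambda>_. undefined) \<partial>Pi\<^sub>M {} M)"
    by (intro Bochner_Integration.integral_cong refl arg_cong[where f=F]) (simp add: space_PiM)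
  moreover have "(\<integral>x. (cmod (F x))\<^sup>2 \<partial>Pi\<^sub>M {} M) = (\<integral>x. (cmod (F (\<lambda>_. undefined)))\<^sup>2 \<partial>Pi\<^sub>M {} M)"
    by (intro Bochner_Integration.integral_cong refl arg_cong[where f="\<lambda>x. (cmod (F x))\<^sup>2"]) (simp add: space_PiM)
  ultimately show ?case by (simp add: P.prob_space)
next
  case (insert i J)
  interpret product_sigma_finite M
    by (rule product_sigma_finite.intro) (rule prob_space_imp_sigma_finite[OF prob])
  interpret P: prob_space "Pi\<^sub>M (insert i J) M" by (rule prob_space_PiM) (rule prob)
  interpret PJ: prob_space "Pi\<^sub>M J M" by (rule prob_space_PiM) (rule prob)
  interpret Mi: prob_space "M i" by (rule prob)
  have sp: "x(i := y) \<in> space (Pi\<^sub>M (insert i J) M)" if "x \<in> space (Pi\<^sub>M J M)" "y \<in> space (M i)" for x y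
    using that insert.hyps by (auto simp: space_PiM PiE_def extensional_def)
  have upd: "(\<lambda>y. h (x(i := y))) \<in> borel_measurable (M i)"
    if "h \<in> borel_measurable (Pi\<^sub>M (insert i J) M)" "x \<in> space (Pi\<^sub>M J M)" for x and h :: "('i \<Rightarrow> 'a) \<Rightarrow> complex"
    using measurable_comp[OF measurable_component_update that(1), OF that(2) insert.hyps(2)] unfolding comp_def .
  have part: "(\<lambda>x. \<integral>y. h (x(i := y)) \<partial>M i) \<in> borel_measurable (Pi\<^sub>M J M)"
    if "h \<in> borel_measurable (Pi\<^sub>M (insert i J) M)" for h :: "('i \<Rightarrow> 'a) \<Rightarrow> complex"
  proof -
    have "(\<lambda>(x, y). h (x(i := y))) \<in> borel_measurable (Pi\<^sub>M J M \<Otimes>\<^sub>M M i)"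
      using measurable_comp[OF measurable_add_dim that] unfolding comp_def case_prod_beta' .
    then show ?thesis by (rule sigma_finite_measure.borel_measurable_lebesgue_integral[OF prob_space_imp_sigma_finite[OF prob]])
  qed
  have partr: "(\<lambda>x. \<integral>y. h (x(i := y)) \<partial>M i) \<in> borel_measurable (Pi\<^sub>M J M)"
    if "h \<in> borel_measurable (Pi\<^sub>M (insert i J) M)" for h :: "('i \<Rightarrow> 'a) \<Rightarrow> real"
  proof -
    have "(\<lambda>(x, y). h (x(i := y))) \<in> borel_measurable (Pi\<^sub>M J M \<Otimes>\<^sub>M M i)"
      using measurable_comp[OF measurable_add_dim that] unfolding comp_def case_prod_beta' .
    then show ?thesis by (rule sigma_finite_measure.borel_measurable_lebesgue_integral[OF prob_space_imp_sigma_finite[OF prob]])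
  qed
  define F' where "F' x = (\<integral>y. F (x(i := y)) \<partial>M i)" for x
  define g' where "g' j x = (\<integral>y. g j (x(i := y)) \<partial>M i)" for j x
  have F'm: "F' \<in> borel_measurable (Pi\<^sub>M J M)"
    unfolding F'_def using part[OF insert.prems(1)] .
  have g'm: "g' j \<in> borel_measurable (Pi\<^sub>M J M)" if "j \<in> J" for j
    unfolding g'_def by (rule part[OF insert.prems(3)]) (use that in simp)
  have F'b: "cmod (F' x) \<le> B" if "x \<in> space (Pi\<^sub>M J M)" for x
    unfolding F'_def by (rule Mi.integral_cmod_le_bound[OF upd[OF insert.prems(1) that] insert.prems(2)[OF sp[OF that]]])
  have g'b: "cmod (g' j x) \<le> B" if "j \<in> J" "x \<in> space (Pi\<^sub>M J M)" for x j
    unfolding g'_def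
    by (rule Mi.integral_cmod_le_bound[OF upd[OF insert.prems(3) that(2)] insert.prems(4)[OF _ sp[OF that(2)]]]) (use that in auto)
  have g'c: "g' j (x(j := y)) = g' j (x(j := y'))" if "j \<in> J" for j x y y'
  proof -
    have "j \<noteq> i" using that insert.hyps by auto
    then have "(x(j := y))(i := w) = (x(i := w))(j := y)" for y w by (rule fun_upd_twist)
    then show ?thesis unfolding g'_def using insert.prems(5)[of j] that by (metis insertI2)
  qed
  have IH: "(\<integral>x. (cmod (F' x))\<^sup>2 \<partial>Pi\<^sub>M J M) - (cmod (\<integral>x. F' x \<partial>Pi\<^sub>M J M))\<^sup>2
    \<le> (\<Sum>j\<in>J. \<integral>x. (cmod (F' x - g' j x))\<^sup>2 \<partial>Pi\<^sub>M J M)"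
    by (rule insert.IH[OF F'm F'b g'm g'b g'c])
  have fold: "(\<integral>x. h x \<partial>Pi\<^sub>M (insert i J) M) = (\<integral>x. (\<integral>y. h (x(i := y)) \<partial>M i) \<partial>Pi\<^sub>M J M)"
    if "integrable (Pi\<^sub>M (insert i J) M) h" for h :: "('i \<Rightarrow> 'a) \<Rightarrow> real"
    by (rule product_integral_insert[OF insert.hyps that])
  have fF: "(\<integral>x. F x \<partial>Pi\<^sub>M (insert i J) M) = (\<integral>x. F' x \<partial>Pi\<^sub>M J M)"
    unfolding F'_def
    by (rule product_integral_insert[OF insert.hyps P.integrable_bounded_complex(1)[OF insert.prems(1,2)]])
  have diffm: "(\<lambda>x. F x - g j x) \<in> borel_measurable (Pi\<^sub>M (insert i J) M)" if "j \<in> insert i J" for j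
    using insert.prems(1) insert.prems(3)[OF that] by simp
  have diffb: "cmod (F x - g j x) \<le> 2 * B" if "j \<in> insert i J" "x \<in> space (Pi\<^sub>M (insert i J) M)" for j x
    using insert.prems(2)[OF that(2)] insert.prems(4)[OF that] norm_triangle_ineq4[of "F x" "g j x"] by simp
  define d where "d j x = (\<integral>y. (cmod (F (x(i := y)) - g j (x(i := y))))\<^sup>2 \<partial>M i)" for j x
  have dint: "(\<integral>x. (cmod (F x - g j x))\<^sup>2 \<partial>Pi\<^sub>M (insert i J) M) = (\<integral>x. d j x \<partial>Pi\<^sub>M J M)" if "j \<in> insert i J" for j
    unfolding d_def by (rule fold[OF P.integrable_bounded_complex(2)[OF diffm diffb]]) (use that in auto)
  have dI: "integrable (Pi\<^sub>M J M) (d j)" if j: "j \<in> insert i J" for j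
  proof (rule PJ.integrable_const_bound[of _ "(2 * B)\<^sup>2"])
    have "d j x \<le> (2 * B)\<^sup>2 \<and> 0 \<le> d j x" if x: "x \<in> space (Pi\<^sub>M J M)" for x
    proof -
      have "d j x \<le> (\<integral>y. (2 * B)\<^sup>2 \<partial>M i)"
        unfolding d_def
        by (intro integral_mono Mi.integrable_bounded_complex(2)[where B="2*B"] upd[OF diffm[OF j] x] power_mono diffb[OF j] sp[OF x]) auto
      moreover have "0 \<le> d j x" unfolding d_def by (intro integral_nonneg_AE) auto
      ultimately show ?thesis by (simp add: Mi.prob_space)
    qed
    then show "AE x in Pi\<^sub>M J M. norm (d j x) \<le> (2 * B)\<^sup>2" by (intro AE_I2) auto
    show "d j \<in> borel_measurable (Pi\<^sub>M J M)"
      unfolding d_def by (rule partr) (use diffm[OF j] in measurable)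
  qed
  have F2: "(\<integral>x. (cmod (F x))\<^sup>2 \<partial>Pi\<^sub>M (insert i J) M) = (\<integral>x. (\<integral>y. (cmod (F (x(i := y))))\<^sup>2 \<partial>M i) \<partial>Pi\<^sub>M J M)"
    by (rule fold[OF P.integrable_bounded_complex(2)[OF insert.prems(1,2)]])
  have F'2I: "integrable (Pi\<^sub>M J M) (\<lambda>x. (cmod (F' x))\<^sup>2)"
    by (rule PJ.integrable_bounded_complex(2)[OF F'm F'b])
  have "(\<integral>x. (\<integral>y. (cmod (F (x(i := y))))\<^sup>2 \<partial>M i) \<partial>Pi\<^sub>M J M) \<le> (\<integral>x. (cmod (F' x))\<^sup>2 + d i x \<partial>Pi\<^sub>M J M)"
  proof (rule integral_mono)
    show "integrable (Pi\<^sub>M J M) (\<lambda>x. (cmod (F' x))\<^sup>2 + d i x)"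
      using F'2I dI[of i] by simp
    have ptw: "(\<integral>y. (cmod (F (x(i := y))))\<^sup>2 \<partial>M i) \<le> (cmod (F' x))\<^sup>2 + d i x" if x: "x \<in> space (Pi\<^sub>M J M)" for x
    proof -
      \<comment> \<open>On the fibre over \<open>x\<close>, \<open>g i\<close> is constant;
        \<open>undefined\<close> is just one admissible value of the coordinate \<open>i\<close> at
        which to read it off.\<close>
      define k where "k = g i (x(i := undefined))"
      have gi: "g i (x(i := y)) = k" for y
        unfolding k_def by (rule insert.prems(5)) simp
      note I = Mi.integrable_bounded_complex[OF upd[OF insert.prems(1) x] insert.prems(2)[OF sp[OF x]]]
      have di: "d i x = (\<integral>y. (cmod (F (x(i := y)) - k))\<^sup>2 \<partial>M i)" unfolding d_def gi ..
      \<comment> \<open>The conditional variance is minimal among mean squared distances to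
        constants, so the distance to \<open>k\<close> exceeds it by
        \<open>|F' x - k|^2\<close>.\<close>
      have "d i x = (\<integral>y. (cmod (F (x(i := y))))\<^sup>2 \<partial>M i) - (cmod (F' x))\<^sup>2 + (cmod (F' x - k))\<^sup>2"
        unfolding di F'_def by (rule Mi.integral_cmod_diff_power2[OF I])
      then show ?thesis using zero_le_power2[of "cmod (F' x - k)"] by linarith
    qed
    then show "(\<integral>y. (cmod (F (x(i := y))))\<^sup>2 \<partial>M i) \<le> (cmod (F' x))\<^sup>2 + d i x" if "x \<in> space (Pi\<^sub>M J M)" for x
      using that .
    show "integrable (Pi\<^sub>M J M) (\<lambda>x. \<integral>y. (cmod (F (x(i := y))))\<^sup>2 \<partial>M i)"
    proof (rule Bochner_Integration.integrable_bound[OF \<open>integrable (Pi\<^sub>M J M) (\<lambda>x. (cmod (F' x))\<^sup>2 + d i x)\<close>])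
      show "(\<lambda>x. \<integral>y. (cmod (F (x(i := y))))\<^sup>2 \<partial>M i) \<in> borel_measurable (Pi\<^sub>M J M)"
        by (rule partr) (use insert.prems(1) in measurable)
      show "AE x in Pi\<^sub>M J M. norm (\<integral>y. (cmod (F (x(i := y))))\<^sup>2 \<partial>M i) \<le> norm ((cmod (F' x))\<^sup>2 + d i x)"
      proof (rule AE_I2)
        fix x assume "x \<in> space (Pi\<^sub>M J M)"
        moreover have "0 \<le> (\<integral>y. (cmod (F (x(i := y))))\<^sup>2 \<partial>M i)" by (intro integral_nonneg_AE) auto
        ultimately show "norm (\<integral>y. (cmod (F (x(i := y))))\<^sup>2 \<partial>M i) \<le> norm ((cmod (F' x))\<^sup>2 + d i x)"
          using ptw[of x] by simp
      qed
    qed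
  qed
  also have "\<dots> = (\<integral>x. (cmod (F' x))\<^sup>2 \<partial>Pi\<^sub>M J M) + (\<integral>x. d i x \<partial>Pi\<^sub>M J M)"
    using F'2I dI[of i] by simp
  finally have step: "(\<integral>x. (cmod (F x))\<^sup>2 \<partial>Pi\<^sub>M (insert i J) M)
      \<le> (\<integral>x. (cmod (F' x))\<^sup>2 \<partial>Pi\<^sub>M J M) + (\<integral>x. d i x \<partial>Pi\<^sub>M J M)"
    unfolding F2 .
  \<comment> \<open>Integrating out the coordinate \<open>i\<close> contracts the distance of
    \<open>F\<close> to \<open>g j\<close>, so the terms of the induction hypothesis are bounded by
    those of the claim.\<close>
  have jens: "(\<integral>x. (cmod (F' x - g' j x))\<^sup>2 \<partial>Pi\<^sub>M J M) \<le> (\<integral>x. d j x \<partial>Pi\<^sub>M J M)" if j: "j \<in> J" for j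
  proof (rule integral_mono)
    have j': "j \<in> insert i J" using j by simp
    show "integrable (Pi\<^sub>M J M) (d j)" using dI[OF j'] .
    show "integrable (Pi\<^sub>M J M) (\<lambda>x. (cmod (F' x - g' j x))\<^sup>2)"
    proof (rule PJ.integrable_bounded_complex(2)[of _ "2 * B"])
      show "(\<lambda>x. F' x - g' j x) \<in> borel_measurable (Pi\<^sub>M J M)" using F'm g'm[OF j] by simp
      show "cmod (F' x - g' j x) \<le> 2 * B" if "x \<in> space (Pi\<^sub>M J M)" for x
        using F'b[OF that] g'b[OF j that] norm_triangle_ineq4[of "F' x" "g' j x"] by simp
    qed
    fix x assume x: "x \<in> space (Pi\<^sub>M J M)"
    note I = Mi.integrable_bounded_complex[OF upd[OF diffm[OF j'] x] diffb[OF j' sp[OF x]]]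
    have IF: "integrable (M i) (\<lambda>y. F (x(i := y)))"
      by (rule Mi.integrable_bounded_complex(1)[OF upd[OF insert.prems(1) x]]) (rule insert.prems(2)[OF sp[OF x]])
    have Ig: "integrable (M i) (\<lambda>y. g j (x(i := y)))"
      by (rule Mi.integrable_bounded_complex(1)[OF upd[OF insert.prems(3)[OF j'] x]]) (rule insert.prems(4)[OF j' sp[OF x]])
    have "F' x - g' j x = (\<integral>y. F (x(i := y)) - g j (x(i := y)) \<partial>M i)"
      unfolding F'_def g'_def
      by (rule Bochner_Integration.integral_diff[OF IF Ig, symmetric])
    then show "(cmod (F' x - g' j x))\<^sup>2 \<le> d j x"
      unfolding d_def using Mi.cmod_integral_power2_le[OF I] by (simp only:)
  qed
  have "(\<integral>x. (cmod (F x))\<^sup>2 \<partial>Pi\<^sub>M (insert i J) M) - (cmod (\<integral>x. F x \<partial>Pi\<^sub>M (insert i J) M))\<^sup>2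
     \<le> (\<integral>x. d i x \<partial>Pi\<^sub>M J M) + (\<Sum>j\<in>J. \<integral>x. (cmod (F' x - g' j x))\<^sup>2 \<partial>Pi\<^sub>M J M)"
    using step IH unfolding fF by linarith
  also have "\<dots> \<le> (\<integral>x. d i x \<partial>Pi\<^sub>M J M) + (\<Sum>j\<in>J. \<integral>x. d j x \<partial>Pi\<^sub>M J M)"
    by (intro add_left_mono sum_mono jens)
  also have "\<dots> = (\<Sum>j\<in>insert i J. \<integral>x. (cmod (F x - g j x))\<^sup>2 \<partial>Pi\<^sub>M (insert i J) M)"
    using insert.hyps by (simp add: dint)
  finally show ?case .
qed

section \<open>Quadratic forms in a row with independent entries\<close>

lemma sum_of_bool_eq:
  fixes f :: "nat \<Rightarrow> 'a::semiring_1"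
  assumes "k < n"
  shows "(\<Sum>l<n. f l * of_bool (l = k)) = f k" "(\<Sum>l<n. f l * of_bool (k = l)) = f k"
  using assms by (simp_all add: of_bool_def if_distrib[where f="\<lambda>t. _ * t"] cong: if_cong)

locale standardized_law = prob_space \<mu> for \<mu> :: "real measure" +
  assumes sets_mu [measurable_cong, simp]: "sets \<mu> = sets borel"
    and mean_zero: "(\<integral>x. x \<partial>\<mu>) = 0"
    and second_moment: "(\<integral>x. x\<^sup>2 \<partial>\<mu>) = 1"
    and fourth_moment: "integrable \<mu> (\<lambda>x. x ^ 4)"
begin

abbreviation \<kappa> where "\<kappa> \<equiv> kappa4 \<mu>"

lemma integrable_power_le4: assumes "e \<le> 4" shows "integrable \<mu> (\<lambda>x. x ^ e)"
proof (rule Bochner_Integration.integrable_bound)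
  show "integrable \<mu> (\<lambda>x. 1 + x ^ 4)" using fourth_moment by simp
  have "\<bar>x ^ e\<bar> \<le> 1 + x ^ 4" for x :: real
  proof (cases "\<bar>x\<bar> \<le> 1")
    case True
    then have "\<bar>x\<bar> ^ e \<le> 1" by (simp add: power_le_one)
    then show ?thesis by (simp add: power_abs add_increasing2)
  next
    case False
    then have "\<bar>x\<bar> ^ e \<le> \<bar>x\<bar> ^ 4" using assms by (intro power_increasing) auto
    then show ?thesis by (simp add: power_abs)
  qed
  then show "AE x in \<mu>. norm (x ^ e) \<le> norm (1 + x ^ 4)"
    by (intro AE_I2) (simp add: order_trans[OF _ abs_ge_self])
qed simp

definition mom :: "nat \<Rightarrow> real" where "mom e = (\<integral>x. x ^ e \<partial>\<mu>)"

text \<open>The successor forms match exponents that the simplifier computes as sums of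
  \<open>of_bool\<close> terms.\<close>

lemma mom_simps [simp]: "mom 0 = 1" "mom (Suc 0) = 0" "mom 2 = 1" "mom 4 = 3 + \<kappa>"
    "mom (Suc (Suc 0)) = 1" "mom (Suc (Suc (Suc (Suc 0)))) = 3 + \<kappa>"
proof -
  show m: "mom 0 = 1" "mom (Suc 0) = 0" "mom 2 = 1" "mom 4 = 3 + \<kappa>"
    using mean_zero second_moment by (simp_all add: mom_def prob_space kappa4_def)
  have "Suc (Suc 0) = 2" by simp
  then show "mom (Suc (Suc 0)) = 1" by (simp only: m)
  have "Suc (Suc (Suc (Suc 0))) = 4" by simp
  then show "mom (Suc (Suc (Suc (Suc 0)))) = 3 + \<kappa>" by (simp only: m)
qed

sublocale row: product_prob_space "\<lambda>_::nat. \<mu>" by (rule product_prob_spaceI) (rule prob_space_axioms)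

definition row_law :: "nat \<Rightarrow> (nat \<Rightarrow> real) measure" where "row_law n = Pi\<^sub>M {..<n} (\<lambda>_. \<mu>)"

lemma prob_space_row_law: "prob_space (row_law n)"
  unfolding row_law_def by (intro prob_space_PiM prob_space_axioms)

lemma row_component [measurable]: "k < n \<Longrightarrow> (\<lambda>x. x k) \<in> borel_measurable (row_law n)"
  unfolding row_law_def by measurable

lemma row_monomial:
  assumes e: "\<And>t. t < n \<Longrightarrow> e t \<le> 4"
  shows "integrable (row_law n) (\<lambda>x. \<Prod>t<n. x t ^ e t)"
    and "(\<integral>x. (\<Prod>t<n. x t ^ e t) \<partial>row_law n) = (\<Prod>t<n. mom (e t))"
  unfolding row_law_def mom_def
  using e by (auto intro!: row.product_integrable_prod row.product_integral_prod[where f="\<lambda>t y. y ^ e t"] integrable_power_le4)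

text \<open>The exponent of \<open>x t\<close> in the monomial \<open>x k * x l * x i * x j\<close>,
  so that its expectation factors into the moments \<open>mom\<close>.\<close>

definition mult4 :: "nat \<Rightarrow> nat \<Rightarrow> nat \<Rightarrow> nat \<Rightarrow> nat \<Rightarrow> nat" where
  "mult4 k l i j t = of_bool (t = k) + of_bool (t = l) + of_bool (t = i) + of_bool (t = j)"

lemma coordinate_eq_prod:
  fixes x :: "nat \<Rightarrow> real"
  assumes "k < n" shows "(\<Prod>t<n. x t ^ of_bool (t = k)) = x k"
proof -
  have "(\<Prod>t<n. x t ^ of_bool (t = k)) = (\<Prod>t<n. if t = k then x t else 1)"
    by (intro prod.cong refl) auto
  then show ?thesis using assms by simp
qed

lemma prod4_eq:
  assumes "k < n" "l < n" "i < n" "j < n"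
  shows "(\<lambda>x :: nat \<Rightarrow> real. x k * x l * x i * x j) = (\<lambda>x. \<Prod>t<n. x t ^ mult4 k l i j t)"
  unfolding mult4_def power_add prod.distrib
  by (simp only: coordinate_eq_prod[OF assms(1)] coordinate_eq_prod[OF assms(2)]
      coordinate_eq_prod[OF assms(3)] coordinate_eq_prod[OF assms(4)])

text \<open>The three pairings of Wick's formula plus a cumulant correction, which counts only when
  all indices agree and the fourth moment \<open>3 + \<kappa>\<close> appears. A coordinate of
  exponent 1 gives zero, and exponent 3 always comes with such a coordinate, so the third moment
  never enters.\<close>

lemma row_fourth:
  assumes "k < n" "l < n" "i < n" "j < n"
  shows "integrable (row_law n) (\<lambda>x. x k * x l * x i * x j)"
    and "(\<integral>x. x k * x l * x i * x j \<partial>row_law n)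
      = of_bool (k = l) * of_bool (i = j) + of_bool (k = i) * of_bool (l = j) + of_bool (k = j) * of_bool (l = i)
        + \<kappa> * of_bool (k = l \<and> k = i \<and> k = j)"
proof -
  have m4: "mult4 k l i j t \<le> 4" for t by (simp add: mult4_def)
  show "integrable (row_law n) (\<lambda>x. x k * x l * x i * x j)"
    unfolding prod4_eq[OF assms] by (rule row_monomial) (rule m4)
  have "(\<integral>x. x k * x l * x i * x j \<partial>row_law n) = (\<Prod>t<n. mom (mult4 k l i j t))"
    unfolding prod4_eq[OF assms] by (rule row_monomial) (rule m4)
  moreover have "(\<Prod>t<n. mom (mult4 k l i j t))
      = of_bool (k = l) * of_bool (i = j) + of_bool (k = i) * of_bool (l = j) + of_bool (k = j) * of_bool (l = i)
        + \<kappa> * of_bool (k = l \<and> k = i \<and> k = j)"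
  proof -
    have one: "(\<Prod>t<n. mom (mult4 k l i j t)) = 1" if "\<And>t. mult4 k l i j t = 0 \<or> mult4 k l i j t = 2"
    proof (rule prod.neutral, safe)
      fix t show "mom (mult4 k l i j t) = 1" using that[of t] by auto
    qed
    have zero: "(\<Prod>t<n. mom (mult4 k l i j t)) = 0" if "t < n" "mult4 k l i j t = Suc 0" for t
      using that by (intro prod_zero) (auto intro!: bexI[of _ t])
    have four: "(\<Prod>t<n. mom (mult4 k k k k t)) = 3 + \<kappa>"
    proof -
      have "(\<Prod>t<n. mom (mult4 k k k k t)) = (\<Prod>t<n. if t = k then 3 + \<kappa> else 1)"
        by (intro prod.cong refl) (auto simp: mult4_def)
      then show ?thesis using assms by simp
    qed
    show ?thesis
    proof (cases "k = l")
      case kl: True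
      show ?thesis
      proof (cases "i = j")
        case ij: True
        show ?thesis
        proof (cases "k = i")
          case True
          then show ?thesis using kl ij four by simp
        next
          case False
          then show ?thesis using kl ij one by (simp add: mult4_def)
        qed
      next
        case ij: False
        show ?thesis
        proof (cases "k = i")
          case True
          then show ?thesis using kl ij zero[OF assms(4)] by (simp add: mult4_def)
        next
          case False
          then show ?thesis using kl ij zero[OF assms(3)] by (simp add: mult4_def)
        qed
      qed
    next
      case kl: False
      show ?thesis
      proof (cases "k = i")
        case ki: True
        show ?thesis
        proof (cases "l = j")
          case True
          then show ?thesis using kl ki one by (simp add: mult4_def)
        next
          case False
          then show ?thesis using kl ki zero[OF assms(2)] by (simp add: mult4_def)
        qed
      next
        case ki: False
        show ?thesis
        proof (cases "k = j")
          case kj: True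
          show ?thesis
          proof (cases "l = i")
            case True
            then show ?thesis using kl kj ki one by (simp add: mult4_def)
          next
            case False
            then show ?thesis using kl kj ki zero[OF assms(2)] by (simp add: mult4_def)
          qed
        next
          case False
          then show ?thesis using kl ki zero[OF assms(1)] by (simp add: mult4_def)
        qed
      qed
    qed
  qed
  ultimately show "(\<integral>x. x k * x l * x i * x j \<partial>row_law n)
      = of_bool (k = l) * of_bool (i = j) + of_bool (k = i) * of_bool (l = j) + of_bool (k = j) * of_bool (l = i)
        + \<kappa> * of_bool (k = l \<and> k = i \<and> k = j)"
    by simp
qed

lemma row_second:
  assumes "k < n" "l < n"
  shows "integrable (row_law n) (\<lambda>x. x k * x l)"
    and "(\<integral>x. x k * x l \<partial>row_law n) = of_bool (k = l)"
proof -
  have eq: "(\<lambda>x :: nat \<Rightarrow> real. x k * x l) = (\<lambda>x. \<Prod>t<n. x t ^ (of_bool (t = k) + of_bool (t = l)))"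
    unfolding power_add prod.distrib
    by (simp only: coordinate_eq_prod[OF assms(1)] coordinate_eq_prod[OF assms(2)])
  show "integrable (row_law n) (\<lambda>x. x k * x l)"
    unfolding eq by (rule row_monomial) simp
  have *: "(\<integral>x. x k * x l \<partial>row_law n) = (\<Prod>t<n. mom (of_bool (t = k) + of_bool (t = l)))"
    unfolding eq by (rule row_monomial) simp
  show "(\<integral>x. x k * x l \<partial>row_law n) = of_bool (k = l)"
  proof (cases "k = l")
    case True
    then have "(\<Prod>t<n. mom (of_bool (t = k) + of_bool (t = l))) = 1"
      by (intro prod.neutral) (auto simp: numeral_2_eq_2[symmetric])
    then show ?thesis using True * by simp
  next
    case False
    then have "(\<Prod>t<n. mom (of_bool (t = k) + of_bool (t = l))) = 0"
      using assms by (intro prod_zero) (auto intro!: bexI[of _ k])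
    then show ?thesis using False * by simp
  qed
qed

section \<open>First and second moments of quadratic forms\<close>

definition qf :: "nat \<Rightarrow> (nat \<Rightarrow> nat \<Rightarrow> complex) \<Rightarrow> (nat \<Rightarrow> real) \<Rightarrow> complex" where
  "qf n A x = (\<Sum>k<n. \<Sum>l<n. A k l * of_real (x k * x l))"

lemma qf_mean:
  shows "integrable (row_law n) (qf n A)" "(\<integral>x. qf n A x \<partial>row_law n) = (\<Sum>k<n. A k k)"
proof -
  show "integrable (row_law n) (qf n A)"
    unfolding qf_def[abs_def]
    by (intro Bochner_Integration.integrable_sum integrable_mult_right integrable_of_real row_second) auto
  have "(\<integral>x. qf n A x \<partial>row_law n) = (\<Sum>k<n. \<Sum>l<n. A k l * of_real (\<integral>x. x k * x l \<partial>row_law n))"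
    unfolding qf_def
    by (subst Bochner_Integration.integral_sum, (intro Bochner_Integration.integrable_sum integrable_mult_right integrable_of_real row_second; simp)[1],
        intro sum.cong refl, subst Bochner_Integration.integral_sum,
        (intro Bochner_Integration.integrable_sum integrable_mult_right integrable_of_real row_second; simp)[1])
       (simp only: integral_mult_right_zero integral_complex_of_real)
  also have "\<dots> = (\<Sum>k<n. \<Sum>l<n. A k l * of_bool (k = l))"
    by (intro sum.cong refl) (simp add: row_second)
  also have "\<dots> = (\<Sum>k<n. A k k)"
    by (intro sum.cong refl) (simp add: sum_of_bool_eq)
  finally show "(\<integral>x. qf n A x \<partial>row_law n) = (\<Sum>k<n. A k k)" .
qed

text \<open>Each of the four terms of \<open>row_fourth\<close> collapses the fourfold index sum.
  For unsymmetric coefficients the two cross pairings give the traces of \<open>A B^T\<close> and of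
  \<open>A B\<close> separately.\<close>

lemma qf_product_mean:
  shows "integrable (row_law n) (\<lambda>x. qf n A x * qf n B x)"
    and "(\<integral>x. qf n A x * qf n B x \<partial>row_law n) = (\<Sum>k<n. A k k) * (\<Sum>k<n. B k k)
      + (\<Sum>k<n. \<Sum>l<n. A k l * B k l) + (\<Sum>k<n. \<Sum>l<n. A k l * B l k) + of_real \<kappa> * (\<Sum>k<n. A k k * B k k)"
proof -
  have eq: "qf n A x * qf n B x = (\<Sum>k<n. \<Sum>l<n. \<Sum>i<n. \<Sum>j<n. A k l * B i j * of_real (x k * x l * x i * x j))" for x
  proof -
    have "qf n A x * qf n B x = (\<Sum>k<n. \<Sum>l<n. (A k l * of_real (x k * x l)) * qf n B x)"
      by (simp only: qf_def[of n A] sum_distrib_right)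
    also have "\<dots> = (\<Sum>k<n. \<Sum>l<n. \<Sum>i<n. \<Sum>j<n. (A k l * of_real (x k * x l)) * (B i j * of_real (x i * x j)))"
      by (simp only: qf_def sum_distrib_left)
    also have "\<dots> = (\<Sum>k<n. \<Sum>l<n. \<Sum>i<n. \<Sum>j<n. A k l * B i j * of_real (x k * x l * x i * x j))"
      by (simp add: mult_ac)
    finally show ?thesis .
  qed
  have int: "integrable (row_law n) (\<lambda>x. A k l * B i j * of_real (x k * x l * x i * x j))"
    if "k < n" "l < n" "i < n" "j < n" for k l i j
    using that by (intro integrable_mult_right integrable_of_real row_fourth)
  show "integrable (row_law n) (\<lambda>x. qf n A x * qf n B x)"
    unfolding eq by (intro Bochner_Integration.integrable_sum int) auto
  have "(\<integral>x. qf n A x * qf n B x \<partial>row_law n)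
      = (\<Sum>k<n. \<Sum>l<n. \<Sum>i<n. \<Sum>j<n. \<integral>x. A k l * B i j * of_real (x k * x l * x i * x j) \<partial>row_law n)"
    unfolding eq
    by (subst Bochner_Integration.integral_sum, (intro Bochner_Integration.integrable_sum int; simp)[1], intro sum.cong refl)+
  also have "\<dots> = (\<Sum>k<n. \<Sum>l<n. \<Sum>i<n. \<Sum>j<n. A k l * B i j * of_real (\<integral>x. x k * x l * x i * x j \<partial>row_law n))"
    by (simp only: integral_mult_right_zero integral_complex_of_real)
  also have "\<dots> = (\<Sum>k<n. \<Sum>l<n. \<Sum>i<n. \<Sum>j<n. A k l * B i j * of_bool (k = l) * of_bool (i = j))
      + (\<Sum>k<n. \<Sum>l<n. \<Sum>i<n. \<Sum>j<n. A k l * B i j * of_bool (k = i) * of_bool (l = j))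
      + (\<Sum>k<n. \<Sum>l<n. \<Sum>i<n. \<Sum>j<n. A k l * B i j * of_bool (k = j) * of_bool (l = i))
      + of_real \<kappa> * (\<Sum>k<n. \<Sum>l<n. \<Sum>i<n. \<Sum>j<n. A k l * B i j * of_bool (k = l) * of_bool (k = i) * of_bool (k = j))"
    unfolding sum_distrib_left sum.distrib[symmetric]
    by (intro sum.cong refl) (simp only: row_fourth(2) lessThan_iff, simp add: algebra_simps of_bool_conj)
  also have "(\<Sum>k<n. \<Sum>l<n. \<Sum>i<n. \<Sum>j<n. A k l * B i j * of_bool (k = l) * of_bool (i = j)) = (\<Sum>k<n. A k k) * (\<Sum>k<n. B k k)"
  proof -
    have "(\<Sum>k<n. \<Sum>l<n. \<Sum>i<n. \<Sum>j<n. A k l * B i j * of_bool (k = l) * of_bool (i = j))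
      = (\<Sum>k<n. \<Sum>l<n. (\<Sum>i<n. A k l * B i i) * of_bool (k = l))"
      unfolding sum_distrib_right
      by (intro sum.cong refl) (simp add: sum_of_bool_eq mult_ac flip: sum_distrib_left)
    also have "\<dots> = (\<Sum>k<n. \<Sum>i<n. A k k * B i i)"
      by (rule sum.cong[OF refl]) (simp add: sum_of_bool_eq)
    finally show ?thesis by (simp add: sum_product)
  qed
  also have "(\<Sum>k<n. \<Sum>l<n. \<Sum>i<n. \<Sum>j<n. A k l * B i j * of_bool (k = i) * of_bool (l = j)) = (\<Sum>k<n. \<Sum>l<n. A k l * B k l)"
  proof (intro sum.cong refl)
    fix k l assume kl: "k \<in> {..<n}" "l \<in> {..<n}"
    have "(\<Sum>i<n. \<Sum>j<n. A k l * B i j * of_bool (k = i) * of_bool (l = j)) = (\<Sum>i<n. A k l * B i l * of_bool (k = i))"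
      using kl by (intro sum.cong refl) (simp add: sum_of_bool_eq)
    then show "(\<Sum>i<n. \<Sum>j<n. A k l * B i j * of_bool (k = i) * of_bool (l = j)) = A k l * B k l"
      using kl by (simp add: sum_of_bool_eq)
  qed
  also have "(\<Sum>k<n. \<Sum>l<n. \<Sum>i<n. \<Sum>j<n. A k l * B i j * of_bool (k = j) * of_bool (l = i)) = (\<Sum>k<n. \<Sum>l<n. A k l * B l k)"
  proof (intro sum.cong refl)
    fix k l assume kl: "k \<in> {..<n}" "l \<in> {..<n}"
    have "(\<Sum>i<n. \<Sum>j<n. A k l * B i j * of_bool (k = j) * of_bool (l = i)) = (\<Sum>i<n. A k l * B i k * of_bool (l = i))"
      unfolding sum_distrib_right[symmetric]
      using kl by (intro sum.cong refl) (simp add: sum_of_bool_eq)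
    then show "(\<Sum>i<n. \<Sum>j<n. A k l * B i j * of_bool (k = j) * of_bool (l = i)) = A k l * B l k"
      using kl by (simp add: sum_of_bool_eq)
  qed
  also have "(\<Sum>k<n. \<Sum>l<n. \<Sum>i<n. \<Sum>j<n. A k l * B i j * of_bool (k = l) * of_bool (k = i) * of_bool (k = j)) = (\<Sum>k<n. A k k * B k k)"
  proof (intro sum.cong refl)
    fix k assume k: "k \<in> {..<n}"
    have "(\<Sum>l<n. \<Sum>i<n. \<Sum>j<n. A k l * B i j * of_bool (k = l) * of_bool (k = i) * of_bool (k = j))
      = (\<Sum>l<n. \<Sum>i<n. A k l * B i k * of_bool (k = l) * of_bool (k = i))"
      using k by (intro sum.cong refl) (simp add: sum_of_bool_eq)
    also have "\<dots> = (\<Sum>l<n. A k l * B k k * of_bool (k = l))"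
      using k by (intro sum.cong refl) (simp add: sum_of_bool_eq)
    also have "\<dots> = A k k * B k k" using k by (simp add: sum_of_bool_eq)
    finally show "(\<Sum>l<n. \<Sum>i<n. \<Sum>j<n. A k l * B i j * of_bool (k = l) * of_bool (k = i) * of_bool (k = j)) = A k k * B k k" .
  qed
  finally show "(\<integral>x. qf n A x * qf n B x \<partial>row_law n) = (\<Sum>k<n. A k k) * (\<Sum>k<n. B k k)
      + (\<Sum>k<n. \<Sum>l<n. A k l * B k l) + (\<Sum>k<n. \<Sum>l<n. A k l * B l k) + of_real \<kappa> * (\<Sum>k<n. A k k * B k k)"
    by simp
qed

lemma cnj_qf: "cnj (qf n A x) = qf n (\<lambda>k l. cnj (A k l)) x"
  by (simp add: qf_def)

lemma qf_integrable_cmod_power2: "integrable (row_law n) (\<lambda>x. (cmod (qf n A x))\<^sup>2)"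
proof -
  have "integrable (row_law n) (\<lambda>x. Re (qf n A x * qf n (\<lambda>k l. cnj (A k l)) x))"
    by (intro integrable_Re qf_product_mean)
  then show ?thesis
    by (simp only: cnj_qf[symmetric] complex_norm_square[symmetric] Re_complex_of_real)
qed

text \<open>Take \<open>B\<close> as the entrywise conjugate of \<open>A\<close>. One cross pairing
  is the squared Frobenius norm, the other is at most that by
  \<open>2 |p q| <= |p|^2 + |q|^2\<close>, and so is the diagonal sum behind
  \<open>\<kappa>\<close>; hence \<open>2 + \<bar>\<kappa>\<bar>\<close>.\<close>

lemma qf_cmod_power2:
  "(\<integral>x. (cmod (qf n A x))\<^sup>2 \<partial>row_law n)
    \<le> (cmod (\<Sum>k<n. A k k))\<^sup>2 + (2 + \<bar>\<kappa>\<bar>) * (\<Sum>k<n. \<Sum>l<n. (cmod (A k l))\<^sup>2)"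
proof -
  define FA where "FA = (\<Sum>k<n. \<Sum>l<n. (cmod (A k l))\<^sup>2)"
  define X where "X = (\<Sum>k<n. \<Sum>l<n. A k l * cnj (A l k))"
  define Y where "Y = (\<Sum>k<n. (cmod (A k k))\<^sup>2)"
  have "complex_of_real (\<integral>x. (cmod (qf n A x))\<^sup>2 \<partial>row_law n) = (\<integral>x. qf n A x * qf n (\<lambda>k l. cnj (A k l)) x \<partial>row_law n)"
    by (simp only: cnj_qf[symmetric] complex_norm_square[symmetric] integral_complex_of_real)
  also have "\<dots> = (\<Sum>k<n. A k k) * cnj (\<Sum>k<n. A k k) + (\<Sum>k<n. \<Sum>l<n. A k l * cnj (A k l)) + X
      + of_real \<kappa> * (\<Sum>k<n. A k k * cnj (A k k))"
    unfolding qf_product_mean X_def cnj_sum ..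
  also have "\<dots> = of_real ((cmod (\<Sum>k<n. A k k))\<^sup>2 + FA + \<kappa> * Y) + X"
    by (simp only: complex_norm_square[symmetric] FA_def Y_def of_real_add of_real_sum of_real_mult) simp
  finally have "(\<integral>x. (cmod (qf n A x))\<^sup>2 \<partial>row_law n) = Re (of_real ((cmod (\<Sum>k<n. A k k))\<^sup>2 + FA + \<kappa> * Y) + X)"
    by (metis Re_complex_of_real)
  then have eq: "(\<integral>x. (cmod (qf n A x))\<^sup>2 \<partial>row_law n) = (cmod (\<Sum>k<n. A k k))\<^sup>2 + FA + \<kappa> * Y + Re X"
    by simp
  have "cmod X \<le> (\<Sum>k<n. \<Sum>l<n. ((cmod (A k l))\<^sup>2 + (cmod (A l k))\<^sup>2) / 2)"
    unfolding X_def
  proof (intro order_trans[OF norm_sum] sum_mono)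
    fix k l
    have "0 \<le> (cmod (A k l) - cmod (A l k))\<^sup>2" by simp
    then show "cmod (A k l * cnj (A l k)) \<le> ((cmod (A k l))\<^sup>2 + (cmod (A l k))\<^sup>2) / 2"
      by (simp add: norm_mult power2_eq_square algebra_simps)
  qed
  also have "\<dots> = (FA + (\<Sum>k<n. \<Sum>l<n. (cmod (A l k))\<^sup>2)) / 2"
    by (simp add: FA_def sum.distrib flip: sum_divide_distrib)
  also have "(\<Sum>k<n. \<Sum>l<n. (cmod (A l k))\<^sup>2) = FA" unfolding FA_def by (rule sum.swap)
  finally have X: "Re X \<le> FA" using complex_Re_le_cmod[of X] by simp
  have "Y \<le> FA" unfolding Y_def FA_def
    by (intro sum_mono member_le_sum) auto
  moreover have "0 \<le> Y" by (simp add: Y_def sum_nonneg)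
  ultimately have "\<kappa> * Y \<le> \<bar>\<kappa>\<bar> * FA" by (intro mult_mono) auto
  then show ?thesis unfolding eq FA_def[symmetric] using X by (simp add: algebra_simps)
qed

lemma qf_variance:
  shows "integrable (row_law n) (\<lambda>x. (cmod (qf n A x - (\<Sum>k<n. A k k)))\<^sup>2)"
    and "(\<integral>x. (cmod (qf n A x - (\<Sum>k<n. A k k)))\<^sup>2 \<partial>row_law n) \<le> (2 + \<bar>\<kappa>\<bar>) * (\<Sum>k<n. \<Sum>l<n. (cmod (A k l))\<^sup>2)"
proof -
  interpret R: prob_space "row_law n" by (rule prob_space_row_law)
  note I = qf_mean(1)[of n A] qf_integrable_cmod_power2[of n A]
  show "integrable (row_law n) (\<lambda>x. (cmod (qf n A x - (\<Sum>k<n. A k k)))\<^sup>2)"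
    by (rule R.integrable_cmod_diff_power2[OF I])
  show "(\<integral>x. (cmod (qf n A x - (\<Sum>k<n. A k k)))\<^sup>2 \<partial>row_law n) \<le> (2 + \<bar>\<kappa>\<bar>) * (\<Sum>k<n. \<Sum>l<n. (cmod (A k l))\<^sup>2)"
    using qf_cmod_power2[of n A] unfolding R.integral_cmod_diff_power2[OF I] qf_mean(2) by simp
qed

end

section \<open>Uniform integrability of the squared norm of a row\<close>

lemma diff_power2_le: "(a - b)\<^sup>2 \<le> 2 * a\<^sup>2 + 2 * b\<^sup>2" for a b :: real
  using zero_le_power2[of "a + b"] by (simp add: power2_eq_square algebra_simps)

lemma abs_mult_le_power2: "\<bar>a\<bar> * \<bar>b\<bar> \<le> a\<^sup>2 + b\<^sup>2" for a b :: real
proof -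
  have "0 \<le> (\<bar>a\<bar> - \<bar>b\<bar>)\<^sup>2" by simp
  also have "\<dots> = a\<^sup>2 + b\<^sup>2 - 2 * (\<bar>a\<bar> * \<bar>b\<bar>)"
    by (simp add: power2_eq_square algebra_simps)
  moreover have "0 \<le> \<bar>a\<bar> * \<bar>b\<bar>" by simp
  ultimately show ?thesis by linarith
qed

context standardized_law
begin

lemma row_integral_split:
  fixes h :: "(nat \<Rightarrow> real) \<Rightarrow> real"
  assumes "k < n" "integrable (row_law n) h"
  shows "(\<integral>x. h x \<partial>row_law n) = (\<integral>x. (\<integral>y. h (x(k := y)) \<partial>\<mu>) \<partial>Pi\<^sub>M ({..<n} - {k}) (\<lambda>_. \<mu>))"
proof -
  have ins: "insert k ({..<n} - {k}) = {..<n}" using assms(1) by auto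
  have "integrable (Pi\<^sub>M (insert k ({..<n} - {k})) (\<lambda>_. \<mu>)) h"
    using assms(2) unfolding ins row_law_def .
  from row.product_integral_insert[OF _ _ this] show ?thesis
    unfolding ins row_law_def by simp
qed

text \<open>Fubini in the coordinate \<open>k\<close>. Independence of \<open>g\<close> from that
  coordinate is expressed as invariance under updating it.\<close>

lemma row_integral_independent:
  fixes f :: "real \<Rightarrow> real" and g :: "(nat \<Rightarrow> real) \<Rightarrow> real"
  assumes k: "k < n" and g: "\<And>x y. g (x(k := y)) = g x"
    and fg: "integrable (row_law n) (\<lambda>x. f (x k) * g x)" and gi: "integrable (row_law n) g"
  shows "(\<integral>x. f (x k) * g x \<partial>row_law n) = (\<integral>y. f y \<partial>\<mu>) * (\<integral>x. g x \<partial>row_law n)"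
proof -
  have "(\<integral>x. g x \<partial>row_law n) = (\<integral>x. (\<integral>y. g x \<partial>\<mu>) \<partial>Pi\<^sub>M ({..<n} - {k}) (\<lambda>_. \<mu>))"
    unfolding row_integral_split[OF k gi] g ..
  then have 1: "(\<integral>x. g x \<partial>row_law n) = (\<integral>x. g x \<partial>Pi\<^sub>M ({..<n} - {k}) (\<lambda>_. \<mu>))"
    by (simp add: prob_space)
  have "(\<integral>x. f (x k) * g x \<partial>row_law n) = (\<integral>x. (\<integral>y. f y * g x \<partial>\<mu>) \<partial>Pi\<^sub>M ({..<n} - {k}) (\<lambda>_. \<mu>))"
    unfolding row_integral_split[OF k fg] g fun_upd_same ..
  then show ?thesis unfolding 1 by simp
qed

definition excess :: "nat \<Rightarrow> (nat \<Rightarrow> real) \<Rightarrow> real" where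
  "excess n x = (\<Sum>k<n. (x k)\<^sup>2) - real n"

text \<open>The constant in the variance bound for quadratic forms. It also dominates the variance
  \<open>2 + \<kappa>\<close> of a squared entry.\<close>

definition v where "v = 2 + \<bar>\<kappa>\<bar>"

lemma v_ge: "v \<ge> 2" by (simp add: v_def)

lemma borel_measurable_excess [measurable]: "excess n \<in> borel_measurable (row_law n)"
  unfolding excess_def[abs_def] by measurable

lemma qf_identity: "qf n (\<lambda>k l. of_bool (k = l)) x = of_real (\<Sum>k<n. (x k)\<^sup>2)"
proof -
  have "(\<Sum>l<n. of_bool (k = l) * complex_of_real (x k * x l)) = of_real ((x k)\<^sup>2)" if "k < n" for k
  proof -
    have "(\<Sum>l<n. of_bool (k = l) * complex_of_real (x k * x l)) = (\<Sum>l<n. of_real (x k * x l) * of_bool (k = l))"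
      by (simp only: mult.commute)
    then show ?thesis using that by (simp add: sum_of_bool_eq power2_eq_square)
  qed
  then show ?thesis unfolding qf_def by simp
qed

lemma sum_identity: "(\<Sum>k<n. \<Sum>l<n. (cmod (of_bool (k = l)))\<^sup>2) = real n"
proof -
  have "(\<Sum>l<n. (cmod (of_bool (k = l)))\<^sup>2) = 1" if "k < n" for k
  proof -
    have "(\<Sum>l<n. (cmod (of_bool (k = l)))\<^sup>2) = (\<Sum>l<n. 1 * of_bool (k = l))"
      by (intro sum.cong) (auto simp: of_bool_def)
    then show ?thesis using that by (simp only: sum_of_bool_eq)
  qed
  then show ?thesis by simp
qed

lemma excess_variance:
  shows "integrable (row_law n) (\<lambda>x. (excess n x)\<^sup>2)"
    and "(\<integral>x. (excess n x)\<^sup>2 \<partial>row_law n) \<le> v * real n"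
proof -
  have eq: "(cmod (qf n (\<lambda>k l. of_bool (k = l)) x - (\<Sum>k<n. of_bool (k = k))))\<^sup>2 = (excess n x)\<^sup>2" for x
  proof -
    have "qf n (\<lambda>k l. of_bool (k = l)) x - (\<Sum>k<n. of_bool (k = k)) = of_real (excess n x)"
      by (simp add: qf_identity excess_def)
    then show ?thesis by simp
  qed
  show "integrable (row_law n) (\<lambda>x. (excess n x)\<^sup>2)"
    using qf_variance(1)[of n "\<lambda>k l. of_bool (k = l)"] unfolding eq .
  show "(\<integral>x. (excess n x)\<^sup>2 \<partial>row_law n) \<le> v * real n"
    using qf_variance(2)[of n "\<lambda>k l. of_bool (k = l)"] unfolding eq sum_identity v_def .
qed

lemma normsq_moments:
  shows "integrable (row_law n) (\<lambda>x. \<Sum>k<n. (x k)\<^sup>2)" "(\<integral>x. (\<Sum>k<n. (x k)\<^sup>2) \<partial>row_law n) = real n"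
    and "integrable (row_law n) (\<lambda>x. (\<Sum>k<n. (x k)\<^sup>2)\<^sup>2)" "(\<integral>x. (\<Sum>k<n. (x k)\<^sup>2)\<^sup>2 \<partial>row_law n) \<le> (real n)\<^sup>2 + v * real n"
proof -
  let ?I = "\<lambda>k l. of_bool (k = l) :: complex"
  have Re: "Re (qf n ?I x) = (\<Sum>k<n. (x k)\<^sup>2)" for x by (simp only: qf_identity Re_complex_of_real)
  have nrm: "(cmod (qf n ?I x))\<^sup>2 = (\<Sum>k<n. (x k)\<^sup>2)\<^sup>2" for x
    by (simp only: qf_identity norm_of_real power2_abs)
  show "integrable (row_law n) (\<lambda>x. \<Sum>k<n. (x k)\<^sup>2)"
    using integrable_Re[OF qf_mean(1)[of n ?I]] unfolding Re .
  show "(\<integral>x. (\<Sum>k<n. (x k)\<^sup>2) \<partial>row_law n) = real n"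
    using integral_Re[OF qf_mean(1)[of n ?I]] unfolding Re qf_mean(2) by simp
  show "integrable (row_law n) (\<lambda>x. (\<Sum>k<n. (x k)\<^sup>2)\<^sup>2)"
    using qf_integrable_cmod_power2[of n ?I] unfolding nrm .
  show "(\<integral>x. (\<Sum>k<n. (x k)\<^sup>2)\<^sup>2 \<partial>row_law n) \<le> (real n)\<^sup>2 + v * real n"
    using qf_cmod_power2[of n ?I] unfolding nrm sum_identity v_def[symmetric] by simp
qed

definition \<xi> :: "real \<Rightarrow> real" where "\<xi> y = y\<^sup>2 - 1"

lemma borel_measurable_xi [measurable]: "\<xi> \<in> borel_measurable borel"
  unfolding \<xi>_def[abs_def] by measurable

lemma xi_moments:
  shows "integrable \<mu> \<xi>" "(\<integral>y. \<xi> y \<partial>\<mu>) = 0" "integrable \<mu> (\<lambda>y. (\<xi> y)\<^sup>2)" "(\<integral>y. (\<xi> y)\<^sup>2 \<partial>\<mu>) \<le> v"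
proof -
  have eq: "(\<xi> y)\<^sup>2 = y ^ 4 - 2 * y\<^sup>2 + 1" for y
    by (simp add: \<xi>_def power2_eq_square power4_eq_xxxx algebra_simps)
  show "integrable \<mu> \<xi>" "(\<integral>y. \<xi> y \<partial>\<mu>) = 0"
    unfolding \<xi>_def[abs_def] using integrable_power_le4[of 2] second_moment by (simp_all add: prob_space)
  show "integrable \<mu> (\<lambda>y. (\<xi> y)\<^sup>2)"
    unfolding eq using integrable_power_le4[of 2] fourth_moment by simp
  have "(\<integral>y. (\<xi> y)\<^sup>2 \<partial>\<mu>) = mom 4 - 2 * mom 2 + 1"
    unfolding eq using integrable_power_le4[of 2] fourth_moment by (simp add: mom_def prob_space)
  then show "(\<integral>y. (\<xi> y)\<^sup>2 \<partial>\<mu>) \<le> v" by (simp add: v_def)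
qed

lemma xi_row_integrable:
  assumes "k < n"
  shows "integrable (row_law n) (\<lambda>x. (\<xi> (x k))\<^sup>2)"
proof -
  interpret R: prob_space "row_law n" by (rule prob_space_row_law)
  have eq: "(\<xi> (x k))\<^sup>2 = x k * x k * x k * x k - 2 * (x k * x k) + 1" for x :: "nat \<Rightarrow> real"
    by (simp add: \<xi>_def power2_eq_square algebra_simps)
  show ?thesis unfolding eq using row_fourth(1)[of k n k k k] row_second(1)[of k n k] assms by simp
qed

text \<open>The threshold \<open>n\<close> is chosen because
  \<open>\<bar>excess n x\<bar> \<le> n\<close> is the event that the squared row norm is at most
  \<open>2 n\<close>. Division by \<open>n\<close> is the natural scale of
  \<open>excess^2\<close>.\<close>

definition tail :: "nat \<Rightarrow> real" where
  "tail n = (\<integral>x. (if \<bar>excess n x\<bar> > real n then (excess n x)\<^sup>2 else 0) \<partial>row_law n) / real n"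

lemma tail_integrable: "integrable (row_law n) (\<lambda>x. if \<bar>excess n x\<bar> > real n then (excess n x)\<^sup>2 else 0)"
  by (rule Bochner_Integration.integrable_bound[OF excess_variance(1)]) auto

lemma tail_nonneg: "tail n \<ge> 0"
  unfolding tail_def by (intro divide_nonneg_nonneg integral_nonneg_AE) auto

definition xi_tail :: "real \<Rightarrow> real" where
  "xi_tail t = (\<integral>y. (if \<bar>\<xi> y\<bar> > t then (\<xi> y)\<^sup>2 else 0) \<partial>\<mu>)"

text \<open>Dominated convergence with the integrable majorant \<open>\<xi>^2\<close>, because for
  fixed \<open>y\<close> the threshold eventually exceeds
  \<open>\<bar>\<xi> y\<bar>\<close>.\<close>

lemma xi_tail_tendsto: "(\<lambda>n. xi_tail (real n / 4)) \<longlonglongrightarrow> 0"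
proof -
  have "(\<lambda>n. \<integral>y. (if \<bar>\<xi> y\<bar> > real n / 4 then (\<xi> y)\<^sup>2 else 0) \<partial>\<mu>) \<longlonglongrightarrow> (\<integral>y. 0 \<partial>\<mu>)"
  proof (rule integral_dominated_convergence[where w="\<lambda>y. (\<xi> y)\<^sup>2"])
    show "AE y in \<mu>. (\<lambda>n. if \<bar>\<xi> y\<bar> > real n / 4 then (\<xi> y)\<^sup>2 else 0) \<longlonglongrightarrow> 0"
    proof (rule AE_I2)
      fix y
      obtain m :: nat where m: "4 * \<bar>\<xi> y\<bar> < real m" using reals_Archimedean2 by blast
      have "eventually (\<lambda>n. (if \<bar>\<xi> y\<bar> > real n / 4 then (\<xi> y)\<^sup>2 else 0) = 0) sequentially"
        using eventually_ge_at_top[of m] by eventually_elim (use m in auto)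
      then show "(\<lambda>n. if \<bar>\<xi> y\<bar> > real n / 4 then (\<xi> y)\<^sup>2 else 0) \<longlonglongrightarrow> 0"
        by (rule tendsto_eventually)
    qed
  qed (use xi_moments in auto)
  then show ?thesis by (simp add: xi_tail_def)
qed

text \<open>With the 1-Lipschitz map \<open>h\<close> that vanishes on \<open>[-t, t]\<close> and \<open>S = S\<^sub>k + \<xi>\<^sub>k\<close>, independence gives
  \<open>E (S h(S)) = (\<Sum>k. E (\<xi>\<^sub>k (h(S) - h(S\<^sub>k))))\<close>, and the increment of \<open>h\<close> is nonzero only if
  \<open>S\<^sub>k\<close> or \<open>\<xi>\<^sub>k\<close> exceeds \<open>t/2\<close>.\<close>

lemma tail_le:
  assumes n: "n > 0"
  shows "tail n \<le> 2 * (64 * v\<^sup>2 / real n + xi_tail (real n / 4))"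
proof -
  interpret R: prob_space "row_law n" by (rule prob_space_row_law)
  \<comment> \<open>Half the threshold: for \<open>\<bar>s\<bar> > n = 2 t\<close> one has
    \<open>\<bar>s\<bar> \<le> 2 (\<bar>s\<bar> - t)\<close>, which makes \<open>2 s h(s)\<close> a
    majorant of the truncated square.\<close>
  define t where "t = real n / 2"
  have t: "t > 0" using n by (simp add: t_def)
  define h where "h s = s - max (- t) (min t s)" for s :: real
  have hm [measurable]: "h \<in> borel_measurable borel" unfolding h_def[abs_def] by measurable
  have h_le: "\<bar>h s\<bar> \<le> \<bar>s\<bar>" for s using t by (auto simp: h_def max_def min_def)
  have h_lip: "\<bar>h r - h s\<bar> \<le> \<bar>r - s\<bar>" for r s using t by (auto simp: h_def max_def min_def abs_if)
  have h_zero: "h s = 0" if "\<bar>s\<bar> \<le> t" for s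
  proof -
    have "s \<le> t" "- t \<le> s" using that by auto
    then show ?thesis by (simp add: h_def min_absorb2 max_absorb2)
  qed
  have h_big: "(if \<bar>s\<bar> > real n then s\<^sup>2 else 0) \<le> 2 * (s * h s)" for s
  proof (cases "\<bar>s\<bar> > t")
    case True
    have "s * h s = \<bar>s\<bar> * (\<bar>s\<bar> - t)"
    proof (cases "s > 0")
      case True
      then have "h s = s - t" using \<open>\<bar>s\<bar> > t\<close> t by (simp add: h_def min_absorb1 max_absorb2)
      then show ?thesis using True by simp
    next
      case False
      then have "h s = s + t" using \<open>\<bar>s\<bar> > t\<close> t by (simp add: h_def min_absorb2 max_absorb1)
      then show ?thesis using False by (simp add: algebra_simps)
    qed
    moreover have "0 \<le> \<bar>s\<bar> * (\<bar>s\<bar> - t)" using True by simp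
    moreover have "s\<^sup>2 \<le> 2 * (\<bar>s\<bar> * (\<bar>s\<bar> - t))" if "\<bar>s\<bar> > real n"
    proof -
      have "\<bar>s\<bar> * \<bar>s\<bar> \<le> \<bar>s\<bar> * (2 * (\<bar>s\<bar> - t))"
        using that by (intro mult_left_mono) (auto simp: t_def)
      then show ?thesis by (simp add: power2_eq_square algebra_simps)
    qed
    ultimately show ?thesis by auto
  next
    case False
    then show ?thesis using h_zero[of s] t by (simp add: t_def)
  qed
  define S' where "S' k x = (\<Sum>l\<in>{..<n} - {k}. \<xi> (x l))" for k x
  have exc: "excess n x = (\<Sum>k<n. \<xi> (x k))" for x
    by (simp add: excess_def \<xi>_def sum_subtractf)
  have S: "excess n x = \<xi> (x k) + S' k x" if "k < n" for k x
    unfolding exc S'_def using that by (simp add: sum.remove[of "{..<n}" k])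
  have S'upd: "S' k (x(k := y)) = S' k x" for k x y
    unfolding S'_def by (intro sum.cong) auto
  have xim [measurable]: "(\<lambda>x. \<xi> (x k)) \<in> borel_measurable (row_law n)" if "k < n" for k
    using row_component[OF that] by measurable
  have S'm [measurable]: "S' k \<in> borel_measurable (row_law n)" for k
    unfolding S'_def[abs_def] by (intro borel_measurable_sum xim) auto
  have S'2: "integrable (row_law n) (\<lambda>x. (S' k x)\<^sup>2)"
    "(\<integral>x. (S' k x)\<^sup>2 \<partial>row_law n) \<le> 4 * v * real n" if k: "k < n" for k
  proof -
    have le: "(S' k x)\<^sup>2 \<le> 2 * (excess n x)\<^sup>2 + 2 * (\<xi> (x k))\<^sup>2" for x
    proof -
      have "S' k x = excess n x - \<xi> (x k)" using S[OF k, of x] by simp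
      then show ?thesis using diff_power2_le[of "excess n x" "\<xi> (x k)"] by simp
    qed
    have I: "integrable (row_law n) (\<lambda>x. 2 * (excess n x)\<^sup>2 + 2 * (\<xi> (x k))\<^sup>2)"
      using excess_variance(1) xi_row_integrable[OF k] by simp
    show 1: "integrable (row_law n) (\<lambda>x. (S' k x)\<^sup>2)"
      by (rule Bochner_Integration.integrable_bound[OF I]) (auto simp: le)
    have "(\<integral>x. (\<xi> (x k))\<^sup>2 * 1 \<partial>row_law n) = (\<integral>y. (\<xi> y)\<^sup>2 \<partial>\<mu>) * (\<integral>x. 1 \<partial>row_law n)"
      by (rule row_integral_independent[OF k, where g="\<lambda>_. 1" and f="\<lambda>y. (\<xi> y)\<^sup>2"]) (use xi_row_integrable[OF k] in auto)
    then have xi2: "(\<integral>x. (\<xi> (x k))\<^sup>2 \<partial>row_law n) \<le> v" using xi_moments(4) by (simp add: R.prob_space)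
    have "(\<integral>x. (S' k x)\<^sup>2 \<partial>row_law n) \<le> (\<integral>x. 2 * (excess n x)\<^sup>2 + 2 * (\<xi> (x k))\<^sup>2 \<partial>row_law n)"
      by (intro integral_mono 1 I le)
    also have "\<dots> = 2 * (\<integral>x. (excess n x)\<^sup>2 \<partial>row_law n) + 2 * (\<integral>x. (\<xi> (x k))\<^sup>2 \<partial>row_law n)"
      using excess_variance(1) xi_row_integrable[OF k] by simp
    also have "\<dots> \<le> 2 * (v * real n) + 2 * v" using excess_variance(2)[of n] xi2 by simp
    also have "\<dots> \<le> 4 * v * real n"
    proof -
      have "v * 1 \<le> v * real n" using n v_ge by (intro mult_left_mono) auto
      then have "2 * (v * real n) + 2 * v \<le> 4 * (v * real n)" by linarith
      then show ?thesis by (simp only: mult.assoc)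
    qed
    finally show "(\<integral>x. (S' k x)\<^sup>2 \<partial>row_law n) \<le> 4 * v * real n" .
  qed
  have hint: "integrable (row_law n) (\<lambda>x. \<xi> (x k) * h (excess n x))" if k: "k < n" for k
  proof (rule Bochner_Integration.integrable_bound)
    show "integrable (row_law n) (\<lambda>x. (\<xi> (x k))\<^sup>2 + (excess n x)\<^sup>2)"
      using excess_variance(1) xi_row_integrable[OF k] by simp
    have "\<bar>\<xi> (x k) * h (excess n x)\<bar> \<le> (\<xi> (x k))\<^sup>2 + (excess n x)\<^sup>2" for x
    proof -
      have "\<bar>\<xi> (x k) * h (excess n x)\<bar> \<le> \<bar>\<xi> (x k)\<bar> * \<bar>excess n x\<bar>"
        unfolding abs_mult by (intro mult_left_mono h_le) auto
      then show ?thesis using abs_mult_le_power2[of "\<xi> (x k)" "excess n x"] by linarith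
    qed
    then show "AE x in row_law n. norm (\<xi> (x k) * h (excess n x)) \<le> norm ((\<xi> (x k))\<^sup>2 + (excess n x)\<^sup>2)"
      by (intro AE_I2) (simp add: order_trans[OF _ abs_ge_self])
    show "(\<lambda>x. \<xi> (x k) * h (excess n x)) \<in> borel_measurable (row_law n)"
      using xim[OF k] by measurable
  qed
  have term_le: "(\<integral>x. \<xi> (x k) * h (excess n x) \<partial>row_law n) \<le> 64 * v\<^sup>2 / real n + xi_tail (real n / 4)"
    if k: "k < n" for k
  proof -
    note xk = xim[OF k, measurable]
    have S'i: "integrable (row_law n) (S' k)"
      using S'2(1)[OF k] by (rule R.square_integrable_imp_integrable[rotated]) simp
    have hS'i: "integrable (row_law n) (\<lambda>x. h (S' k x))"
      by (rule Bochner_Integration.integrable_bound[OF S'i]) (use h_le in auto)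
    have prod_int: "integrable (row_law n) (\<lambda>x. \<xi> (x k) * h (S' k x))"
    proof (rule Bochner_Integration.integrable_bound)
      show "integrable (row_law n) (\<lambda>x. (\<xi> (x k))\<^sup>2 + (S' k x)\<^sup>2)"
        using S'2(1)[OF k] xi_row_integrable[OF k] by simp
      have "\<bar>\<xi> (x k) * h (S' k x)\<bar> \<le> (\<xi> (x k))\<^sup>2 + (S' k x)\<^sup>2" for x
      proof -
        have "\<bar>\<xi> (x k) * h (S' k x)\<bar> \<le> \<bar>\<xi> (x k)\<bar> * \<bar>S' k x\<bar>"
          unfolding abs_mult by (intro mult_left_mono h_le) auto
        then show ?thesis using abs_mult_le_power2[of "\<xi> (x k)" "S' k x"] by linarith
      qed
      then show "AE x in row_law n. norm (\<xi> (x k) * h (S' k x)) \<le> norm ((\<xi> (x k))\<^sup>2 + (S' k x)\<^sup>2)"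
        by (intro AE_I2) (simp add: order_trans[OF _ abs_ge_self])
    qed measurable
    have zero: "(\<integral>x. \<xi> (x k) * h (S' k x) \<partial>row_law n) = 0"
    proof -
      have "(\<integral>x. \<xi> (x k) * h (S' k x) \<partial>row_law n) = (\<integral>y. \<xi> y \<partial>\<mu>) * (\<integral>x. h (S' k x) \<partial>row_law n)"
        by (rule row_integral_independent[OF k _ prod_int hS'i]) (simp only: S'upd)
      then show ?thesis by (simp add: xi_moments)
    qed
    \<comment> \<open>\<open>p\<close> marks the event that the remaining sum is large,
      \<open>r\<close> keeps the part where the single term is. If both stay below
      \<open>t / 2\<close>, the full sum and the remaining sum lie in \<open>[-t, t]\<close>, where
      \<open>h\<close> vanishes.\<close>
    define p where "p x = (if \<bar>S' k x\<bar> > t / 2 then 1 else 0 :: real)" for x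
    define r where "r y = (if \<bar>\<xi> y\<bar> > t / 2 then (\<xi> y)\<^sup>2 else 0)" for y
    have pm [measurable]: "p \<in> borel_measurable (row_law n)" unfolding p_def[abs_def] by measurable
    have rm [measurable]: "r \<in> borel_measurable borel" unfolding r_def[abs_def] by measurable
    have pint: "integrable (row_law n) p"
      by (rule R.integrable_const_bound[of _ 1]) (auto simp: p_def)
    have xip: "integrable (row_law n) (\<lambda>x. (\<xi> (x k))\<^sup>2 * p x)"
      by (rule Bochner_Integration.integrable_bound[OF xi_row_integrable[OF k]]) (auto simp: p_def)
    have rint: "integrable (row_law n) (\<lambda>x. r (x k) * 1)"
      by (rule Bochner_Integration.integrable_bound[OF xi_row_integrable[OF k]])
         (use row_component[OF k] in \<open>auto simp: r_def\<close>)
    have le: "\<xi> (x k) * h (excess n x) - \<xi> (x k) * h (S' k x) \<le> (\<xi> (x k))\<^sup>2 * p x + r (x k) * 1" for x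
    proof -
      have inc: "\<bar>h (excess n x) - h (S' k x)\<bar> \<le> \<bar>\<xi> (x k)\<bar>"
        using h_lip[of "excess n x" "S' k x"] S[OF k, of x] by simp
      have "\<xi> (x k) * (h (excess n x) - h (S' k x)) \<le> \<bar>\<xi> (x k)\<bar> * \<bar>h (excess n x) - h (S' k x)\<bar>"
        by (metis abs_ge_self abs_mult)
      also have "\<dots> \<le> (\<xi> (x k))\<^sup>2 * p x + r (x k)"
      proof (cases "\<bar>S' k x\<bar> > t / 2 \<or> \<bar>\<xi> (x k)\<bar> > t / 2")
        case True
        have "\<bar>\<xi> (x k)\<bar> * \<bar>h (excess n x) - h (S' k x)\<bar> \<le> \<bar>\<xi> (x k)\<bar> * \<bar>\<xi> (x k)\<bar>"
          using inc by (intro mult_left_mono) auto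
        then have "\<bar>\<xi> (x k)\<bar> * \<bar>h (excess n x) - h (S' k x)\<bar> \<le> (\<xi> (x k))\<^sup>2"
          by (simp add: power2_eq_square)
        also have "(\<xi> (x k))\<^sup>2 \<le> (\<xi> (x k))\<^sup>2 * p x + r (x k)"
          using True zero_le_power2[of "\<xi> (x k)"] unfolding p_def r_def by (auto split: if_splits)
        finally show ?thesis .
      next
        case False
        then have "\<bar>excess n x\<bar> \<le> t" "\<bar>S' k x\<bar> \<le> t" using S[OF k, of x] by auto
        then show ?thesis by (simp add: h_zero p_def r_def)
      qed
      finally show ?thesis by (simp add: right_diff_distrib)
    qed
    have "(\<integral>x. \<xi> (x k) * h (excess n x) \<partial>row_law n)
        = (\<integral>x. \<xi> (x k) * h (excess n x) - \<xi> (x k) * h (S' k x) \<partial>row_law n)"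
      using hint[OF k] prod_int zero by simp
    also have "\<dots> \<le> (\<integral>x. (\<xi> (x k))\<^sup>2 * p x + r (x k) * 1 \<partial>row_law n)"
      using hint[OF k] prod_int xip rint by (intro integral_mono le) auto
    also have "\<dots> = (\<integral>x. (\<xi> (x k))\<^sup>2 * p x \<partial>row_law n) + (\<integral>x. r (x k) * 1 \<partial>row_law n)"
      using xip rint by (rule Bochner_Integration.integral_add)
    \<comment> \<open>\<open>p\<close> depends on the other coordinates alone, so the expectation
      factors and the second moment of \<open>\<xi>\<close> suffices.\<close>
    also have "(\<integral>x. (\<xi> (x k))\<^sup>2 * p x \<partial>row_law n) = (\<integral>y. (\<xi> y)\<^sup>2 \<partial>\<mu>) * (\<integral>x. p x \<partial>row_law n)"
      by (rule row_integral_independent[OF k _ xip pint]) (simp only: p_def S'upd)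
    also have "(\<integral>x. r (x k) * 1 \<partial>row_law n) = (\<integral>y. r y \<partial>\<mu>) * (\<integral>x. 1 \<partial>row_law n)"
      by (rule row_integral_independent[OF k _ rint]) auto
    also have "(\<integral>y. r y \<partial>\<mu>) * (\<integral>x. 1 \<partial>row_law n) = xi_tail (real n / 4)"
      by (simp add: R.prob_space r_def xi_tail_def t_def)
    \<comment> \<open>Chebyshev at level \<open>t / 2\<close> with the bound \<open>4 v n\<close>
      for the second moment of the remaining sum.\<close>
    also have "(\<integral>y. (\<xi> y)\<^sup>2 \<partial>\<mu>) * (\<integral>x. p x \<partial>row_law n) \<le> v * (16 * v * real n / t\<^sup>2)"
    proof (intro mult_mono xi_moments(4))
      have "(\<integral>x. p x \<partial>row_law n) \<le> (\<integral>x. 4 / t\<^sup>2 * (S' k x)\<^sup>2 \<partial>row_law n)"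
      proof (intro integral_mono pint)
        show "integrable (row_law n) (\<lambda>x. 4 / t\<^sup>2 * (S' k x)\<^sup>2)" using S'2(1)[OF k] by simp
        fix x
        show "p x \<le> 4 / t\<^sup>2 * (S' k x)\<^sup>2"
        proof (cases "\<bar>S' k x\<bar> > t / 2")
          case True
          then have "(t / 2)\<^sup>2 \<le> \<bar>S' k x\<bar>\<^sup>2" using t by (intro power_mono) auto
          then have "t\<^sup>2 \<le> 4 * (S' k x)\<^sup>2" by (simp add: power_divide)
          then show ?thesis using True t by (simp add: p_def field_simps)
        qed (simp add: p_def)
      qed
      also have "\<dots> = 4 / t\<^sup>2 * (\<integral>x. (S' k x)\<^sup>2 \<partial>row_law n)" by simp
      also have "\<dots> \<le> 4 / t\<^sup>2 * (4 * v * real n)" by (intro mult_left_mono S'2(2)[OF k]) auto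
      finally show "(\<integral>x. p x \<partial>row_law n) \<le> 16 * v * real n / t\<^sup>2" by simp
      show "0 \<le> v" using v_ge by simp
      show "0 \<le> (\<integral>x. p x \<partial>row_law n)" by (intro integral_nonneg_AE) (auto simp: p_def)
    qed
    also have "v * (16 * v * real n / t\<^sup>2) = 64 * v\<^sup>2 / real n"
      using n by (simp add: t_def power2_eq_square field_simps)
    finally show ?thesis by simp
  qed
  have "(\<integral>x. (if \<bar>excess n x\<bar> > real n then (excess n x)\<^sup>2 else 0) \<partial>row_law n)
      \<le> (\<integral>x. 2 * (\<Sum>k<n. \<xi> (x k) * h (excess n x)) \<partial>row_law n)"
  proof (rule integral_mono[OF tail_integrable])
    show "integrable (row_law n) (\<lambda>x. 2 * (\<Sum>k<n. \<xi> (x k) * h (excess n x)))"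
      by (intro integrable_mult_right Bochner_Integration.integrable_sum hint) auto
    show "(if \<bar>excess n x\<bar> > real n then (excess n x)\<^sup>2 else 0) \<le> 2 * (\<Sum>k<n. \<xi> (x k) * h (excess n x))" for x
      using h_big[of "excess n x"] unfolding sum_distrib_right[symmetric] exc[symmetric] .
  qed
  also have "\<dots> = 2 * (\<Sum>k<n. \<integral>x. \<xi> (x k) * h (excess n x) \<partial>row_law n)"
    by (simp add: Bochner_Integration.integral_sum hint)
  also have "\<dots> \<le> 2 * (\<Sum>k<n. 64 * v\<^sup>2 / real n + xi_tail (real n / 4))"
    by (intro mult_left_mono sum_mono term_le) auto
  also have "\<dots> = 2 * (64 * v\<^sup>2 / real n + xi_tail (real n / 4)) * real n" by simp
  finally show ?thesis
    using n unfolding tail_def by (simp add: pos_divide_le_eq)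
qed

lemma tail_tendsto: "tail \<longlonglongrightarrow> 0"
proof (rule tendsto_sandwich)
  show "eventually (\<lambda>n. 0 \<le> tail n) sequentially" by (simp add: tail_nonneg)
  show "eventually (\<lambda>n. tail n \<le> 2 * (64 * v\<^sup>2 / real n + xi_tail (real n / 4))) sequentially"
    using eventually_gt_at_top[of 0] by eventually_elim (rule tail_le)
  have "(\<lambda>n. 2 * (64 * v\<^sup>2 / real n + xi_tail (real n / 4))) \<longlonglongrightarrow> 2 * (0 + 0)"
    by (intro tendsto_intros xi_tail_tendsto lim_const_over_n)
  then show "(\<lambda>n. 2 * (64 * v\<^sup>2 / real n + xi_tail (real n / 4))) \<longlonglongrightarrow> 0" by simp
qed simp

end

section \<open>Removing one row\<close>

lemma norm_diff_cube_le:
  fixes p q :: complex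
  assumes "cmod p \<le> K" "cmod q \<le> K"
  shows "cmod (p ^ 3 - q ^ 3) \<le> 3 * K\<^sup>2 * cmod (p - q)"
proof -
  have K: "K \<ge> 0" using assms(1) norm_ge_zero[of p] by linarith
  have "p ^ 3 - q ^ 3 = (p - q) * (p\<^sup>2 + p * q + q\<^sup>2)"
    by (simp add: power2_eq_square power3_eq_cube algebra_simps)
  moreover have "cmod (p\<^sup>2 + p * q + q\<^sup>2) \<le> K\<^sup>2 + K * K + K\<^sup>2"
    using assms K by (intro order_trans[OF norm_triangle_ineq] add_mono)
      (auto simp: norm_mult norm_power intro!: mult_mono power_mono)
  then have "cmod (p\<^sup>2 + p * q + q\<^sup>2) \<le> 3 * K\<^sup>2" by (simp add: power2_eq_square)
  ultimately show ?thesis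
    using mult_left_mono[of "cmod (p\<^sup>2 + p * q + q\<^sup>2)" "3 * K\<^sup>2" "cmod (p - q)"]
    by (simp add: norm_mult ac_simps)
qed

lemma (in prob_space) integral_abs_le_sqrt:
  fixes f :: "'a \<Rightarrow> complex"
  assumes "integrable M f" "integrable M (\<lambda>x. (cmod (f x))\<^sup>2)" "(\<integral>x. (cmod (f x))\<^sup>2 \<partial>M) \<le> K"
  shows "(\<integral>x. cmod (f x) \<partial>M) \<le> sqrt K"
proof -
  have "(cmod (\<integral>x. complex_of_real (cmod (f x)) \<partial>M))\<^sup>2 \<le> (\<integral>x. (cmod (complex_of_real (cmod (f x))))\<^sup>2 \<partial>M)"
    using assms(1,2) by (intro cmod_integral_power2_le) auto
  then have "(\<integral>x. cmod (f x) \<partial>M)\<^sup>2 \<le> K" using assms(3) by simp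
  then show ?thesis by (rule real_le_rsqrt)
qed

text \<open>The conditional situation after all other rows are frozen: \<open>A\<close> and
  \<open>G\<close> are deterministic and only the added row \<open>x\<close> is random.\<close>

locale cavity = standardized_law \<mu> + resolvent_fun n A z G
  for \<mu> n A z G +
  fixes a :: real
  assumes a_pos: "a > 0" and n_pos: "n > 0"
begin

sublocale rk: rank_one_update n A z G a x for x
  by standard (rule a_pos)

sublocale R: prob_space "row_law n" by (rule prob_space_row_law)

lemma normsq_eq: "rk.normsq x = excess n x + real n"
  by (simp add: rk.normsq_def excess_def)

lemma normsq_small: "\<bar>excess n x\<bar> \<le> real n \<Longrightarrow> rk.normsq x \<le> 2 * real n"
  unfolding normsq_eq by linarith

lemma normsq_large:
  assumes "\<not> \<bar>excess n x\<bar> \<le> real n"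
  shows "rk.normsq x \<le> 2 * excess n x" "excess n x > real n"
  using assms rk.normsq_nonneg[of x] unfolding normsq_eq by linarith+

text \<open>This is \<open>G^T G\<close>, hence \<open>G^2\<close> by symmetry; it presents
  \<open>s\<close> as a quadratic form in the row.\<close>

definition G2 where "G2 k l = (\<Sum>i<n. G i k * G i l)"

lemma q_qf: "rk.q x = qf n G x"
  unfolding rk.q_def rk.u_def app_def qf_def sum_distrib_left by (simp add: ac_simps)

lemma s_qf: "rk.s x = qf n G2 x"
proof -
  have "rk.s x = (\<Sum>i<n. (\<Sum>k<n. G i k * of_real (x k)) * (\<Sum>l<n. G i l * of_real (x l)))"
    by (simp add: rk.s_def rk.u_def app_def power2_eq_square)
  also have "\<dots> = (\<Sum>i<n. \<Sum>k<n. \<Sum>l<n. G i k * G i l * of_real (x k * x l))"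
    unfolding sum_product by (simp add: mult_ac)
  also have "\<dots> = (\<Sum>k<n. \<Sum>i<n. \<Sum>l<n. G i k * G i l * of_real (x k * x l))"
    by (rule sum.swap)
  also have "\<dots> = (\<Sum>k<n. \<Sum>l<n. \<Sum>i<n. G i k * G i l * of_real (x k * x l))"
    by (rule sum.cong[OF refl]) (rule sum.swap)
  also have "\<dots> = qf n G2 x"
    unfolding qf_def G2_def sum_distrib_right ..
  finally show ?thesis .
qed

lemma trace_G2: "(\<Sum>k<n. G2 k k) = trace_sq"
  unfolding G2_def trace_sq_def by (subst sum.swap) (simp add: power2_eq_square)

lemma trace_sq_swap: "(\<Sum>k<n. \<Sum>l<n. G k l * G l k) = trace_sq"
  unfolding trace_sq_def by (intro sum.cong refl) (simp add: power2_eq_square symG)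

lemma frobenius_G2: "(\<Sum>k<n. \<Sum>l<n. (cmod (G2 k l))\<^sup>2) \<le> real n / (Im z) ^ 4"
proof -
  have "(\<Sum>k<n. \<Sum>l<n. (cmod (G2 k l))\<^sup>2) = (\<Sum>l<n. \<Sum>k<n. (cmod (G2 k l))\<^sup>2)" by (rule sum.swap)
  also have "\<dots> \<le> (\<Sum>l<n. 1 / (Im z) ^ 4)"
  proof (rule sum_mono)
    fix l assume l: "l \<in> {..<n}"
    have "(\<Sum>k<n. (cmod (G2 k l))\<^sup>2) = (\<Sum>k<n. (cmod (app (\<lambda>i. G i l) k))\<^sup>2)"
      unfolding G2_def app_def by (intro sum.cong refl arg_cong[where f="\<lambda>t. (cmod t)\<^sup>2"]) (simp add: symG)
    also have "\<dots> \<le> (\<Sum>i<n. (cmod (G i l))\<^sup>2) / (Im z)\<^sup>2" by (rule app_norm)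
    also have "\<dots> \<le> (1 / (Im z)\<^sup>2) / (Im z)\<^sup>2"
      using l by (intro divide_right_mono column_norm) auto
    finally show "(\<Sum>k<n. (cmod (G2 k l))\<^sup>2) \<le> 1 / (Im z) ^ 4"
      by (simp add: power2_eq_square power4_eq_xxxx mult.assoc)
  qed
  finally show ?thesis by simp
qed

text \<open>By the symmetry of \<open>G\<close> both cross pairings equal the trace of
  \<open>G^2\<close>, which explains the coefficient 2.\<close>

lemma q_moments:
  shows "integrable (row_law n) rk.q" "(\<integral>x. rk.q x \<partial>row_law n) = trace"
    and "integrable (row_law n) (\<lambda>x. (rk.q x)\<^sup>2)"
      "(\<integral>x. (rk.q x)\<^sup>2 \<partial>row_law n) = trace\<^sup>2 + 2 * trace_sq + of_real \<kappa> * diag_sq"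
    and "integrable (row_law n) (\<lambda>x. (cmod (rk.q x - trace))\<^sup>2)"
      "(\<integral>x. (cmod (rk.q x - trace))\<^sup>2 \<partial>row_law n) \<le> v * real n / (Im z)\<^sup>2"
proof -
  show "integrable (row_law n) rk.q" "(\<integral>x. rk.q x \<partial>row_law n) = trace"
    unfolding q_qf[abs_def] using qf_mean[of n G] by (simp_all add: trace_def)
  have sq: "(rk.q x)\<^sup>2 = qf n G x * qf n G x" for x by (simp add: q_qf power2_eq_square)
  have "(\<Sum>k<n. \<Sum>l<n. G k l * G k l) = trace_sq" "(\<Sum>k<n. G k k * G k k) = diag_sq"
    by (simp_all add: trace_sq_def diag_sq_def power2_eq_square)
  then show "integrable (row_law n) (\<lambda>x. (rk.q x)\<^sup>2)"
      "(\<integral>x. (rk.q x)\<^sup>2 \<partial>row_law n) = trace\<^sup>2 + 2 * trace_sq + of_real \<kappa> * diag_sq"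
    unfolding sq using qf_product_mean[of n G G]
    by (simp_all add: trace_sq_swap trace_def[symmetric] power2_eq_square)
  have "v * (\<Sum>k<n. \<Sum>l<n. (cmod (G k l))\<^sup>2) \<le> v * (real n / (Im z)\<^sup>2)"
    using v_ge by (intro mult_left_mono frobenius_norm) auto
  then show "integrable (row_law n) (\<lambda>x. (cmod (rk.q x - trace))\<^sup>2)"
      "(\<integral>x. (cmod (rk.q x - trace))\<^sup>2 \<partial>row_law n) \<le> v * real n / (Im z)\<^sup>2"
    unfolding q_qf using qf_variance[of n G] by (simp_all add: trace_def[symmetric] v_def[symmetric])
qed

lemma s_moments:
  shows "integrable (row_law n) rk.s" "(\<integral>x. rk.s x \<partial>row_law n) = trace_sq"
    and "integrable (row_law n) (\<lambda>x. (cmod (rk.s x - trace_sq))\<^sup>2)"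
      "(\<integral>x. (cmod (rk.s x - trace_sq))\<^sup>2 \<partial>row_law n) \<le> v * real n / (Im z) ^ 4"
proof -
  show "integrable (row_law n) rk.s" "(\<integral>x. rk.s x \<partial>row_law n) = trace_sq"
    unfolding s_qf[abs_def] using qf_mean[of n G2] by (simp_all add: trace_G2)
  have "v * (\<Sum>k<n. \<Sum>l<n. (cmod (G2 k l))\<^sup>2) \<le> v * (real n / (Im z) ^ 4)"
    using v_ge by (intro mult_left_mono frobenius_G2) auto
  then show "integrable (row_law n) (\<lambda>x. (cmod (rk.s x - trace_sq))\<^sup>2)"
      "(\<integral>x. (cmod (rk.s x - trace_sq))\<^sup>2 \<partial>row_law n) \<le> v * real n / (Im z) ^ 4"
    unfolding s_qf using qf_variance[of n G2] by (simp_all add: trace_G2 v_def[symmetric])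
qed

lemma q_measurable [measurable]: "rk.q \<in> borel_measurable (row_law n)"
  using q_moments(1) by (rule borel_measurable_integrable)

lemma s_measurable [measurable]: "rk.s \<in> borel_measurable (row_law n)"
  using s_moments(1) by (rule borel_measurable_integrable)

lemma R3_measurable [measurable]: "rk.R3 \<in> borel_measurable (row_law n)"
  unfolding rk.R3_def[abs_def] by measurable

lemma beta_measurable [measurable]: "rk.\<beta> \<in> borel_measurable (row_law n)"
  unfolding rk.\<beta>_def[abs_def] by measurable

lemma R4_measurable [measurable]: "rk.R4 \<in> borel_measurable (row_law n)"
  unfolding rk.R4_def[abs_def] by measurable

lemma normsq_integrals:
  shows "integrable (row_law n) rk.normsq" "(\<integral>x. rk.normsq x \<partial>row_law n) = real n"
    and "integrable (row_law n) (\<lambda>x. (rk.normsq x)\<^sup>2)" "(\<integral>x. (rk.normsq x)\<^sup>2 \<partial>row_law n) \<le> (1 + v) * (real n)\<^sup>2"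
proof -
  show "integrable (row_law n) rk.normsq" "(\<integral>x. rk.normsq x \<partial>row_law n) = real n"
    "integrable (row_law n) (\<lambda>x. (rk.normsq x)\<^sup>2)"
    unfolding rk.normsq_def[abs_def] using normsq_moments[of n] by simp_all
  have "v * real n * 1 \<le> v * real n * real n" using n_pos v_ge by (intro mult_left_mono) auto
  then show "(\<integral>x. (rk.normsq x)\<^sup>2 \<partial>row_law n) \<le> (1 + v) * (real n)\<^sup>2"
    unfolding rk.normsq_def[abs_def] using normsq_moments(4)[of n] by (simp add: algebra_simps power2_eq_square)
qed

text \<open>\<open>R4_le1\<close> gives integrability; \<open>R4_le2\<close> together with the
  second moment of \<open>normsq\<close>, of order \<open>n^2\<close>, gives the size
  \<open>(a n)^2\<close> of the mean.\<close>

lemma R4_integral: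
  shows "integrable (row_law n) rk.R4"
    and "(\<integral>x. cmod (rk.R4 x) \<partial>row_law n) \<le> 6 * (1 + v) * a\<^sup>2 * (real n)\<^sup>2 / (Im z) ^ 3"
proof -
  have nn: "0 \<le> 3 * a * rk.normsq x / (Im z)\<^sup>2" for x
    using a_pos rk.normsq_nonneg[of x] by simp
  show I: "integrable (row_law n) rk.R4"
  proof (rule Bochner_Integration.integrable_bound)
    show "integrable (row_law n) (\<lambda>x. 3 * a * rk.normsq x / (Im z)\<^sup>2)"
      using normsq_integrals(1) by simp
    show "AE x in row_law n. norm (rk.R4 x) \<le> norm (3 * a * rk.normsq x / (Im z)\<^sup>2)"
      by (intro AE_I2) (simp only: real_norm_def abs_of_nonneg[OF nn] rk.R4_le1)
  qed measurable
  have "(\<integral>x. cmod (rk.R4 x) \<partial>row_law n) \<le> (\<integral>x. 6 * a\<^sup>2 / (Im z) ^ 3 * (rk.normsq x)\<^sup>2 \<partial>row_law n)"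
    using I normsq_integrals(3) rk.R4_le2 by (intro integral_mono) simp_all
  also have "\<dots> = 6 * a\<^sup>2 / (Im z) ^ 3 * (\<integral>x. (rk.normsq x)\<^sup>2 \<partial>row_law n)" by simp
  also have "\<dots> \<le> 6 * a\<^sup>2 / (Im z) ^ 3 * ((1 + v) * (real n)\<^sup>2)"
    using Im_z by (intro mult_left_mono normsq_integrals(4)) auto
  finally show "(\<integral>x. cmod (rk.R4 x) \<partial>row_law n) \<le> 6 * (1 + v) * a\<^sup>2 * (real n)\<^sup>2 / (Im z) ^ 3"
    by (simp add: algebra_simps)
qed

lemma R3_integrable: "integrable (row_law n) rk.R3"
proof (rule Bochner_Integration.integrable_bound)
  show "integrable (row_law n) (\<lambda>x. 5 * a * (rk.normsq x)\<^sup>2 / (Im z)\<^sup>2)"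
    using normsq_integrals(3) by simp
  show "AE x in row_law n. norm (rk.R3 x) \<le> norm (5 * a * (rk.normsq x)\<^sup>2 / (Im z)\<^sup>2)"
    using rk.R3_le1 a_pos by (intro AE_I2) simp
qed measurable

definition tail_excess where "tail_excess x = (if \<bar>excess n x\<bar> > real n then (excess n x)\<^sup>2 else 0)"

lemma tail_excess_integral:
  "integrable (row_law n) tail_excess" "(\<integral>x. tail_excess x \<partial>row_law n) = real n * tail n"
  unfolding tail_excess_def[abs_def] using tail_integrable[of n] n_pos by (simp_all add: tail_def)

text \<open>If \<open>normsq <= 2 n\<close>, the cubic term is extracted and \<open>q\<close> is
  replaced by its mean through the Lipschitz bound of the cube; otherwise both terms are absorbed by
  \<open>excess^2\<close>. The constants are \<open>352 = 22 * 2^4\<close>,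
  \<open>12 = 3 * 2^2\<close> and \<open>20 = 5 * 2^2\<close>.\<close>

lemma R3_expansion:
  "cmod (rk.R3 x - (of_real a)\<^sup>2 * trace ^ 3)
    \<le> 352 * a ^ 3 * (real n) ^ 4 / (Im z) ^ 4 + 12 * a\<^sup>2 * (real n)\<^sup>2 / (Im z)\<^sup>2 * cmod (rk.q x - trace)
      + (20 * a / (Im z)\<^sup>2 + a\<^sup>2 * real n / (Im z) ^ 3) * tail_excess x"
proof (cases "\<bar>excess n x\<bar> \<le> real n")
  case True
  note ns = normsq_small[OF True]
  have "cmod (rk.R3 x - (of_real a)\<^sup>2 * rk.q x ^ 3) \<le> 22 * a ^ 3 * rk.normsq x ^ 4 / (Im z) ^ 4"
    by (rule rk.R3_le2)
  also have "\<dots> \<le> 22 * a ^ 3 * (2 * real n) ^ 4 / (Im z) ^ 4"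
    using a_pos rk.normsq_nonneg ns Im_z by (intro divide_right_mono mult_left_mono power_mono) auto
  finally have 1: "cmod (rk.R3 x - (of_real a)\<^sup>2 * rk.q x ^ 3) \<le> 352 * a ^ 3 * (real n) ^ 4 / (Im z) ^ 4"
    by simp
  have "cmod (rk.q x) \<le> 2 * real n / Im z"
    using rk.q_le[of x] ns Im_z by (meson divide_right_mono less_imp_le order_trans)
  moreover have "cmod trace \<le> 2 * real n / Im z"
    using trace_norm Im_z by (simp add: field_simps)
  ultimately have "cmod (rk.q x ^ 3 - trace ^ 3) \<le> 3 * (2 * real n / Im z)\<^sup>2 * cmod (rk.q x - trace)"
    by (rule norm_diff_cube_le)
  then have "a\<^sup>2 * cmod (rk.q x ^ 3 - trace ^ 3) \<le> a\<^sup>2 * (3 * (2 * real n / Im z)\<^sup>2 * cmod (rk.q x - trace))"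
    by (intro mult_left_mono) auto
  then have 2: "cmod ((of_real a)\<^sup>2 * rk.q x ^ 3 - (of_real a)\<^sup>2 * trace ^ 3)
      \<le> 12 * a\<^sup>2 * (real n)\<^sup>2 / (Im z)\<^sup>2 * cmod (rk.q x - trace)"
    by (simp add: norm_mult norm_power power_divide power_mult_distrib ac_simps flip: right_diff_distrib)
  have "tail_excess x = 0" using True by (simp add: tail_excess_def)
  then show ?thesis
    using 1 2 norm_triangle_ineq[of "rk.R3 x - (of_real a)\<^sup>2 * rk.q x ^ 3" "(of_real a)\<^sup>2 * rk.q x ^ 3 - (of_real a)\<^sup>2 * trace ^ 3"]
    by simp
next
  case False
  note ns = normsq_large[OF False]
  define S where "S = excess n x"
  have S: "S > real n" "tail_excess x = S\<^sup>2" using False ns by (simp_all add: tail_excess_def S_def)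
  have "cmod (rk.R3 x) \<le> 5 * a * (rk.normsq x)\<^sup>2 / (Im z)\<^sup>2" by (rule rk.R3_le1)
  also have "\<dots> \<le> 5 * a * (2 * S)\<^sup>2 / (Im z)\<^sup>2"
    using a_pos rk.normsq_nonneg ns unfolding S_def by (intro divide_right_mono mult_left_mono power_mono) auto
  finally have 1: "cmod (rk.R3 x) \<le> 20 * a / (Im z)\<^sup>2 * S\<^sup>2" by (simp add: power_mult_distrib)
  have "cmod ((of_real a)\<^sup>2 * trace ^ 3) \<le> a\<^sup>2 * (real n / Im z) ^ 3"
    unfolding norm_mult norm_power using trace_norm by (auto intro!: mult_mono power_mono)
  also have "\<dots> = a\<^sup>2 * real n / (Im z) ^ 3 * (real n)\<^sup>2"
    by (simp add: power_divide power2_eq_square power3_eq_cube)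
  also have "\<dots> \<le> a\<^sup>2 * real n / (Im z) ^ 3 * S\<^sup>2"
    using S Im_z by (intro mult_left_mono power_mono) auto
  finally have 2: "cmod ((of_real a)\<^sup>2 * trace ^ 3) \<le> a\<^sup>2 * real n / (Im z) ^ 3 * S\<^sup>2" .
  have 3: "0 \<le> 352 * a ^ 3 * (real n) ^ 4 / (Im z) ^ 4" "0 \<le> 12 * a\<^sup>2 * (real n)\<^sup>2 / (Im z)\<^sup>2 * cmod (rk.q x - trace)"
    using a_pos Im_z by auto
  show ?thesis
    using 1 2 3 norm_triangle_ineq4[of "rk.R3 x" "(of_real a)\<^sup>2 * trace ^ 3"] unfolding S(2) distrib_right by linarith
qed

definition R3_err where
  "R3_err = 352 * a ^ 3 * (real n) ^ 4 / (Im z) ^ 4 + 12 * a\<^sup>2 * (real n)\<^sup>2 / (Im z)\<^sup>2 * sqrt (v * real n / (Im z)\<^sup>2)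
      + (20 * a / (Im z)\<^sup>2 + a\<^sup>2 * real n / (Im z) ^ 3) * (real n * tail n)"

lemma R3_integral: "cmod ((\<integral>x. rk.R3 x \<partial>row_law n) - (of_real a)\<^sup>2 * trace ^ 3) \<le> R3_err"
proof -
  let ?c = "352 * a ^ 3 * (real n) ^ 4 / (Im z) ^ 4"
  let ?d = "12 * a\<^sup>2 * (real n)\<^sup>2 / (Im z)\<^sup>2"
  let ?e = "20 * a / (Im z)\<^sup>2 + a\<^sup>2 * real n / (Im z) ^ 3"
  have dI: "integrable (row_law n) (\<lambda>x. rk.q x - trace)" using q_moments(1) by simp
  have "(\<integral>x. rk.R3 x \<partial>row_law n) - (of_real a)\<^sup>2 * trace ^ 3 = (\<integral>x. rk.R3 x - (of_real a)\<^sup>2 * trace ^ 3 \<partial>row_law n)"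
    using R3_integrable by (simp add: R.prob_space)
  then have "cmod ((\<integral>x. rk.R3 x \<partial>row_law n) - (of_real a)\<^sup>2 * trace ^ 3)
      \<le> (\<integral>x. cmod (rk.R3 x - (of_real a)\<^sup>2 * trace ^ 3) \<partial>row_law n)"
    by (simp only: integral_norm_bound)
  also have "\<dots> \<le> (\<integral>x. ?c + ?d * cmod (rk.q x - trace) + ?e * tail_excess x \<partial>row_law n)"
    using R3_integrable dI tail_excess_integral(1) by (intro integral_mono R3_expansion) simp_all
  also have "\<dots> = ?c + ?d * (\<integral>x. cmod (rk.q x - trace) \<partial>row_law n) + ?e * (\<integral>x. tail_excess x \<partial>row_law n)"
    using dI tail_excess_integral(1) by (simp add: R.prob_space)
  also have "\<dots> \<le> ?c + ?d * sqrt (v * real n / (Im z)\<^sup>2) + ?e * (real n * tail n)"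
    unfolding tail_excess_integral(2)
    using a_pos Im_z by (intro add_mono mult_left_mono R.integral_abs_le_sqrt[OF dI q_moments(5,6)]) auto
  finally show ?thesis unfolding R3_err_def .
qed

text \<open>Quadratic form minus trace, both for the updated resolvent: the contribution of one row
  to the trace identity, up to the factor \<open>a\<close>.\<close>

definition D where "D x = rk.q x / (1 + of_real a * rk.q x) - (trace - rk.\<beta> x * rk.s x)"

text \<open>\<open>D\<close> equals \<open>q - a q^2 - Tr G + a s + R3 - R4\<close>. In the mean
  \<open>q\<close> cancels the trace, \<open>- a q^2\<close> produces \<open>trace_sq\<close> with
  coefficient \<open>- 2 a\<close>, and \<open>a s\<close> returns one \<open>a\<close> of
  it.\<close>

lemma D_mean:
  shows "integrable (row_law n) D"
    and "cmod ((\<integral>x. D x \<partial>row_law n) + of_real a * (trace\<^sup>2 + trace_sq + of_real \<kappa> * diag_sq) - (of_real a)\<^sup>2 * trace ^ 3)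
      \<le> R3_err + 6 * (1 + v) * a\<^sup>2 * (real n)\<^sup>2 / (Im z) ^ 3"
proof -
  have D: "D x = rk.R3 x + rk.q x - of_real a * (rk.q x)\<^sup>2 - trace + of_real a * rk.s x - rk.R4 x" for x
    by (simp add: D_def rk.R3_def rk.R4_def)
  show "integrable (row_law n) D"
    unfolding D[abs_def] using R3_integrable q_moments(1,3) s_moments(1) R4_integral(1) by simp
  have "(\<integral>x. D x \<partial>row_law n) = (\<integral>x. rk.R3 x \<partial>row_law n) + trace
      - of_real a * (trace\<^sup>2 + 2 * trace_sq + of_real \<kappa> * diag_sq) - trace + of_real a * trace_sq - (\<integral>x. rk.R4 x \<partial>row_law n)"
    unfolding D using R3_integrable q_moments(1,3) s_moments(1) R4_integral(1)
    by (simp add: R.prob_space q_moments(2,4) s_moments(2))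
  then have eq: "(\<integral>x. D x \<partial>row_law n) + of_real a * (trace\<^sup>2 + trace_sq + of_real \<kappa> * diag_sq) - (of_real a)\<^sup>2 * trace ^ 3
     = ((\<integral>x. rk.R3 x \<partial>row_law n) - (of_real a)\<^sup>2 * trace ^ 3) - (\<integral>x. rk.R4 x \<partial>row_law n)"
    by (simp add: algebra_simps)
  have "cmod (\<integral>x. rk.R4 x \<partial>row_law n) \<le> (\<integral>x. cmod (rk.R4 x) \<partial>row_law n)"
    by (rule integral_norm_bound)
  then show "cmod ((\<integral>x. D x \<partial>row_law n) + of_real a * (trace\<^sup>2 + trace_sq + of_real \<kappa> * diag_sq) - (of_real a)\<^sup>2 * trace ^ 3)
      \<le> R3_err + 6 * (1 + v) * a\<^sup>2 * (real n)\<^sup>2 / (Im z) ^ 3"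
    unfolding eq
    using R3_integral R4_integral(2) norm_triangle_ineq4[of "(\<integral>x. rk.R3 x \<partial>row_law n) - (of_real a)\<^sup>2 * trace ^ 3" "\<integral>x. rk.R4 x \<partial>row_law n"]
    by linarith
qed

text \<open>The mean is of order \<open>a n\<close>, smaller than the deterministic bound
  \<open>1 / Im z\<close> whenever \<open>a n\<close> is small. This gain is needed where the change
  is multiplied by a trace of order \<open>n\<close>.\<close>

lemma trace_change_mean:
  shows "integrable (row_law n) (\<lambda>x. rk.\<beta> x * rk.s x)"
    and "(\<integral>x. cmod (rk.\<beta> x * rk.s x) \<partial>row_law n)
      \<le> a * real n / (Im z)\<^sup>2 + 6 * (1 + v) * a\<^sup>2 * (real n)\<^sup>2 / (Im z) ^ 3"
proof -
  have eq: "rk.\<beta> x * rk.s x = of_real a * rk.s x - rk.R4 x" for x by (simp add: rk.R4_def)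
  show I: "integrable (row_law n) (\<lambda>x. rk.\<beta> x * rk.s x)"
    unfolding eq using s_moments(1) R4_integral(1) by simp
  have "(\<integral>x. cmod (rk.\<beta> x * rk.s x) \<partial>row_law n) \<le> (\<integral>x. a / (Im z)\<^sup>2 * rk.normsq x + cmod (rk.R4 x) \<partial>row_law n)"
  proof (rule integral_mono)
    show "integrable (row_law n) (\<lambda>x. a / (Im z)\<^sup>2 * rk.normsq x + cmod (rk.R4 x))"
      using normsq_integrals(1) R4_integral(1) by simp
    fix x
    have "a * cmod (rk.s x) \<le> a * (rk.normsq x / (Im z)\<^sup>2)" using a_pos by (intro mult_left_mono rk.s_le) auto
    then show "cmod (rk.\<beta> x * rk.s x) \<le> a / (Im z)\<^sup>2 * rk.normsq x + cmod (rk.R4 x)"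
      unfolding eq using norm_triangle_ineq4[of "of_real a * rk.s x" "rk.R4 x"] a_pos by (simp add: norm_mult)
  qed (use I in simp)
  also have "\<dots> = a / (Im z)\<^sup>2 * real n + (\<integral>x. cmod (rk.R4 x) \<partial>row_law n)"
    using normsq_integrals(1,2) R4_integral(1) by simp
  also have "\<dots> \<le> a / (Im z)\<^sup>2 * real n + 6 * (1 + v) * a\<^sup>2 * (real n)\<^sup>2 / (Im z) ^ 3"
    by (intro add_left_mono R4_integral(2))
  finally show "(\<integral>x. cmod (rk.\<beta> x * rk.s x) \<partial>row_law n)
      \<le> a * real n / (Im z)\<^sup>2 + 6 * (1 + v) * a\<^sup>2 * (real n)\<^sup>2 / (Im z) ^ 3" by simp
qed

text \<open>\<open>a trace_sq\<close> is the mean of \<open>a s\<close>, the leading part of the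
  trace change. Centering there leaves the variance of \<open>s\<close>, of order \<open>n\<close>,
  in place of its second moment, which may be of order \<open>n^2\<close>.\<close>

lemma trace_fluctuation:
  "(\<integral>x. (cmod (of_real a * trace_sq - rk.\<beta> x * rk.s x))\<^sup>2 \<partial>row_law n)
    \<le> 146 * v * a\<^sup>2 * real n / (Im z) ^ 4 + 2304 * a ^ 4 * (real n) ^ 4 / (Im z) ^ 6"
proof -
  \<comment> \<open>On the tail event \<open>R4\<close> is bounded linearly in
    \<open>\<bar>excess\<bar>\<close>, so that its square remains integrable under four
    moments.\<close>
  have R4: "cmod (rk.R4 x) \<le> 24 * a\<^sup>2 * (real n)\<^sup>2 / (Im z) ^ 3 + 6 * a * \<bar>excess n x\<bar> / (Im z)\<^sup>2" for x
  proof (cases "\<bar>excess n x\<bar> \<le> real n")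
    case True
    have "cmod (rk.R4 x) \<le> 6 * a\<^sup>2 * (rk.normsq x)\<^sup>2 / (Im z) ^ 3" by (rule rk.R4_le2)
    also have "\<dots> \<le> 6 * a\<^sup>2 * (2 * real n)\<^sup>2 / (Im z) ^ 3"
      using rk.normsq_nonneg normsq_small[OF True] Im_z by (intro divide_right_mono mult_left_mono power_mono) auto
    also have "\<dots> = 24 * a\<^sup>2 * (real n)\<^sup>2 / (Im z) ^ 3" by simp
    also have "\<dots> \<le> 24 * a\<^sup>2 * (real n)\<^sup>2 / (Im z) ^ 3 + 6 * a * \<bar>excess n x\<bar> / (Im z)\<^sup>2"
      using a_pos by simp
    finally show ?thesis .
  next
    case False
    have "cmod (rk.R4 x) \<le> 3 * a * rk.normsq x / (Im z)\<^sup>2" by (rule rk.R4_le1)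
    also have "\<dots> \<le> 3 * a * (2 * \<bar>excess n x\<bar>) / (Im z)\<^sup>2"
      using normsq_large[OF False] a_pos by (intro divide_right_mono mult_left_mono) auto
    also have "\<dots> = 6 * a * \<bar>excess n x\<bar> / (Im z)\<^sup>2" by simp
    finally have "cmod (rk.R4 x) \<le> 6 * a * \<bar>excess n x\<bar> / (Im z)\<^sup>2" .
    moreover have "0 \<le> 24 * a\<^sup>2 * (real n)\<^sup>2 / (Im z) ^ 3" using Im_z by simp
    ultimately show ?thesis by linarith
  qed
  have ptw: "(cmod (of_real a * trace_sq - rk.\<beta> x * rk.s x))\<^sup>2
     \<le> 2 * a\<^sup>2 * (cmod (rk.s x - trace_sq))\<^sup>2 + (2304 * a ^ 4 * (real n) ^ 4 / (Im z) ^ 6 + 144 * a\<^sup>2 / (Im z) ^ 4 * (excess n x)\<^sup>2)" for x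
  proof -
    have sq: "(p + q)\<^sup>2 \<le> 2 * p\<^sup>2 + 2 * q\<^sup>2" for p q :: real
      using diff_power2_le[of p "- q"] by simp
    have "of_real a * trace_sq - rk.\<beta> x * rk.s x = rk.R4 x - of_real a * (rk.s x - trace_sq)"
      by (simp add: rk.R4_def algebra_simps)
    then have "cmod (of_real a * trace_sq - rk.\<beta> x * rk.s x) \<le> a * cmod (rk.s x - trace_sq) + cmod (rk.R4 x)"
      using norm_triangle_ineq4[of "rk.R4 x" "of_real a * (rk.s x - trace_sq)"] a_pos by (simp add: norm_mult)
    then have "(cmod (of_real a * trace_sq - rk.\<beta> x * rk.s x))\<^sup>2 \<le> (a * cmod (rk.s x - trace_sq) + cmod (rk.R4 x))\<^sup>2"
      by (intro power_mono) auto
    also have "\<dots> \<le> 2 * (a * cmod (rk.s x - trace_sq))\<^sup>2 + 2 * (cmod (rk.R4 x))\<^sup>2" by (rule sq)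
    also have "(cmod (rk.R4 x))\<^sup>2 \<le> (24 * a\<^sup>2 * (real n)\<^sup>2 / (Im z) ^ 3 + 6 * a * \<bar>excess n x\<bar> / (Im z)\<^sup>2)\<^sup>2"
      by (intro power_mono R4) auto
    also have "\<dots> \<le> 2 * (24 * a\<^sup>2 * (real n)\<^sup>2 / (Im z) ^ 3)\<^sup>2 + 2 * (6 * a * \<bar>excess n x\<bar> / (Im z)\<^sup>2)\<^sup>2" by (rule sq)
    also have "\<dots> = 1152 * a ^ 4 * (real n) ^ 4 / (Im z) ^ 6 + 72 * a\<^sup>2 / (Im z) ^ 4 * (excess n x)\<^sup>2"
      by (simp add: power_divide power_mult_distrib flip: power_mult)
    finally show ?thesis by (simp add: power_mult_distrib)
  qed
  have "(\<integral>x. (cmod (of_real a * trace_sq - rk.\<beta> x * rk.s x))\<^sup>2 \<partial>row_law n)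
    \<le> (\<integral>x. 2 * a\<^sup>2 * (cmod (rk.s x - trace_sq))\<^sup>2 + (2304 * a ^ 4 * (real n) ^ 4 / (Im z) ^ 6 + 144 * a\<^sup>2 / (Im z) ^ 4 * (excess n x)\<^sup>2) \<partial>row_law n)"
  proof (rule integral_mono[OF _ _ ptw])
    show I: "integrable (row_law n) (\<lambda>x. 2 * a\<^sup>2 * (cmod (rk.s x - trace_sq))\<^sup>2 + (2304 * a ^ 4 * (real n) ^ 4 / (Im z) ^ 6 + 144 * a\<^sup>2 / (Im z) ^ 4 * (excess n x)\<^sup>2))"
      using s_moments(3) excess_variance(1)[of n] by simp
    show "integrable (row_law n) (\<lambda>x. (cmod (of_real a * trace_sq - rk.\<beta> x * rk.s x))\<^sup>2)"
      by (rule Bochner_Integration.integrable_bound[OF I])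
         (use ptw in \<open>auto intro!: AE_I2 intro: order_trans[OF _ abs_ge_self]\<close>)
  qed
  also have "\<dots> = 2 * a\<^sup>2 * (\<integral>x. (cmod (rk.s x - trace_sq))\<^sup>2 \<partial>row_law n)
      + (2304 * a ^ 4 * (real n) ^ 4 / (Im z) ^ 6 + 144 * a\<^sup>2 / (Im z) ^ 4 * (\<integral>x. (excess n x)\<^sup>2 \<partial>row_law n))"
    using s_moments(3) excess_variance(1)[of n] by (simp add: R.prob_space)
  also have "\<dots> \<le> 2 * a\<^sup>2 * (v * real n / (Im z) ^ 4)
      + (2304 * a ^ 4 * (real n) ^ 4 / (Im z) ^ 6 + 144 * a\<^sup>2 / (Im z) ^ 4 * (v * real n))"
    by (intro add_mono mult_left_mono order_refl s_moments(4) excess_variance(2)) auto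
  also have "\<dots> = 146 * v * a\<^sup>2 * real n / (Im z) ^ 4 + 2304 * a ^ 4 * (real n) ^ 4 / (Im z) ^ 6"
    by (simp add: add_divide_distrib[symmetric])
  finally show ?thesis .
qed

text \<open>Off the tail event the update is at most \<open>2 a |u_k|^2\<close>, and
  \<open>u_k^2\<close> is a quadratic form of rank one whose Frobenius norm is the squared norm of a
  row of \<open>G\<close>. This avoids any factor \<open>n\<close> in the main term.\<close>

lemma entry_fluctuation:
  assumes k: "k < n" and small: "4 * a * real n \<le> Im z"
  shows "(\<integral>x. (cmod (rk.\<beta> x * (rk.u x k)\<^sup>2))\<^sup>2 \<partial>row_law n)
    \<le> 4 * (1 + v) * a\<^sup>2 / (Im z) ^ 4 + 16 * a\<^sup>2 * real n * tail n / (Im z) ^ 4"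
proof -
  define B where "B i j = G k i * G k j" for i j
  have usq: "(rk.u x k)\<^sup>2 = qf n B x" for x
  proof -
    have "(rk.u x k)\<^sup>2 = (\<Sum>i<n. G k i * of_real (x i)) * (\<Sum>j<n. G k j * of_real (x j))"
      by (simp add: rk.u_def app_def power2_eq_square)
    then show ?thesis unfolding sum_product qf_def B_def by (simp add: mult_ac)
  qed
  have u4: "cmod (rk.u x k) ^ 4 = (cmod (qf n B x))\<^sup>2" for x
    by (simp add: usq[symmetric] norm_power flip: power_mult)
  have rn: "(\<Sum>i<n. (cmod (G k i))\<^sup>2) \<le> 1 / (Im z)\<^sup>2" by (rule row_norm[OF k])
  have rn2: "(\<Sum>i<n. (cmod (G k i))\<^sup>2)\<^sup>2 \<le> 1 / (Im z) ^ 4"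
  proof -
    have "(\<Sum>i<n. (cmod (G k i))\<^sup>2)\<^sup>2 \<le> (1 / (Im z)\<^sup>2)\<^sup>2" by (intro power_mono rn sum_nonneg) auto
    then show ?thesis by (simp add: power_divide flip: power_mult)
  qed
  have "cmod (\<Sum>i<n. B i i) \<le> (\<Sum>i<n. (cmod (G k i))\<^sup>2)"
    unfolding B_def by (rule order_trans[OF norm_sum]) (simp add: norm_mult power2_eq_square)
  then have "(cmod (\<Sum>i<n. B i i))\<^sup>2 \<le> (\<Sum>i<n. (cmod (G k i))\<^sup>2)\<^sup>2" by (intro power_mono) auto
  moreover have "(\<Sum>i<n. \<Sum>j<n. (cmod (B i j))\<^sup>2) = (\<Sum>i<n. (cmod (G k i))\<^sup>2)\<^sup>2"
    by (simp add: B_def norm_mult power_mult_distrib sum_product power2_eq_square[of "\<Sum>i<n. (cmod (G k i))\<^sup>2"])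
  ultimately have "(\<integral>x. (cmod (qf n B x))\<^sup>2 \<partial>row_law n) \<le> (\<Sum>i<n. (cmod (G k i))\<^sup>2)\<^sup>2 + v * (\<Sum>i<n. (cmod (G k i))\<^sup>2)\<^sup>2"
    using qf_cmod_power2[of n B] by (simp add: v_def)
  also have "\<dots> \<le> 1 / (Im z) ^ 4 + v * (1 / (Im z) ^ 4)"
    using v_ge by (intro add_mono mult_left_mono rn2) auto
  finally have qB: "(\<integral>x. (cmod (qf n B x))\<^sup>2 \<partial>row_law n) \<le> (1 + v) / (Im z) ^ 4" by (simp add: add_divide_distrib)
  have ptw: "(cmod (rk.\<beta> x * (rk.u x k)\<^sup>2))\<^sup>2 \<le> 4 * a\<^sup>2 * (cmod (qf n B x))\<^sup>2 + 16 * a\<^sup>2 / (Im z) ^ 4 * tail_excess x" for x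
    using rk.entry_update_sq_le[OF k small, of x]
    unfolding tail_excess_def u4 normsq_eq by (auto split: if_splits)
  have I: "integrable (row_law n) (\<lambda>x. 4 * a\<^sup>2 * (cmod (qf n B x))\<^sup>2 + 16 * a\<^sup>2 / (Im z) ^ 4 * tail_excess x)"
    using qf_integrable_cmod_power2[of n B] tail_excess_integral(1) by simp
  have qBm: "qf n B \<in> borel_measurable (row_law n)" by (rule borel_measurable_integrable[OF qf_mean(1)])
  have "(\<integral>x. (cmod (rk.\<beta> x * (rk.u x k)\<^sup>2))\<^sup>2 \<partial>row_law n)
      \<le> (\<integral>x. 4 * a\<^sup>2 * (cmod (qf n B x))\<^sup>2 + 16 * a\<^sup>2 / (Im z) ^ 4 * tail_excess x \<partial>row_law n)"
  proof (rule integral_mono[OF _ I ptw])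
    show "integrable (row_law n) (\<lambda>x. (cmod (rk.\<beta> x * (rk.u x k)\<^sup>2))\<^sup>2)"
      by (rule Bochner_Integration.integrable_bound[OF I])
         (use ptw qBm in \<open>auto simp: usq intro!: AE_I2 intro: order_trans[OF _ abs_ge_self]\<close>)
  qed
  also have "\<dots> = 4 * a\<^sup>2 * (\<integral>x. (cmod (qf n B x))\<^sup>2 \<partial>row_law n) + 16 * a\<^sup>2 / (Im z) ^ 4 * (real n * tail n)"
    using qf_integrable_cmod_power2[of n B] tail_excess_integral by simp
  also have "\<dots> \<le> 4 * a\<^sup>2 * ((1 + v) / (Im z) ^ 4) + 16 * a\<^sup>2 / (Im z) ^ 4 * (real n * tail n)"
    by (intro add_right_mono mult_left_mono qB) auto
  finally show ?thesis by (simp add: algebra_simps)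
qed

end

section \<open>The renormalized sample covariance matrix\<close>

lemma resolvent_fun_permute:
  assumes "resolvent_fun n A z G" and \<tau>: "bij_betw \<tau> {..<n} {..<n}"
  shows "resolvent_fun n (\<lambda>k l. A (\<tau> k) (\<tau> l)) z (\<lambda>k l. G (\<tau> k) (\<tau> l))"
proof (rule resolvent_fun.intro)
  interpret resolvent_fun n A z G by fact
  have r: "\<tau> k < n" if "k < n" for k using bij_betwE[OF \<tau>] that by auto
  show "A (\<tau> k) (\<tau> l) = A (\<tau> l) (\<tau> k)" if "k < n" "l < n" for k l using sym r that by simp
  show "Im z > 0" by (rule Im_z)
  fix k l assume kl: "k < n" "l < n"
  have "(\<Sum>i<n. of_real (A (\<tau> k) (\<tau> i)) * G (\<tau> i) (\<tau> l)) = (\<Sum>i<n. of_real (A (\<tau> k) i) * G i (\<tau> l))"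
    by (rule sum.reindex_bij_betw[OF \<tau>])
  moreover have "\<tau> k = \<tau> l \<longleftrightarrow> k = l"
    using bij_betw_imp_inj_on[OF \<tau>] kl by (auto simp: inj_on_def)
  ultimately show "(\<Sum>i<n. of_real (A (\<tau> k) (\<tau> i)) * G (\<tau> i) (\<tau> l)) - z * G (\<tau> k) (\<tau> l) = (if k = l then 1 else 0)"
    using inv[OF r r, OF kl] by simp
qed

lemma resolvent_fun_traces_unique:
  assumes "resolvent_fun n A z G" "resolvent_fun n A z G'"
  shows "resolvent_fun.trace n G = resolvent_fun.trace n G'"
    "resolvent_fun.trace_sq n G = resolvent_fun.trace_sq n G'"
    "resolvent_fun.diag_sq n G = resolvent_fun.diag_sq n G'"
  using resolvent_fun_unique[OF assms]
  by (simp_all add: resolvent_fun.trace_def[OF assms(1)] resolvent_fun.trace_def[OF assms(2)]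
      resolvent_fun.trace_sq_def[OF assms(1)] resolvent_fun.trace_sq_def[OF assms(2)]
      resolvent_fun.diag_sq_def[OF assms(1)] resolvent_fun.diag_sq_def[OF assms(2)])

locale sample_cov = standardized_law \<mu> for \<mu> +
  fixes n m :: nat
  assumes n_pos: "n > 0" and m_pos: "m > 0"
begin

definition a :: real where "a = 1 / sqrt (real m * real n)"

lemma a_pos: "a > 0" using n_pos m_pos by (simp add: a_def)

text \<open>The shift \<open>m\<close> is kept for every \<open>J\<close>, instead of the number of
  rows in \<open>J\<close>, so that adding a row is exactly a rank-one update.\<close>

definition gram :: "nat set \<Rightarrow> (nat \<Rightarrow> nat \<Rightarrow> real) \<Rightarrow> nat \<Rightarrow> nat \<Rightarrow> real" where
  "gram J x k l = a * ((\<Sum>j\<in>J. x j k * x j l) - (if k = l then real m else 0))"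

definition Gr :: "complex \<Rightarrow> nat set \<Rightarrow> (nat \<Rightarrow> nat \<Rightarrow> real) \<Rightarrow> nat \<Rightarrow> nat \<Rightarrow> complex" where
  "Gr z J x = resolvent_entry n (gram J x) z"

lemma gram_sym: "gram J x k l = gram J x l k"
  by (simp add: gram_def mult.commute)

lemma gram_insert: "finite J \<Longrightarrow> j \<notin> J \<Longrightarrow> gram (insert j J) x k l = gram J x k l + a * x j k * x j l"
  by (simp add: gram_def algebra_simps)

lemma gram_upd: "j \<notin> J \<Longrightarrow> gram J (x(j := y)) = gram J x"
  unfolding gram_def by (intro ext arg_cong2[where f="(*)"] arg_cong2[where f="(-)"] sum.cong refl) auto

text \<open>This is how independence from the removed row is used: the reduced resolvent does not
  read row \<open>j\<close>, so it is constant while that row is integrated.\<close>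

lemma Gr_upd: assumes "j \<notin> J" shows "Gr z J (x(j := y)) = Gr z J x"
  unfolding Gr_def gram_upd[OF assms] ..

lemma resolvent_fun_Gr: "Im z > 0 \<Longrightarrow> resolvent_fun n (gram J x) z (Gr z J x)"
  unfolding Gr_def by (rule resolvent_fun_resolvent_entry[OF gram_sym])

lemma cavity_Gr: "Im z > 0 \<Longrightarrow> cavity \<mu> n (gram J x) z (Gr z J x) a"
  by (intro cavity.intro cavity_axioms.intro resolvent_fun_Gr a_pos n_pos standardized_law_axioms)

text \<open>A product of row laws rather than of entry laws, since conditioning and Efron-Stein
  treat one whole row as a coordinate.\<close>

definition joint_law :: "(nat \<Rightarrow> nat \<Rightarrow> real) measure" where
  "joint_law = Pi\<^sub>M {..<m} (\<lambda>_. row_law n)"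

sublocale Q: prob_space joint_law
  unfolding joint_law_def by (intro prob_space_PiM prob_space_row_law)

lemma joint_component_measurable:
  assumes "j \<in> J" "k < n" shows "(\<lambda>x. x j k) \<in> borel_measurable (Pi\<^sub>M J (\<lambda>_. row_law n))"
  using measurable_comp[OF measurable_component_singleton[OF assms(1), of "\<lambda>_. row_law n"] row_component[OF assms(2)]]
  unfolding comp_def .

lemma Gr_measurable:
  assumes "J \<subseteq> {..<m}" "Im z > 0" "k < n" "l < n"
  shows "(\<lambda>x. Gr z J x k l) \<in> borel_measurable joint_law"
  unfolding Gr_def
proof (rule borel_measurable_resolvent_entry[OF gram_sym assms(2) _ assms(3,4)])
  fix k l assume kl: "k < n" "l < n"
  have "(\<lambda>x. x j k * x j l) \<in> borel_measurable joint_law" if "j \<in> J" for j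
    using that assms(1) kl joint_component_measurable[of j "{..<m}"] unfolding joint_law_def by auto
  then have "(\<lambda>x. \<Sum>j\<in>J. x j k * x j l) \<in> borel_measurable joint_law"
    by (rule borel_measurable_sum)
  then show "(\<lambda>x. gram J x k l) \<in> borel_measurable joint_law" unfolding gram_def by measurable
qed

abbreviation tr where "tr \<equiv> resolvent_fun.trace n"
abbreviation tr_sq where "tr_sq \<equiv> resolvent_fun.trace_sq n"
abbreviation dg_sq where "dg_sq \<equiv> resolvent_fun.diag_sq n"

lemma traces_measurable:
  assumes J: "J \<subseteq> {..<m}" and z: "Im z > 0"
  shows "(\<lambda>x. tr (Gr z J x)) \<in> borel_measurable joint_law"
    "(\<lambda>x. tr_sq (Gr z J x)) \<in> borel_measurable joint_law"
    "(\<lambda>x. dg_sq (Gr z J x)) \<in> borel_measurable joint_law"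
  unfolding resolvent_fun.trace_def[OF resolvent_fun_Gr[OF z]]
    resolvent_fun.trace_sq_def[OF resolvent_fun_Gr[OF z]] resolvent_fun.diag_sq_def[OF resolvent_fun_Gr[OF z]]
  by (intro borel_measurable_sum borel_measurable_power Gr_measurable[OF J z]; simp)+

lemma traces_bounded:
  assumes z: "Im z > 0"
  shows "cmod (tr (Gr z J x)) \<le> real n / Im z" "cmod (tr_sq (Gr z J x)) \<le> real n / (Im z)\<^sup>2"
    "cmod (dg_sq (Gr z J x)) \<le> real n / (Im z)\<^sup>2"
proof -
  interpret resolvent_fun n "gram J x" z "Gr z J x" by (rule resolvent_fun_Gr[OF z])
  show "cmod (tr (Gr z J x)) \<le> real n / Im z" "cmod (tr_sq (Gr z J x)) \<le> real n / (Im z)\<^sup>2"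
    "cmod (dg_sq (Gr z J x)) \<le> real n / (Im z)\<^sup>2"
    by (rule trace_norm trace_sq_norm diag_sq_norm)+
qed

lemma traces_integrable:
  assumes J: "J \<subseteq> {..<m}" and z: "Im z > 0"
  shows "integrable joint_law (\<lambda>x. tr (Gr z J x) ^ e)"
    "integrable joint_law (\<lambda>x. tr_sq (Gr z J x))"
    "integrable joint_law (\<lambda>x. dg_sq (Gr z J x))"
proof -
  show "integrable joint_law (\<lambda>x. tr (Gr z J x) ^ e)"
    using traces_measurable(1)[OF J z] traces_bounded(1)[OF z]
    by (intro Q.integrable_bounded_complex(1)[where B="(real n / Im z) ^ e"]) (auto simp: norm_power intro!: power_mono)
  show "integrable joint_law (\<lambda>x. tr_sq (Gr z J x))"
    by (rule Q.integrable_bounded_complex(1)[OF traces_measurable(2)[OF J z] traces_bounded(2)[OF z]])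
  show "integrable joint_law (\<lambda>x. dg_sq (Gr z J x))"
    by (rule Q.integrable_bounded_complex(1)[OF traces_measurable(3)[OF J z] traces_bounded(3)[OF z]])
qed

text \<open>Fubini with row \<open>j\<close> innermost: a bound for the conditional expectation,
  uniform in the other rows, passes to the expectation.\<close>

lemma joint_integral_bound:
  fixes h :: "(nat \<Rightarrow> nat \<Rightarrow> real) \<Rightarrow> 'b::{banach, second_countable_topology}"
  assumes j: "j < m" and h: "integrable joint_law h"
    and le: "\<And>x. norm (\<integral>y. h (x(j := y)) \<partial>row_law n) \<le> C"
  shows "norm (\<integral>x. h x \<partial>joint_law) \<le> C"
proof -
  interpret P: product_sigma_finite "\<lambda>_::nat. row_law n"
    by (rule product_sigma_finite.intro) (rule prob_space_imp_sigma_finite[OF prob_space_row_law])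
  have ins: "insert j ({..<m} - {j}) = {..<m}" using j by auto
  let ?P = "Pi\<^sub>M ({..<m} - {j}) (\<lambda>_. row_law n)"
  interpret PJ: prob_space ?P by (intro prob_space_PiM prob_space_row_law)
  have "integrable (Pi\<^sub>M (insert j ({..<m} - {j})) (\<lambda>_. row_law n)) h"
    using h unfolding ins joint_law_def .
  from P.product_integral_insert[OF _ _ this]
  have "(\<integral>x. h x \<partial>joint_law) = (\<integral>x. (\<integral>y. h (x(j := y)) \<partial>row_law n) \<partial>?P)"
    unfolding ins joint_law_def by simp
  then have "norm (\<integral>x. h x \<partial>joint_law) \<le> (\<integral>x. norm (\<integral>y. h (x(j := y)) \<partial>row_law n) \<partial>?P)"
    by (simp only: integral_norm_bound)
  also have "\<dots> \<le> C"
  proof (cases "integrable ?P (\<lambda>x. norm (\<integral>y. h (x(j := y)) \<partial>row_law n))")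
    case True
    have "(\<integral>x. norm (\<integral>y. h (x(j := y)) \<partial>row_law n) \<partial>?P) \<le> (\<integral>x. C \<partial>?P)"
      using True by (intro integral_mono le) auto
    then show ?thesis by (simp add: PJ.prob_space)
  next
    \<comment> \<open>Without integrability the integral has the default value 0, which is below
      \<open>C\<close> because any instance of the hypothesis shows \<open>C\<close>
      nonnegative.\<close>
    case False
    have "0 \<le> C" using le[of undefined] norm_ge_zero order_trans by blast
    then show ?thesis using not_integrable_integral_eq[OF False] by simp
  qed
  finally show ?thesis .
qed

lemma row_integrable_joint:
  fixes f :: "(nat \<Rightarrow> real) \<Rightarrow> real"
  assumes j: "j < m" and f: "integrable (row_law n) f"
  shows "integrable joint_law (\<lambda>x. f (x j))"
proof -
  have d: "distr joint_law (row_law n) (\<lambda>x. x j) = row_law n"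
    unfolding joint_law_def using j by (intro distr_PiM_component prob_space_row_law) auto
  have "(\<lambda>x. x j) \<in> measurable joint_law (row_law n)"
    unfolding joint_law_def using j by (intro measurable_component_singleton) auto
  from integrable_distr[OF this, of f] show ?thesis using f unfolding d by simp
qed

definition rest :: "nat \<Rightarrow> nat set" where "rest j = {..<m} - {j}"

lemma rest_subset: "rest j \<subseteq> {..<m}" and rest_notin: "j \<notin> rest j"
  by (auto simp: rest_def)

text \<open>The quadratic form bracketed as \<open>y^T (G y)\<close>, matching the shape in which
  the rank-one update computes it.\<close>

definition qd :: "(nat \<Rightarrow> nat \<Rightarrow> complex) \<Rightarrow> (nat \<Rightarrow> real) \<Rightarrow> complex" where
  "qd G y = (\<Sum>k<n. of_real (y k) * (\<Sum>l<n. G k l * of_real (y l)))"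

text \<open>With the new row inserted at \<open>j\<close>, the full Gram matrix is the reduced one
  plus \<open>a y y^T\<close>; uniqueness of resolvents then transfers every rank-one formula to
  \<open>Gr\<close>.\<close>

lemma row_update:
  assumes z: "Im z > 0" and j: "j < m"
  defines "G0 x \<equiv> Gr z (rest j) x"
  defines "G1 x y \<equiv> Gr z {..<m} (x(j := y))"
  shows "k < n \<Longrightarrow> l < n \<Longrightarrow> G1 x y k l = G0 x k l
      - rank_one_update.\<beta> n (G0 x) a y * rank_one_update.u n (G0 x) y k * rank_one_update.u n (G0 x) y l"
    and "tr (G1 x y) = tr (G0 x) - rank_one_update.\<beta> n (G0 x) a y * rank_one_update.s n (G0 x) y"
    and "cmod (tr_sq (G1 x y) - tr_sq (G0 x)) \<le> 3 / (Im z)\<^sup>2"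
    and "cmod (dg_sq (G1 x y) - dg_sq (G0 x)) \<le> 2 / (Im z)\<^sup>2"
    and "cmod (tr (G1 x y) - tr (G0 x)) \<le> 1 / Im z"
    and "qd (G1 x y) y = rank_one_update.q n (G0 x) y / (1 + of_real a * rank_one_update.q n (G0 x) y)"
proof -
  interpret C: cavity \<mu> n "gram (rest j) x" z "G0 x" a
    unfolding G0_def by (rule cavity_Gr[OF z])
  have ins: "insert j (rest j) = {..<m}" using j by (auto simp: rest_def)
  have gram: "gram {..<m} (x(j := y)) k l = gram (rest j) x k l + a * y k * y l" for k l
    using gram_insert[of "rest j" j "x(j := y)" k l] unfolding ins gram_upd[OF rest_notin]
    by (simp add: rest_def)
  have res: "resolvent_fun n (\<lambda>k l. gram (rest j) x k l + a * y k * y l) z (G1 x y)"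
    unfolding G1_def by (rule resolvent_fun_cong[OF resolvent_fun_Gr[OF z] gram refl])
  have eq: "G1 x y k l = C.rk.G' y k l" if "k < n" "l < n" for k l
    by (rule resolvent_fun_unique[OF res C.rk.update that])
  show "G1 x y k l = G0 x k l - C.rk.\<beta> y * C.rk.u y k * C.rk.u y l" if "k < n" "l < n"
    using eq[OF that] by (simp add: C.rk.G'_def)
  note T = resolvent_fun_traces_unique[OF res C.rk.update]
  show tr: "tr (G1 x y) = tr (G0 x) - C.rk.\<beta> y * C.rk.s y" unfolding T by (rule C.rk.trace_update)
  show "cmod (tr_sq (G1 x y) - tr_sq (G0 x)) \<le> 3 / (Im z)\<^sup>2" unfolding T by (rule C.rk.trace_sq_update)
  show "cmod (dg_sq (G1 x y) - dg_sq (G0 x)) \<le> 2 / (Im z)\<^sup>2" unfolding T by (rule C.rk.diag_sq_update)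
  show "cmod (tr (G1 x y) - tr (G0 x)) \<le> 1 / Im z" unfolding tr using C.rk.beta_s_le[of y] by simp
  have "qd (G1 x y) y = (\<Sum>k<n. of_real (y k) * C.rk.upd.app y (\<lambda>k. of_real (y k)) k)"
    unfolding qd_def C.rk.upd.app_def by (intro sum.cong refl arg_cong2[where f="(*)"]) (simp add: eq)
  then show "qd (G1 x y) y = C.rk.q y / (1 + of_real a * C.rk.q y)"
    by (simp only: C.rk.quadratic_update)
qed

section \<open>Variances of the trace and of the diagonal entries\<close>

definition mean_tr where "mean_tr z = (\<integral>x. tr (Gr z {..<m} x) \<partial>joint_law)"

text \<open>Efron-Stein over rows, with each of its \<open>m\<close> terms bounded conditionally on
  the other rows.\<close>

lemma joint_variance_le:
  fixes F :: "(nat \<Rightarrow> nat \<Rightarrow> real) \<Rightarrow> complex" and g :: "nat \<Rightarrow> (nat \<Rightarrow> nat \<Rightarrow> real) \<Rightarrow> complex"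
  assumes Fm: "F \<in> borel_measurable joint_law" and gm: "\<And>j. g j \<in> borel_measurable joint_law"
    and Fb: "\<And>x. cmod (F x) \<le> B" and gb: "\<And>j x. cmod (g j x) \<le> B"
    and const: "\<And>j x y. g j (x(j := y)) = g j x"
    and le: "\<And>j x. j < m \<Longrightarrow> (\<integral>y. (cmod (F (x(j := y)) - g j x))\<^sup>2 \<partial>row_law n) \<le> C"
  shows "(\<integral>x. (cmod (F x - (\<integral>x. F x \<partial>joint_law)))\<^sup>2 \<partial>joint_law) \<le> real m * C"
proof -
  have "(\<integral>x. (cmod (F x))\<^sup>2 \<partial>joint_law) - (cmod (\<integral>x. F x \<partial>joint_law))\<^sup>2 \<le> (\<Sum>j<m. \<integral>x. (cmod (F x - g j x))\<^sup>2 \<partial>joint_law)"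
    unfolding joint_law_def
  proof (rule efron_stein)
    show "F \<in> borel_measurable (Pi\<^sub>M {..<m} (\<lambda>_. row_law n))" using Fm unfolding joint_law_def .
    show "g j \<in> borel_measurable (Pi\<^sub>M {..<m} (\<lambda>_. row_law n))" for j using gm unfolding joint_law_def .
    show "g j (x(j := y)) = g j (x(j := y'))" for j x y y' unfolding const ..
  qed (use Fb gb prob_space_row_law in auto)
  also have "\<dots> \<le> (\<Sum>j<m. C)"
  proof (rule sum_mono)
    fix j assume "j \<in> {..<m}"
    then have j: "j < m" by simp
    have "norm (\<integral>x. (cmod (F x - g j x))\<^sup>2 \<partial>joint_law) \<le> C"
    proof (rule joint_integral_bound[OF j])
      show "integrable joint_law (\<lambda>x. (cmod (F x - g j x))\<^sup>2)"
      proof (rule Q.integrable_bounded_complex(2)[where B="2 * B"])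
        show "(\<lambda>x. F x - g j x) \<in> borel_measurable joint_law" using Fm gm by simp
        show "cmod (F x - g j x) \<le> 2 * B" for x
          using Fb[of x] gb[of j x] norm_triangle_ineq4[of "F x" "g j x"] by simp
      qed
      fix x
      have "0 \<le> (\<integral>y. (cmod (F (x(j := y)) - g j x))\<^sup>2 \<partial>row_law n)"
        by (intro integral_nonneg_AE) auto
      then show "norm (\<integral>y. (cmod (F (x(j := y)) - g j (x(j := y))))\<^sup>2 \<partial>row_law n) \<le> C"
        unfolding const real_norm_def using le[OF j, of x] by linarith
    qed
    then show "(\<integral>x. (cmod (F x - g j x))\<^sup>2 \<partial>joint_law) \<le> C" by simp
  qed
  finally have "(\<integral>x. (cmod (F x))\<^sup>2 \<partial>joint_law) - (cmod (\<integral>x. F x \<partial>joint_law))\<^sup>2 \<le> real m * C" by simp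
  then show ?thesis
    using Q.integral_cmod_diff_power2[OF Q.integrable_bounded_complex[OF Fm Fb], of "\<integral>x. F x \<partial>joint_law"] by simp
qed

text \<open>Row \<open>j\<close> is compared with the reduced trace minus \<open>a\<close> times the
  reduced \<open>trace_sq\<close>, the first-order prediction of the full trace. After division by
  \<open>n^2\<close> the bound has size \<open>1/n^2 + 1/m\<close>.\<close>

lemma variance_trace:
  assumes z: "Im z > 0"
  shows "(\<integral>x. (cmod (tr (Gr z {..<m} x) - mean_tr z))\<^sup>2 \<partial>joint_law)
    \<le> real m * (146 * v * a\<^sup>2 * real n / (Im z) ^ 4 + 2304 * a ^ 4 * (real n) ^ 4 / (Im z) ^ 6)"
  unfolding mean_tr_def
proof (rule joint_variance_le)
  let ?g = "\<lambda>j x. tr (Gr z (rest j) x) - of_real a * tr_sq (Gr z (rest j) x)"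
  show "(\<lambda>x. tr (Gr z {..<m} x)) \<in> borel_measurable joint_law" by (rule traces_measurable[OF order_refl z])
  show "?g j \<in> borel_measurable joint_law" for j
    using traces_measurable[OF rest_subset z] by measurable
  show "cmod (tr (Gr z {..<m} x)) \<le> real n / Im z + a * (real n / (Im z)\<^sup>2)" for x
    using traces_bounded(1)[OF z, of "{..<m}" x] a_pos by (simp add: add_increasing2)
  show "cmod (?g j x) \<le> real n / Im z + a * (real n / (Im z)\<^sup>2)" for j x
  proof -
    have "a * cmod (tr_sq (Gr z (rest j) x)) \<le> a * (real n / (Im z)\<^sup>2)"
      using a_pos by (intro mult_left_mono traces_bounded[OF z]) auto
    then show ?thesis
      using traces_bounded(1)[OF z, of "rest j" x] a_pos
        norm_triangle_ineq4[of "tr (Gr z (rest j) x)" "of_real a * tr_sq (Gr z (rest j) x)"]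
      by (simp add: norm_mult)
  qed
  show "?g j (x(j := y)) = ?g j x" for j x y unfolding Gr_upd[OF rest_notin] ..
  fix j x assume j: "j < m"
  interpret C: cavity \<mu> n "gram (rest j) x" z "Gr z (rest j) x" a by (rule cavity_Gr[OF z])
  have eq: "tr (Gr z {..<m} (x(j := y))) - ?g j x = of_real a * C.trace_sq - C.rk.\<beta> y * C.rk.s y" for y
    unfolding row_update(2)[OF z j] by simp
  show "(\<integral>y. (cmod (tr (Gr z {..<m} (x(j := y))) - ?g j x))\<^sup>2 \<partial>row_law n)
      \<le> 146 * v * a\<^sup>2 * real n / (Im z) ^ 4 + 2304 * a ^ 4 * (real n) ^ 4 / (Im z) ^ 6"
    unfolding eq by (rule C.trace_fluctuation)
qed

text \<open>The uncorrected entry of the reduced resolvent is a sufficient comparison: since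
  \<open>m a^2 = 1 / n\<close>, the bound is of size \<open>1/n + tail n\<close>, and convergence to
  zero is all that is asked.\<close>

lemma variance_diagonal:
  assumes z: "Im z > 0" and k: "k < n" and small: "4 * a * real n \<le> Im z"
  shows "(\<integral>x. (cmod (Gr z {..<m} x k k - (\<integral>x. Gr z {..<m} x k k \<partial>joint_law)))\<^sup>2 \<partial>joint_law)
    \<le> real m * (4 * (1 + v) * a\<^sup>2 / (Im z) ^ 4 + 16 * a\<^sup>2 * real n * tail n / (Im z) ^ 4)"
proof (rule joint_variance_le)
  show "(\<lambda>x. Gr z {..<m} x k k) \<in> borel_measurable joint_law" by (rule Gr_measurable[OF order_refl z k k])
  show "(\<lambda>x. Gr z (rest j) x k k) \<in> borel_measurable joint_law" for j by (rule Gr_measurable[OF rest_subset z k k])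
  show "cmod (Gr z {..<m} x k k) \<le> 1 / Im z" "cmod (Gr z (rest j) x k k) \<le> 1 / Im z" for j x
    by (rule resolvent_fun.entry_norm[OF resolvent_fun_Gr[OF z] k k])+
  show "Gr z (rest j) (x(j := y)) k k = Gr z (rest j) x k k" for j x y unfolding Gr_upd[OF rest_notin] ..
  fix j x assume j: "j < m"
  interpret C: cavity \<mu> n "gram (rest j) x" z "Gr z (rest j) x" a by (rule cavity_Gr[OF z])
  have eq: "cmod (Gr z {..<m} (x(j := y)) k k - Gr z (rest j) x k k) = cmod (C.rk.\<beta> y * (C.rk.u y k)\<^sup>2)" for y
    unfolding row_update(1)[OF z j k k] by (simp add: norm_mult power2_eq_square mult.assoc)
  show "(\<integral>y. (cmod (Gr z {..<m} (x(j := y)) k k - Gr z (rest j) x k k))\<^sup>2 \<partial>row_law n)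
      \<le> 4 * (1 + v) * a\<^sup>2 / (Im z) ^ 4 + 16 * a\<^sup>2 * real n * tail n / (Im z) ^ 4"
    unfolding eq by (rule C.entry_fluctuation[OF k small])
qed

text \<open>The same permutation acts in every row separately. It preserves the law of a row because
  the coordinates are i.i.d., hence also the product over rows.\<close>

lemma joint_law_permute_columns:
  assumes \<tau>: "bij_betw \<tau> {..<n} {..<n}"
  shows "distr joint_law joint_law (compose {..<m} (\<lambda>y. \<lambda>k\<in>{..<n}. y (\<tau> k))) = joint_law"
    and "compose {..<m} (\<lambda>y. \<lambda>k\<in>{..<n}. y (\<tau> k)) \<in> measurable joint_law joint_law"
proof -
  let ?\<phi> = "\<lambda>y. \<lambda>k\<in>{..<n}. y (\<tau> k)"
  have r: "\<tau> k < n" if "k < n" for k using bij_betwE[OF \<tau>] that by auto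
  have m: "?\<phi> \<in> measurable (row_law n) (row_law n)"
    unfolding row_law_def using r by (intro measurable_restrict measurable_component_singleton) auto
  have "distr (row_law n) (row_law n) ?\<phi> = row_law n"
    unfolding row_law_def
    using distr_PiM_reindex[of "{..<n}" "\<lambda>_. \<mu>" \<tau> "{..<n}"] bij_betw_imp_inj_on[OF \<tau>] r prob_space_axioms
    by auto
  then show "distr joint_law joint_law (compose {..<m} ?\<phi>) = joint_law"
    unfolding joint_law_def
    using distr_PiM_finite_prob_space'[of "{..<m}" "\<lambda>_. row_law n" "\<lambda>_. row_law n" ?\<phi>] prob_space_row_law m by simp
  have "(\<lambda>x. ?\<phi> (x j)) \<in> measurable (Pi\<^sub>M {..<m} (\<lambda>_. row_law n)) (row_law n)" if "j \<in> {..<m}" for j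
    using measurable_comp[OF measurable_component_singleton[OF that, of "\<lambda>_. row_law n"] m] unfolding comp_def .
  then show "compose {..<m} ?\<phi> \<in> measurable joint_law joint_law"
    unfolding joint_law_def compose_def by (intro measurable_restrict)
qed

text \<open>Permuting columns conjugates the Gram matrix, and with it the resolvent, by a
  permutation matrix. Hence all diagonal means agree, and they sum to the mean trace.\<close>

lemma mean_diagonal:
  assumes z: "Im z > 0" and k: "k < n"
  shows "(\<integral>x. Gr z {..<m} x k k \<partial>joint_law) = mean_tr z / of_nat n"
proof -
  have eq: "(\<integral>x. Gr z {..<m} x l l \<partial>joint_law) = (\<integral>x. Gr z {..<m} x k k \<partial>joint_law)" if l: "l < n" for l
  proof -
    \<comment> \<open>The transposition of \<open>k\<close> and \<open>l\<close>, which is its own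
      inverse.\<close>
    define \<tau> where "\<tau> i = (if i = k then l else if i = l then k else i)" for i
    have \<tau>: "bij_betw \<tau> {..<n} {..<n}"
      using k l by (intro bij_betw_byWitness[where f'=\<tau>]) (auto simp: \<tau>_def)
    let ?\<psi> = "compose {..<m} (\<lambda>y. \<lambda>k\<in>{..<n}. y (\<tau> k))"
    have r: "\<tau> k < n" if "k < n" for k using bij_betwE[OF \<tau>] that by auto
    have gram: "gram {..<m} x (\<tau> i) (\<tau> i') = gram {..<m} (?\<psi> x) i i'" if "i < n" "i' < n" for x i i'
    proof -
      have "\<tau> i = \<tau> i' \<longleftrightarrow> i = i'" using bij_betw_imp_inj_on[OF \<tau>] that by (auto simp: inj_on_def)
      then show ?thesis unfolding gram_def using that by (simp add: compose_def)
    qed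
    have "Gr z {..<m} (?\<psi> x) k k = Gr z {..<m} x (\<tau> k) (\<tau> k)" for x
    proof -
      have "resolvent_fun n (gram {..<m} (?\<psi> x)) z (\<lambda>k l. Gr z {..<m} x (\<tau> k) (\<tau> l))"
        by (rule resolvent_fun_cong[OF resolvent_fun_permute[OF resolvent_fun_Gr[OF z] \<tau>] gram refl])
      from resolvent_fun_unique[OF resolvent_fun_Gr[OF z] this k k] show ?thesis .
    qed
    moreover have "\<tau> k = l" by (simp add: \<tau>_def)
    ultimately have "(\<integral>x. Gr z {..<m} x l l \<partial>joint_law) = (\<integral>x. Gr z {..<m} (?\<psi> x) k k \<partial>joint_law)" by simp
    also have "\<dots> = (\<integral>x. Gr z {..<m} x k k \<partial>distr joint_law joint_law ?\<psi>)"
      by (rule integral_distr[symmetric, OF joint_law_permute_columns(2)[OF \<tau>] Gr_measurable[OF order_refl z k k]])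
    finally show ?thesis unfolding joint_law_permute_columns(1)[OF \<tau>] .
  qed
  have "mean_tr z = (\<Sum>l<n. \<integral>x. Gr z {..<m} x l l \<partial>joint_law)"
    unfolding mean_tr_def resolvent_fun.trace_def[OF resolvent_fun_Gr[OF z]]
    by (intro Bochner_Integration.integral_sum Q.integrable_bounded_complex(1)[OF Gr_measurable[OF order_refl z]
          resolvent_fun.entry_norm[OF resolvent_fun_Gr[OF z]]]) auto
  also have "\<dots> = (\<Sum>l<n. \<integral>x. Gr z {..<m} x k k \<partial>joint_law)"
    by (intro sum.cong refl eq) simp
  finally show ?thesis using n_pos by simp
qed

section \<open>The self-consistent equation for the mean trace\<close>

lemma trace_identity:
  assumes z: "Im z > 0"
  shows "of_nat n + z * tr (Gr z {..<m} x) = (\<Sum>j<m. of_real a * (qd (Gr z {..<m} x) (x j) - tr (Gr z {..<m} x)))"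
proof -
  define G where "G = Gr z {..<m} x"
  interpret resolvent_fun n "gram {..<m} x" z G unfolding G_def by (rule resolvent_fun_Gr[OF z])
  \<comment> \<open>The trace of \<open>(A - z) G = 1\<close>; below, \<open>Tr (A G)\<close> is
    split into the contributions of the rows and of the shift \<open>m\<close>.\<close>
  have "(\<Sum>k<n. (\<Sum>i<n. of_real (gram {..<m} x k i) * G i k) - z * G k k) = (\<Sum>k<n. 1)"
    by (intro sum.cong refl) (simp add: inv)
  then have 1: "(\<Sum>k<n. \<Sum>i<n. of_real (gram {..<m} x k i) * G i k) = of_nat n + z * trace"
    by (simp add: sum_subtractf trace_def sum_distrib_left algebra_simps)
  have row: "(\<Sum>i<n. of_real (gram {..<m} x k i) * G i k)
     = of_real a * (\<Sum>j<m. of_real (x j k) * (\<Sum>i<n. G k i * of_real (x j i))) - of_real a * of_nat m * G k k" if k: "k < n" for k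
  proof -
    have "(\<Sum>i<n. of_real (gram {..<m} x k i) * G i k)
      = (\<Sum>i<n. of_real a * (\<Sum>j<m. of_real (x j k) * (G k i * of_real (x j i))) - (if k = i then of_real a * of_nat m * G i k else 0))"
      using k by (intro sum.cong refl) (simp add: gram_def symG[of _ k] sum_distrib_left sum_distrib_right algebra_simps)
    also have "\<dots> = of_real a * (\<Sum>i<n. \<Sum>j<m. of_real (x j k) * (G k i * of_real (x j i))) - of_real a * of_nat m * G k k"
      using k by (simp add: sum_subtractf sum_distrib_left)
    also have "(\<Sum>i<n. \<Sum>j<m. of_real (x j k) * (G k i * of_real (x j i))) = (\<Sum>j<m. of_real (x j k) * (\<Sum>i<n. G k i * of_real (x j i)))"
      unfolding sum_distrib_left by (rule sum.swap)
    finally show ?thesis .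
  qed
  have "(\<Sum>k<n. \<Sum>i<n. of_real (gram {..<m} x k i) * G i k)
     = (\<Sum>k<n. of_real a * (\<Sum>j<m. of_real (x j k) * (\<Sum>i<n. G k i * of_real (x j i))) - of_real a * of_nat m * G k k)"
    by (intro sum.cong refl row) simp
  also have "\<dots> = of_real a * (\<Sum>k<n. \<Sum>j<m. of_real (x j k) * (\<Sum>i<n. G k i * of_real (x j i))) - of_real a * of_nat m * trace"
    by (simp add: sum_subtractf trace_def sum_distrib_left)
  also have "(\<Sum>k<n. \<Sum>j<m. of_real (x j k) * (\<Sum>i<n. G k i * of_real (x j i))) = (\<Sum>j<m. qd G (x j))"
    unfolding qd_def by (rule sum.swap)
  finally show ?thesis
    unfolding 1 G_def[symmetric] by (simp add: sum_subtractf sum_distrib_left[symmetric] right_diff_distrib)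
qed

definition R4_err where "R4_err z = 6 * (1 + v) * a\<^sup>2 * (real n)\<^sup>2 / (Im z) ^ 3"
definition R3_error where
  "R3_error z = 352 * a ^ 3 * (real n) ^ 4 / (Im z) ^ 4 + 12 * a\<^sup>2 * (real n)\<^sup>2 / (Im z)\<^sup>2 * sqrt (v * real n / (Im z)\<^sup>2)
      + (20 * a / (Im z)\<^sup>2 + a\<^sup>2 * real n / (Im z) ^ 3) * (real n * tail n)"
text \<open>The first two terms come from the cavity mean \<open>D\<close>. The others pay for
  passing from the reduced to the full resolvent: in the square of the trace, in
  \<open>trace_sq\<close> and \<open>diag_sq\<close> (the constants 3 and 2), and in the
  cube.\<close>

definition row_error where
  "row_error z = R3_error z + R4_err z
    + a * (2 * (real n / Im z) * (a * real n / (Im z)\<^sup>2 + R4_err z) + (3 + 2 * \<bar>\<kappa>\<bar>) / (Im z)\<^sup>2)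
    + 3 * a\<^sup>2 * (real n)\<^sup>2 / (Im z) ^ 3"

text \<open>The cavity computation yields powers of the reduced trace, which depend on
  \<open>j\<close>. They are exchanged for those of the full trace, so that the resulting equation
  is closed and the same for every row.\<close>

lemma row_contribution:
  assumes z: "Im z > 0" and j: "j < m"
  shows "integrable joint_law (\<lambda>x. qd (Gr z {..<m} x) (x j) - tr (Gr z {..<m} x))"
    and "cmod ((\<integral>x. qd (Gr z {..<m} x) (x j) - tr (Gr z {..<m} x) \<partial>joint_law)
      + of_real a * (\<integral>x. (tr (Gr z {..<m} x))\<^sup>2 + tr_sq (Gr z {..<m} x) + of_real \<kappa> * dg_sq (Gr z {..<m} x) \<partial>joint_law)
      - (of_real a)\<^sup>2 * (\<integral>x. (tr (Gr z {..<m} x)) ^ 3 \<partial>joint_law)) \<le> row_error z"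
proof -
  define F where "F x = tr (Gr z {..<m} x)" for x
  define P where "P x = tr_sq (Gr z {..<m} x) + of_real \<kappa> * dg_sq (Gr z {..<m} x)" for x
  define F0 where "F0 x = tr (Gr z (rest j) x)" for x
  define P0 where "P0 x = tr_sq (Gr z (rest j) x) + of_real \<kappa> * dg_sq (Gr z (rest j) x)" for x
  define d where "d x = qd (Gr z {..<m} x) (x j) - F x" for x
  have FI: "integrable joint_law (\<lambda>x. F x ^ e)" "integrable joint_law (\<lambda>x. F0 x ^ e)" for e
    unfolding F_def F0_def using traces_integrable(1)[OF _ z] rest_subset by auto
  have PI: "integrable joint_law P" "integrable joint_law P0"
    unfolding P_def[abs_def] P0_def[abs_def] using traces_integrable(2,3)[OF _ z] rest_subset[of j] by auto
  have cav: "d (x(j := y)) = cavity.D n (Gr z (rest j) x) a y" for x y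
  proof -
    interpret C: cavity \<mu> n "gram (rest j) x" z "Gr z (rest j) x" a by (rule cavity_Gr[OF z])
    show ?thesis unfolding d_def F_def fun_upd_same row_update(2,6)[OF z j] C.D_def ..
  qed
  show dI: "integrable joint_law d"
  proof -
    have meas: "(\<lambda>x. qd (Gr z {..<m} x) (x j)) \<in> borel_measurable joint_law"
      unfolding qd_def
    proof (intro borel_measurable_sum borel_measurable_times borel_measurable_of_real)
      fix k l assume "k \<in> {..<n}" "l \<in> {..<n}"
      then show "(\<lambda>x. Gr z {..<m} x k l) \<in> borel_measurable joint_law" by (intro Gr_measurable z) auto
    qed (use joint_component_measurable[of j "{..<m}"] j in \<open>auto simp: joint_law_def\<close>)
    have bound: "cmod (qd (Gr z {..<m} x) (x j)) \<le> (\<Sum>k<n. (x j k)\<^sup>2) / Im z" for x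
    proof -
      interpret resolvent_fun n "gram {..<m} x" z "Gr z {..<m} x" by (rule resolvent_fun_Gr[OF z])
      show ?thesis using bilinear_norm[of "\<lambda>k. of_real (x j k)"] by (simp add: qd_def app_def)
    qed
    have bI: "integrable joint_law (\<lambda>x. (\<Sum>k<n. (x j k)\<^sup>2) / Im z)"
      using row_integrable_joint[OF j normsq_moments(1)] by simp
    have "integrable joint_law (\<lambda>x. qd (Gr z {..<m} x) (x j))"
      by (rule Bochner_Integration.integrable_bound[OF bI meas])
         (intro AE_I2, simp only: real_norm_def, rule order_trans[OF bound abs_ge_self])
    then show ?thesis unfolding d_def[abs_def] using FI(1)[of 1] by simp
  qed
  \<comment> \<open>Formulated with the reduced quantities, so that integrating row \<open>j\<close>
    alone leaves exactly the expression bounded in \<open>D_mean\<close>.\<close>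
  define h where "h x = d x + of_real a * ((F0 x)\<^sup>2 + P0 x) - (of_real a)\<^sup>2 * F0 x ^ 3" for x
  have hI: "integrable joint_law h"
    unfolding h_def[abs_def] using dI FI(2) PI(2) by simp
  have 1: "cmod (\<integral>x. h x \<partial>joint_law) \<le> R3_error z + R4_err z"
  proof (rule joint_integral_bound[OF j hI])
    fix x
    interpret C: cavity \<mu> n "gram (rest j) x" z "Gr z (rest j) x" a by (rule cavity_Gr[OF z])
    have "h (x(j := y)) = C.D y + (of_real a * (C.trace\<^sup>2 + C.trace_sq + of_real \<kappa> * C.diag_sq) - (of_real a)\<^sup>2 * C.trace ^ 3)" for y
      unfolding h_def cav F0_def P0_def Gr_upd[OF rest_notin] by simp
    then have "(\<integral>y. h (x(j := y)) \<partial>row_law n) = (\<integral>y. C.D y \<partial>row_law n)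
        + of_real a * (C.trace\<^sup>2 + C.trace_sq + of_real \<kappa> * C.diag_sq) - (of_real a)\<^sup>2 * C.trace ^ 3"
      using C.D_mean(1) by (simp add: C.R.prob_space)
    then show "cmod (\<integral>y. h (x(j := y)) \<partial>row_law n) \<le> R3_error z + R4_err z"
      using C.D_mean(2) unfolding C.R3_err_def R3_error_def R4_err_def by (simp only:)
  qed
  \<comment> \<open>The bound in mean is essential: this difference is multiplied by
    \<open>F + F0\<close>, which can be of order \<open>n\<close>.\<close>
  have 2: "(\<integral>x. cmod (F x - F0 x) \<partial>joint_law) \<le> a * real n / (Im z)\<^sup>2 + R4_err z"
  proof -
    have "norm (\<integral>x. cmod (F x - F0 x) \<partial>joint_law) \<le> a * real n / (Im z)\<^sup>2 + R4_err z"
    proof (rule joint_integral_bound[OF j])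
      show "integrable joint_law (\<lambda>x. cmod (F x - F0 x))" using FI[of 1] by simp
      fix x
      interpret C: cavity \<mu> n "gram (rest j) x" z "Gr z (rest j) x" a by (rule cavity_Gr[OF z])
      have eq: "cmod (F (x(j := y)) - F0 (x(j := y))) = cmod (C.rk.\<beta> y * C.rk.s y)" for y
        unfolding F_def F0_def Gr_upd[OF rest_notin] row_update(2)[OF z j] by simp
      have "0 \<le> (\<integral>y. cmod (C.rk.\<beta> y * C.rk.s y) \<partial>row_law n)" by (intro integral_nonneg_AE) auto
      then show "norm (\<integral>y. cmod (F (x(j := y)) - F0 (x(j := y))) \<partial>row_law n) \<le> a * real n / (Im z)\<^sup>2 + R4_err z"
        unfolding eq real_norm_def R4_err_def using C.trace_change_mean(2) by simp
    qed
    then show ?thesis by simp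
  qed
  have P_diff: "cmod (P x - P0 x) \<le> (3 + 2 * \<bar>\<kappa>\<bar>) / (Im z)\<^sup>2" for x
  proof -
    have 1: "cmod (tr_sq (Gr z {..<m} x) - tr_sq (Gr z (rest j) x)) \<le> 3 / (Im z)\<^sup>2"
      using row_update(3)[OF z j, of x "x j"] by simp
    have 2: "cmod (dg_sq (Gr z {..<m} x) - dg_sq (Gr z (rest j) x)) \<le> 2 / (Im z)\<^sup>2"
      using row_update(4)[OF z j, of x "x j"] by simp
    have "cmod (P x - P0 x) = cmod ((tr_sq (Gr z {..<m} x) - tr_sq (Gr z (rest j) x))
        + of_real \<kappa> * (dg_sq (Gr z {..<m} x) - dg_sq (Gr z (rest j) x)))"
      unfolding P_def P0_def by (simp add: algebra_simps)
    also have "\<dots> \<le> 3 / (Im z)\<^sup>2 + \<bar>\<kappa>\<bar> * (2 / (Im z)\<^sup>2)"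
      by (rule order_trans[OF norm_triangle_ineq]) (intro add_mono 1, simp only: norm_mult norm_of_real, intro mult_left_mono 2, simp)
    finally show ?thesis by (simp add: add_divide_distrib ac_simps)
  qed
  have Fb: "cmod (F x) \<le> real n / Im z" "cmod (F0 x) \<le> real n / Im z" for x
    unfolding F_def F0_def by (rule traces_bounded[OF z])+
  have F_diff: "cmod (F x - F0 x) \<le> 1 / Im z" for x
    unfolding F_def F0_def using row_update(5)[OF z j, of x "x j"] by simp
  have sq_diff: "cmod ((F x)\<^sup>2 - (F0 x)\<^sup>2) \<le> 2 * (real n / Im z) * cmod (F x - F0 x)" for x
  proof -
    have "(F x)\<^sup>2 - (F0 x)\<^sup>2 = (F x + F0 x) * (F x - F0 x)" by (simp add: power2_eq_square algebra_simps)
    moreover have "cmod (F x + F0 x) \<le> 2 * (real n / Im z)"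
      using Fb[of x] norm_triangle_ineq[of "F x" "F0 x"] by simp
    ultimately show ?thesis by (simp only: norm_mult) (intro mult_right_mono, auto)
  qed
  \<comment> \<open>Here the deterministic bound is good enough, because the factor
    \<open>a^2 n^2\<close> is already of order \<open>c^2\<close>.\<close>
  have cube_diff: "cmod (F x ^ 3 - F0 x ^ 3) \<le> 3 * (real n / Im z)\<^sup>2 * (1 / Im z)" for x
    using norm_diff_cube_le[OF Fb] mult_left_mono[OF F_diff, of "3 * (real n / Im z)\<^sup>2" x] by (meson order_trans zero_le_mult_iff zero_le_numeral zero_le_power2)
  define e where "e x = of_real a * (((F x)\<^sup>2 - (F0 x)\<^sup>2) + (P x - P0 x)) - (of_real a)\<^sup>2 * (F x ^ 3 - F0 x ^ 3)" for x
  have eI: "integrable joint_law e"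
    unfolding e_def[abs_def] using FI PI by simp
  have e_le: "cmod (e x) \<le> a * (2 * (real n / Im z)) * cmod (F x - F0 x) + (a * ((3 + 2 * \<bar>\<kappa>\<bar>) / (Im z)\<^sup>2) + a\<^sup>2 * (3 * (real n / Im z)\<^sup>2 * (1 / Im z)))" for x
  proof -
    have "cmod (e x) \<le> a * cmod ((F x)\<^sup>2 - (F0 x)\<^sup>2) + a * cmod (P x - P0 x) + a\<^sup>2 * cmod (F x ^ 3 - F0 x ^ 3)"
    proof -
      have "e x = (of_real a * ((F x)\<^sup>2 - (F0 x)\<^sup>2) + of_real a * (P x - P0 x)) - (of_real a)\<^sup>2 * (F x ^ 3 - F0 x ^ 3)"
        unfolding e_def by (simp only: distrib_left)
      then have "cmod (e x) \<le> cmod (of_real a * ((F x)\<^sup>2 - (F0 x)\<^sup>2)) + cmod (of_real a * (P x - P0 x)) + cmod ((of_real a)\<^sup>2 * (F x ^ 3 - F0 x ^ 3))"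
        using norm_triangle_ineq4[of "of_real a * ((F x)\<^sup>2 - (F0 x)\<^sup>2) + of_real a * (P x - P0 x)" "(of_real a)\<^sup>2 * (F x ^ 3 - F0 x ^ 3)"]
          norm_triangle_ineq[of "of_real a * ((F x)\<^sup>2 - (F0 x)\<^sup>2)" "of_real a * (P x - P0 x)"] by (simp only:)
      then show ?thesis using a_pos by (simp add: norm_mult norm_power)
    qed
    also have "\<dots> \<le> a * (2 * (real n / Im z) * cmod (F x - F0 x)) + a * ((3 + 2 * \<bar>\<kappa>\<bar>) / (Im z)\<^sup>2) + a\<^sup>2 * (3 * (real n / Im z)\<^sup>2 * (1 / Im z))"
      using a_pos by (intro add_mono mult_left_mono sq_diff P_diff cube_diff) auto
    finally show ?thesis by (simp only: mult.assoc add.assoc)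
  qed
  have 3: "cmod (\<integral>x. e x \<partial>joint_law) \<le> a * (2 * (real n / Im z)) * (a * real n / (Im z)\<^sup>2 + R4_err z)
      + (a * ((3 + 2 * \<bar>\<kappa>\<bar>) / (Im z)\<^sup>2) + a\<^sup>2 * (3 * (real n / Im z)\<^sup>2 * (1 / Im z)))"
  proof -
    have "cmod (\<integral>x. e x \<partial>joint_law) \<le> (\<integral>x. cmod (e x) \<partial>joint_law)" by (rule integral_norm_bound)
    also have "\<dots> \<le> (\<integral>x. a * (2 * (real n / Im z)) * cmod (F x - F0 x) + (a * ((3 + 2 * \<bar>\<kappa>\<bar>) / (Im z)\<^sup>2) + a\<^sup>2 * (3 * (real n / Im z)\<^sup>2 * (1 / Im z))) \<partial>joint_law)"
      using eI FI[of 1] by (intro integral_mono e_le) auto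
    also have "\<dots> = a * (2 * (real n / Im z)) * (\<integral>x. cmod (F x - F0 x) \<partial>joint_law) + (a * ((3 + 2 * \<bar>\<kappa>\<bar>) / (Im z)\<^sup>2) + a\<^sup>2 * (3 * (real n / Im z)\<^sup>2 * (1 / Im z)))"
      using FI[of 1] by (simp add: Q.prob_space)
    also have "\<dots> \<le> a * (2 * (real n / Im z)) * (a * real n / (Im z)\<^sup>2 + R4_err z)
      + (a * ((3 + 2 * \<bar>\<kappa>\<bar>) / (Im z)\<^sup>2) + a\<^sup>2 * (3 * (real n / Im z)\<^sup>2 * (1 / Im z)))"
      using a_pos z by (intro add_right_mono mult_left_mono 2) auto
    finally show ?thesis .
  qed
  have "(\<integral>x. d x \<partial>joint_law) + of_real a * (\<integral>x. (F x)\<^sup>2 + P x \<partial>joint_law) - (of_real a)\<^sup>2 * (\<integral>x. F x ^ 3 \<partial>joint_law)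
     = (\<integral>x. h x \<partial>joint_law) + (\<integral>x. e x \<partial>joint_law)"
  proof -
    have "(\<integral>x. h x \<partial>joint_law) + (\<integral>x. e x \<partial>joint_law) = (\<integral>x. h x + e x \<partial>joint_law)"
      using hI eI by simp
    also have "\<dots> = (\<integral>x. d x + of_real a * ((F x)\<^sup>2 + P x) - (of_real a)\<^sup>2 * F x ^ 3 \<partial>joint_law)"
      by (intro Bochner_Integration.integral_cong refl) (simp add: h_def e_def algebra_simps)
    also have "\<dots> = (\<integral>x. d x \<partial>joint_law) + of_real a * (\<integral>x. (F x)\<^sup>2 + P x \<partial>joint_law) - (of_real a)\<^sup>2 * (\<integral>x. F x ^ 3 \<partial>joint_law)"
      using dI FI(1) PI(1) by simp
    finally show ?thesis by simp
  qed
  then have "cmod ((\<integral>x. d x \<partial>joint_law) + of_real a * (\<integral>x. (F x)\<^sup>2 + P x \<partial>joint_law) - (of_real a)\<^sup>2 * (\<integral>x. F x ^ 3 \<partial>joint_law))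
     \<le> cmod (\<integral>x. h x \<partial>joint_law) + cmod (\<integral>x. e x \<partial>joint_law)"
    by (simp only: norm_triangle_ineq)
  also have "\<dots> \<le> row_error z"
    using 1 3 unfolding row_error_def by (simp add: power_divide power2_eq_square power3_eq_cube algebra_simps)
  finally show "cmod ((\<integral>x. qd (Gr z {..<m} x) (x j) - tr (Gr z {..<m} x) \<partial>joint_law)
      + of_real a * (\<integral>x. (tr (Gr z {..<m} x))\<^sup>2 + tr_sq (Gr z {..<m} x) + of_real \<kappa> * dg_sq (Gr z {..<m} x) \<partial>joint_law)
      - (of_real a)\<^sup>2 * (\<integral>x. (tr (Gr z {..<m} x)) ^ 3 \<partial>joint_law)) \<le> row_error z"
    unfolding d_def F_def P_def add.assoc .
qed

text \<open>Expectation of the trace identity with each row replaced by its approximation; the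
  \<open>m\<close> identical main terms add up to the factors \<open>m a^2\<close> and
  \<open>m a^3\<close>.\<close>

lemma self_consistent_equation:
  assumes z: "Im z > 0"
  shows "cmod (of_nat n + z * mean_tr z
      + of_real (real m * a\<^sup>2) * (\<integral>x. (tr (Gr z {..<m} x))\<^sup>2 + tr_sq (Gr z {..<m} x) + of_real \<kappa> * dg_sq (Gr z {..<m} x) \<partial>joint_law)
      - of_real (real m * a ^ 3) * (\<integral>x. (tr (Gr z {..<m} x)) ^ 3 \<partial>joint_law)) \<le> real m * a * row_error z"
proof -
  define I where "I = (\<integral>x. (tr (Gr z {..<m} x))\<^sup>2 + tr_sq (Gr z {..<m} x) + of_real \<kappa> * dg_sq (Gr z {..<m} x) \<partial>joint_law)"
  define K where "K = (\<integral>x. (tr (Gr z {..<m} x)) ^ 3 \<partial>joint_law)"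
  define E where "E j = (\<integral>x. qd (Gr z {..<m} x) (x j) - tr (Gr z {..<m} x) \<partial>joint_law)" for j
  have FI: "integrable joint_law (\<lambda>x. tr (Gr z {..<m} x))" using traces_integrable(1)[OF order_refl z, of 1] by simp
  have "of_nat n + z * mean_tr z = (\<integral>x. of_nat n + z * tr (Gr z {..<m} x) \<partial>joint_law)"
    unfolding mean_tr_def using FI by (simp add: Q.prob_space)
  also have "\<dots> = (\<Sum>j<m. of_real a * E j)"
    unfolding trace_identity[OF z] E_def
    by (subst Bochner_Integration.integral_sum) (auto intro!: row_contribution(1)[OF z] integrable_mult_right)
  finally have "of_nat n + z * mean_tr z + of_real (real m * a\<^sup>2) * I - of_real (real m * a ^ 3) * K
     = (\<Sum>j<m. of_real a * (E j + of_real a * I - (of_real a)\<^sup>2 * K))"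
    by (simp add: sum.distrib sum_subtractf distrib_left right_diff_distrib power2_eq_square power3_eq_cube)
  then have "cmod (of_nat n + z * mean_tr z + of_real (real m * a\<^sup>2) * I - of_real (real m * a ^ 3) * K)
     \<le> (\<Sum>j<m. cmod (of_real a * (E j + of_real a * I - (of_real a)\<^sup>2 * K)))"
    by (simp only: norm_sum)
  also have "\<dots> \<le> (\<Sum>j<m. a * row_error z)"
  proof (rule sum_mono)
    fix j assume "j \<in> {..<m}"
    then have "cmod (E j + of_real a * I - (of_real a)\<^sup>2 * K) \<le> row_error z"
      unfolding E_def I_def K_def by (intro row_contribution(2)[OF z]) simp
    then have "a * cmod (E j + of_real a * I - (of_real a)\<^sup>2 * K) \<le> a * row_error z"
      using a_pos by (intro mult_left_mono) auto
    then show "cmod (of_real a * (E j + of_real a * I - (of_real a)\<^sup>2 * K)) \<le> a * row_error z"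
      using a_pos by (simp add: norm_mult)
  qed
  finally show ?thesis unfolding I_def K_def by simp
qed

lemma trace_difference_quotient:
  assumes z: "Im z > 0" and z': "Im z \<le> Im z'"
  shows "cmod (mean_tr z' - mean_tr z - (z' - z) * (\<integral>x. tr_sq (Gr z {..<m} x) \<partial>joint_law))
    \<le> (cmod (z' - z))\<^sup>2 * real n / (Im z) ^ 3"
proof -
  have z'': "Im z' > 0" using z z' by simp
  have I: "integrable joint_law (\<lambda>x. tr (Gr z {..<m} x))" "integrable joint_law (\<lambda>x. tr (Gr z' {..<m} x))"
    using traces_integrable(1)[OF order_refl z, of 1] traces_integrable(1)[OF order_refl z'', of 1] by auto
  note I2 = traces_integrable(2)[OF order_refl z]
  have "mean_tr z' - mean_tr z - (z' - z) * (\<integral>x. tr_sq (Gr z {..<m} x) \<partial>joint_law)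
     = (\<integral>x. tr (Gr z' {..<m} x) - tr (Gr z {..<m} x) - (z' - z) * tr_sq (Gr z {..<m} x) \<partial>joint_law)"
    unfolding mean_tr_def using I I2 by simp
  moreover have "cmod (\<integral>x. tr (Gr z' {..<m} x) - tr (Gr z {..<m} x) - (z' - z) * tr_sq (Gr z {..<m} x) \<partial>joint_law)
     \<le> (cmod (z' - z))\<^sup>2 * real n / (Im z) ^ 3"
  proof (rule Q.integral_cmod_le_bound)
    show "(\<lambda>x. tr (Gr z' {..<m} x) - tr (Gr z {..<m} x) - (z' - z) * tr_sq (Gr z {..<m} x)) \<in> borel_measurable joint_law"
      using traces_measurable[OF order_refl z] traces_measurable[OF order_refl z''] by measurable
    show "cmod (tr (Gr z' {..<m} x) - tr (Gr z {..<m} x) - (z' - z) * tr_sq (Gr z {..<m} x)) \<le> (cmod (z' - z))\<^sup>2 * real n / (Im z) ^ 3" for x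
      by (rule resolvent_trace_difference[OF resolvent_fun_Gr[OF z] resolvent_fun_Gr[OF z''] z'])
  qed
  ultimately show ?thesis by (simp only:)
qed

end

section \<open>The semicircle equation\<close>

text \<open>The other root is \<open>1 / f = - z - f = - (z + s) / 2\<close>, and
  \<open>Im z\<close> and \<open>Im s\<close> are both positive. Its negative imaginary part makes
  \<open>Im f\<close> positive, as inversion reverses that sign.\<close>

lemma semicircle_stieltjes_properties:
  assumes z: "Im z > 0"
  defines "f \<equiv> semicircle_stieltjes z"
  shows semicircle_quadratic: "f\<^sup>2 + z * f + 1 = 0"
    and Im_semicircle_pos: "Im f > 0"
    and semicircle_norm_less: "cmod f < 1"
    and Im_inverse_semicircle: "Im (1 / f) < 0"
    and semicircle_inverse: "1 / f = - z - f"
proof -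
  define s where "s = upper_sqrt (z\<^sup>2 - 4)"
  have "s\<^sup>2 = z\<^sup>2 - 4 \<and> Im s > 0"
    unfolding s_def upper_sqrt_def by (rule theI'[OF ex1_upper_sqrt[OF sq_minus_4_not_nonneg]]) (use z in simp)
  then have s: "s * s = z * z - 4" "Im s > 0" unfolding power2_eq_square by blast+
  have f: "f = (s - z) / 2" by (simp add: f_def semicircle_stieltjes_def s_def)
  have "4 * (f\<^sup>2 + z * f + 1) = s * s - z * z + 4"
    by (simp add: f power2_eq_square field_simps)
  also have "\<dots> = 0" unfolding s(1) by simp
  finally have "4 * (f\<^sup>2 + z * f + 1) = 0" .
  then show q: "f\<^sup>2 + z * f + 1 = 0" by (simp only: mult_eq_0_iff) simp
  then have f0: "f \<noteq> 0" by auto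
  have "f * (- z - f) = - (f\<^sup>2 + z * f + 1) + 1" by (simp add: power2_eq_square algebra_simps)
  then have "f * (- z - f) = 1" unfolding q by simp
  then show inv: "1 / f = - z - f" using f0 by (simp add: divide_eq_eq mult.commute)
  have Im_inv: "Im (1 / f) = - Im f / (cmod f)\<^sup>2"
    by (simp add: Im_divide cmod_power2)
  have neg: "Im (- z - f) < 0" using z s(2) by (simp add: f)
  then show neg': "Im (1 / f) < 0" unfolding inv .
  have "(cmod f)\<^sup>2 > 0" using f0 by simp
  then show pos: "Im f > 0" using neg' unfolding Im_inv by (simp add: zero_less_divide_iff)
  \<comment> \<open>Imaginary parts of \<open>1 / f = - z - f\<close> give
    \<open>Im f = (Im z + Im f) |f|^2\<close>, which is impossible unless
    \<open>|f| < 1\<close>.\<close>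
  have "Im f / (cmod f)\<^sup>2 = Im z + Im f" using Im_inv unfolding inv by simp
  then have "Im f = (Im z + Im f) * (cmod f)\<^sup>2" using \<open>(cmod f)\<^sup>2 > 0\<close> by (simp add: field_simps)
  then have "Im f = Im z * (cmod f)\<^sup>2 + Im f * (cmod f)\<^sup>2" by (simp only: distrib_right)
  moreover have "Im z * (cmod f)\<^sup>2 > 0" using z \<open>(cmod f)\<^sup>2 > 0\<close> by (rule mult_pos_pos)
  ultimately have "Im f * (cmod f)\<^sup>2 < Im f * 1" by linarith
  then have "(cmod f)\<^sup>2 < 1\<^sup>2" using pos by simp
  then show "cmod f < 1" by (rule power2_less_imp_less) simp
qed

lemma semicircle_factor:
  assumes z: "Im z > 0"
  shows "w\<^sup>2 + z * w + 1 = (w - semicircle_stieltjes z) * (w - 1 / semicircle_stieltjes z)"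
proof -
  define f where "f = semicircle_stieltjes z"
  have q: "f\<^sup>2 + z * f + 1 = 0" and inv: "1 / f = - z - f"
    unfolding f_def using semicircle_quadratic[OF z] semicircle_inverse[OF z] by auto
  have "(w - f) * (w - 1 / f) = w\<^sup>2 + z * w - (f\<^sup>2 + z * f)"
    unfolding inv by (simp add: power2_eq_square algebra_simps)
  also have "f\<^sup>2 + z * f = - 1" using q by (simp add: add_eq_0_iff2)
  finally show ?thesis by (simp add: f_def)
qed

text \<open>The second root \<open>1 / f\<close> lies in the lower half-plane, hence away from Stieltjes transforms.\<close>

lemma semicircle_gap:
  assumes z: "Im z > 0" and w: "Im w \<ge> 0"
  shows "cmod (w - 1 / semicircle_stieltjes z) \<ge> - Im (1 / semicircle_stieltjes z)"
  using w abs_Im_le_cmod[of "w - 1 / semicircle_stieltjes z"] by simp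

text \<open>The quadratic factors over its two roots, and the factor belonging to
  \<open>1 / f\<close> is bounded below, so the residual controls the distance to
  \<open>f\<close>.\<close>

lemma semicircle_stability:
  assumes z: "Im z > 0" and w: "Im w \<ge> 0"
  shows "cmod (w - semicircle_stieltjes z) \<le> cmod (w\<^sup>2 + z * w + 1) / (- Im (1 / semicircle_stieltjes z))"
proof -
  have "cmod (w - semicircle_stieltjes z) * (- Im (1 / semicircle_stieltjes z))
      \<le> cmod (w - semicircle_stieltjes z) * cmod (w - 1 / semicircle_stieltjes z)"
    using z w by (intro mult_left_mono semicircle_gap) auto
  also have "\<dots> = cmod (w\<^sup>2 + z * w + 1)" unfolding semicircle_factor[OF z] norm_mult ..
  finally show ?thesis using Im_inverse_semicircle[OF z] by (subst pos_le_divide_eq) auto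
qed

text \<open>Inserting the value at \<open>z + i t\<close> into the quadratic at \<open>z\<close>
  leaves the residual \<open>- i t g\<close>. Factoring that quadratic at \<open>z\<close> gives the
  exact quotient, and the stability argument its continuity.\<close>

lemma semicircle_difference_quotient:
  assumes z: "Im z > 0" and t: "t > 0"
  defines "f \<equiv> semicircle_stieltjes z" and "g \<equiv> semicircle_stieltjes (z + \<i> * of_real t)"
  shows "(g - f) / (\<i> * of_real t) = - g / (g - 1 / f)"
    and "cmod (g - f) \<le> t / (- Im (1 / f))"
proof -
  have z': "Im (z + \<i> * of_real t) > 0" using z t by simp
  have "g\<^sup>2 + (z + \<i> * of_real t) * g + 1 = 0"
    unfolding g_def by (rule semicircle_quadratic[OF z'])
  moreover have "g\<^sup>2 + z * g + 1 = (g\<^sup>2 + (z + \<i> * of_real t) * g + 1) - \<i> * of_real t * g"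
    by (simp add: algebra_simps)
  ultimately have "g\<^sup>2 + z * g + 1 = - (\<i> * of_real t * g)" by simp
  then have eq: "(g - f) * (g - 1 / f) = - (\<i> * of_real t * g)"
    unfolding semicircle_factor[OF z] f_def .
  have Img: "Im g > 0" unfolding g_def by (rule Im_semicircle_pos[OF z'])
  have "Im (g - 1 / f) > 0" using Img Im_inverse_semicircle[OF z] by (simp add: f_def)
  then have nz: "g - 1 / f \<noteq> 0" by (metis less_irrefl zero_complex.sel(2))
  have "g - f = - (\<i> * of_real t * g) / (g - 1 / f)"
    by (subst nonzero_eq_divide_eq[OF nz]) (rule eq)
  then have "g - f = \<i> * of_real t * (- g / (g - 1 / f))" by simp
  then show "(g - f) / (\<i> * of_real t) = - g / (g - 1 / f)" using t by simp
  have "cmod (g - f) \<le> cmod (g\<^sup>2 + z * g + 1) / (- Im (1 / f))"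
    unfolding f_def by (rule semicircle_stability[OF z]) (use Img in simp)
  also have "cmod (g\<^sup>2 + z * g + 1) = t * cmod g"
    unfolding semicircle_factor[OF z] f_def[symmetric] eq using t by (simp add: norm_mult)
  also have "t * cmod g / (- Im (1 / f)) \<le> t * 1 / (- Im (1 / f))"
    using t semicircle_norm_less[OF z'] Im_inverse_semicircle[OF z]
    by (intro divide_right_mono mult_left_mono) (auto simp: g_def f_def)
  finally show "cmod (g - f) \<le> t / (- Im (1 / f))" by simp
qed

text \<open>Only the upward imaginary direction is considered: there the imaginary part grows, as
  \<open>quot\<close> in the expansion below demands.\<close>

lemma semicircle_derivative:
  assumes z: "Im z > 0"
  defines "f \<equiv> semicircle_stieltjes z"
  shows "((\<lambda>t. (semicircle_stieltjes (z + \<i> * of_real t) - f) / (\<i> * of_real t)) \<longlongrightarrow> f\<^sup>2 / (1 - f\<^sup>2)) (at_right 0)"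
proof -
  define g where "g t = semicircle_stieltjes (z + \<i> * of_real t)" for t
  have f0: "f \<noteq> 0" using Im_semicircle_pos[OF z] by (auto simp: f_def)
  have ff: "f - 1 / f \<noteq> 0"
  proof
    assume "f - 1 / f = 0"
    then have "Im f = Im (1 / f)" by (metis eq_iff_diff_eq_0)
    then show False using Im_semicircle_pos[OF z] Im_inverse_semicircle[OF z] by (simp add: f_def)
  qed
  have "((\<lambda>t. g t - f) \<longlongrightarrow> 0) (at_right 0)"
  proof (rule Lim_null_comparison)
    show "eventually (\<lambda>t. norm (g t - f) \<le> t / (- Im (1 / f))) (at_right 0)"
      using eventually_at_right_less[of 0]
      by eventually_elim (use semicircle_difference_quotient(2)[OF z] in \<open>simp add: g_def f_def\<close>)
    have "((\<lambda>t. t / (- Im (1 / f))) \<longlongrightarrow> 0 / (- Im (1 / f))) (at_right 0)"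
      using Im_inverse_semicircle[OF z] by (intro tendsto_intros) (auto simp: f_def)
    then show "((\<lambda>t. t / (- Im (1 / f))) \<longlongrightarrow> 0) (at_right 0)" by simp
  qed
  then have g: "(g \<longlongrightarrow> f) (at_right 0)" by (rule LIM_zero_cancel)
  have "((\<lambda>t. - g t / (g t - 1 / f)) \<longlongrightarrow> - f / (f - 1 / f)) (at_right 0)"
    by (intro tendsto_intros g ff)
  also have "- f / (f - 1 / f) = f\<^sup>2 / (1 - f\<^sup>2)"
  proof -
    have e: "f - 1 / f = - (1 - f\<^sup>2) / f" using f0 by (simp add: field_simps power2_eq_square)
    then have "1 - f\<^sup>2 \<noteq> 0" using ff by auto
    then show ?thesis unfolding e using f0 by (simp add: field_simps power2_eq_square)
  qed
  finally have lim: "((\<lambda>t. - g t / (g t - 1 / f)) \<longlongrightarrow> f\<^sup>2 / (1 - f\<^sup>2)) (at_right 0)" .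
  have "eventually (\<lambda>t. - g t / (g t - 1 / f) = (g t - f) / (\<i> * of_real t)) (at_right 0)"
    using eventually_at_right_less[of 0]
    by eventually_elim (use semicircle_difference_quotient(1)[OF z] in \<open>simp add: g_def f_def\<close>)
  from Lim_transform_eventually[OF lim this] show ?thesis unfolding g_def .
qed

text \<open>The scale \<open>\<epsilon>\<close> dominates \<open>c\<close> and \<open>1/N\<close>; the ratios \<open>c/\<epsilon>\<close> and \<open>(1/N)/\<epsilon>\<close> need not converge.\<close>

lemma stieltjes_expansion:
  fixes mb psq pdg fcb :: "nat \<Rightarrow> complex \<Rightarrow> complex" and c r \<epsilon> :: "nat \<Rightarrow> real" and \<kappa> :: real
  assumes Im_nonneg: "\<And>z N. Im z > 0 \<Longrightarrow> N > 0 \<Longrightarrow> Im (mb N z) \<ge> 0"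
    and psq_bound: "\<And>z N. Im z > 0 \<Longrightarrow> N > 0 \<Longrightarrow> cmod (psq N z) \<le> B z"
    and pdg_bound: "\<And>z N. Im z > 0 \<Longrightarrow> N > 0 \<Longrightarrow> cmod (pdg N z) \<le> B z"
    and fcb_bound: "\<And>z N. Im z > 0 \<Longrightarrow> N > 0 \<Longrightarrow> cmod (fcb N z) \<le> B z"
    and eq: "\<And>z N. Im z > 0 \<Longrightarrow> N > 0 \<Longrightarrow>
      cmod ((mb N z)\<^sup>2 + z * mb N z + 1 + of_real (r N) * (psq N z + of_real \<kappa> * pdg N z) - of_real (c N) * fcb N z) \<le> \<epsilon> N * d N z"
    and d: "\<And>z. Im z > 0 \<Longrightarrow> (\<lambda>N. d N z) \<longlonglongrightarrow> 0"
    and pdg: "\<And>z. Im z > 0 \<Longrightarrow> (\<lambda>N. pdg N z - (mb N z)\<^sup>2) \<longlonglongrightarrow> 0"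
    and fcb: "\<And>z. Im z > 0 \<Longrightarrow> (\<lambda>N. fcb N z - (mb N z) ^ 3) \<longlonglongrightarrow> 0"
    and quot: "\<And>z z' N. Im z > 0 \<Longrightarrow> Im z \<le> Im z' \<Longrightarrow> N > 0 \<Longrightarrow>
      cmod (mb N z' - mb N z - (z' - z) * psq N z) \<le> (cmod (z' - z))\<^sup>2 * K z"
    and c0: "c \<longlonglongrightarrow> 0" "\<And>N. c N \<ge> 0" and r0: "r \<longlonglongrightarrow> 0" "\<And>N. r N \<ge> 0"
    and \<epsilon>: "\<And>N. N > 0 \<Longrightarrow> \<epsilon> N > 0" "\<And>N. \<epsilon> N = max (c N) (r N)"
    and z: "Im z > 0"
  defines "f \<equiv> semicircle_stieltjes z"
  shows "(\<lambda>N. mb N z - f * (1 - of_real (c N) * (f ^ 3 / (1 - f\<^sup>2))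
      + of_real (r N) * (f\<^sup>2 / (1 - f\<^sup>2)\<^sup>2 + of_real \<kappa> * (f\<^sup>2 / (1 - f\<^sup>2)))))
    \<in> o(\<lambda>N. complex_of_real (\<epsilon> N))"
proof -
  have \<epsilon>0: "\<epsilon> \<longlonglongrightarrow> 0"
    unfolding \<epsilon>(2)[abs_def] using tendsto_max[OF c0(1) r0(1)] by simp
  have N0: "eventually (\<lambda>N. N > (0::nat)) sequentially" by (rule eventually_gt_at_top)
  \<comment> \<open>Stated for every \<open>z\<close> in the upper half-plane, since the limit of
    \<open>psq\<close> is found by comparing \<open>z\<close> with \<open>z + i t\<close>.\<close>
  have mb_lim: "(\<lambda>N. mb N z) \<longlonglongrightarrow> semicircle_stieltjes z" if z: "Im z > 0" for z
  proof -
    define \<gamma> where "\<gamma> = - Im (1 / semicircle_stieltjes z)"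
    have \<gamma>: "\<gamma> > 0" using Im_inverse_semicircle[OF z] by (simp add: \<gamma>_def)
    define b where "b N = (\<epsilon> N * d N z + r N * ((1 + \<bar>\<kappa>\<bar>) * B z) + c N * B z) / \<gamma>" for N
    have "b \<longlonglongrightarrow> (0 * 0 + 0 * ((1 + \<bar>\<kappa>\<bar>) * B z) + 0 * B z) / \<gamma>"
      unfolding b_def[abs_def] using \<gamma> by (intro tendsto_intros \<epsilon>0 d[OF z] c0(1) r0(1)) auto
    then have b0: "b \<longlonglongrightarrow> 0" by simp
    have "eventually (\<lambda>N. norm (mb N z - semicircle_stieltjes z) \<le> b N) sequentially"
      using N0
    proof eventually_elim
      case (elim N)
      define W where "W = (mb N z)\<^sup>2 + z * mb N z + 1"
      define U where "U = of_real (r N) * (psq N z + of_real \<kappa> * pdg N z)"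
      define V where "V = of_real (c N) * fcb N z"
      have e: "cmod (W + U - V) \<le> \<epsilon> N * d N z" unfolding W_def U_def V_def by (rule eq[OF z elim])
      have "cmod (psq N z + of_real \<kappa> * pdg N z) \<le> B z + \<bar>\<kappa>\<bar> * B z"
        by (rule order_trans[OF norm_triangle_ineq])
           (intro add_mono psq_bound[OF z elim], simp add: norm_mult mult_left_mono pdg_bound[OF z elim])
      then have "r N * cmod (psq N z + of_real \<kappa> * pdg N z) \<le> r N * ((1 + \<bar>\<kappa>\<bar>) * B z)"
        using r0(2) by (intro mult_left_mono) (auto simp: algebra_simps)
      then have u: "cmod U \<le> r N * ((1 + \<bar>\<kappa>\<bar>) * B z)" using r0(2) by (simp add: U_def norm_mult)
      have v: "cmod V \<le> c N * B z" unfolding V_def using c0(2)[of N] fcb_bound[OF z elim]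
        by (simp add: norm_mult mult_left_mono)
      have "cmod W \<le> cmod (W + U - V) + cmod U + cmod V"
        using norm_triangle_ineq4[of "W + U - V" "U - V"] norm_triangle_ineq4[of U V] by simp
      then have "cmod W \<le> \<epsilon> N * d N z + r N * ((1 + \<bar>\<kappa>\<bar>) * B z) + c N * B z"
        using e u v by linarith
      then have "cmod W / \<gamma> \<le> b N" unfolding b_def using \<gamma> by (intro divide_right_mono) auto
      moreover have "cmod (mb N z - semicircle_stieltjes z) \<le> cmod W / \<gamma>"
        unfolding W_def \<gamma>_def by (rule semicircle_stability[OF z Im_nonneg[OF z elim]])
      ultimately show ?case by simp
    qed
    then have "(\<lambda>N. mb N z - semicircle_stieltjes z) \<longlonglongrightarrow> 0" by (rule Lim_null_comparison[OF _ b0])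
    then show ?thesis by (rule LIM_zero_cancel)
  qed
  define L where "L = f\<^sup>2 / (1 - f\<^sup>2)"
  have psq_lim: "(\<lambda>N. psq N z) \<longlonglongrightarrow> L"
  proof (rule tendstoI)
    fix e :: real assume e: "e > 0"
    \<comment> \<open>Raised to be strictly positive, so that \<open>e / (3 * K')\<close> is a
      genuine threshold for \<open>t\<close>.\<close>
    define K' where "K' = \<bar>K z\<bar> + 1"
    have K': "K' > 0" "K z \<le> K'" by (auto simp: K'_def)
    have "eventually (\<lambda>t. dist ((semicircle_stieltjes (z + \<i> * of_real t) - f) / (\<i> * of_real t)) L < e / 3) (at_right 0)"
      using tendstoD[OF semicircle_derivative[OF z], of "e / 3"] e unfolding f_def L_def by simp
    moreover have "eventually (\<lambda>t. t < e / (3 * K')) (at_right (0::real))"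
      using e K' by (intro eventually_at_right_field[THEN iffD2] exI[of _ "e / (3 * K')"]) auto
    moreover note eventually_at_right_less[of "0::real"]
    ultimately have "eventually (\<lambda>t. dist ((semicircle_stieltjes (z + \<i> * of_real t) - f) / (\<i> * of_real t)) L < e / 3
        \<and> t < e / (3 * K') \<and> 0 < t) (at_right 0)"
      by eventually_elim auto
    then obtain t :: real where t: "dist ((semicircle_stieltjes (z + \<i> * of_real t) - f) / (\<i> * of_real t)) L < e / 3"
        "t < e / (3 * K')" "0 < t"
      using eventually_happens'[of "at_right (0::real)"] by auto
    \<comment> \<open>With \<open>t\<close> fixed, \<open>N\<close> tends to infinity. The error
      divides into three parts: \<open>psq\<close> against the quotient of \<open>mb\<close>, that
      against the quotient of \<open>f\<close>, and that against the derivative.\<close>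
    define z' where "z' = z + \<i> * of_real t"
    have z': "Im z' > 0" "Im z \<le> Im z'" "z' - z = \<i> * of_real t" "z' - z \<noteq> 0" "cmod (z' - z) = t"
      using z t(3) by (auto simp: z'_def norm_mult)
    have "(\<lambda>N. (mb N z' - mb N z) / (z' - z)) \<longlonglongrightarrow> (semicircle_stieltjes z' - f) / (z' - z)"
      using z'(4) unfolding f_def by (intro tendsto_intros mb_lim z z'(1)) auto
    then have "eventually (\<lambda>N. dist ((mb N z' - mb N z) / (z' - z)) ((semicircle_stieltjes z' - f) / (z' - z)) < e / 3) sequentially"
      by (rule tendstoD) (use e in simp)
    with N0 show "eventually (\<lambda>N. dist (psq N z) L < e) sequentially"
    proof eventually_elim
      case (elim N)
      define D where "D = (mb N z' - mb N z) / (z' - z)"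
      have "D - psq N z = (mb N z' - mb N z - (z' - z) * psq N z) / (z' - z)"
        unfolding D_def using z'(4) by (simp add: diff_divide_distrib)
      then have "cmod (D - psq N z) = cmod (mb N z' - mb N z - (z' - z) * psq N z) / t"
        by (simp only: norm_divide z'(5))
      also have "\<dots> \<le> (t\<^sup>2 * K z) / t"
        using quot[OF z z'(2) elim(1)] t(3) unfolding z'(5) by (intro divide_right_mono) auto
      also have "\<dots> = t * K z" using t(3) by (simp add: power2_eq_square)
      also have "\<dots> \<le> t * K'" using K' t(3) by (intro mult_left_mono) auto
      also have "\<dots> < e / 3" using t(2) K' by (simp add: field_simps)
      finally have 1: "dist (psq N z) D < e / 3" by (simp add: dist_norm norm_minus_commute)
      have 2: "dist D ((semicircle_stieltjes z' - f) / (z' - z)) < e / 3" using elim(2) unfolding D_def .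
      have 3: "dist ((semicircle_stieltjes z' - f) / (z' - z)) L < e / 3" using t(1) by (simp only: z'(3) z'_def[symmetric])
      show ?case
        using 1 2 3 dist_triangle[of "psq N z" L D] dist_triangle[of D L "(semicircle_stieltjes z' - f) / (z' - z)"] by linarith
    qed
  qed
  have m_lim: "(\<lambda>N. mb N z) \<longlonglongrightarrow> f" unfolding f_def by (rule mb_lim[OF z])
  have pdg_lim: "(\<lambda>N. pdg N z) \<longlonglongrightarrow> f\<^sup>2"
    using tendsto_add[OF pdg[OF z] tendsto_power[OF m_lim, of 2]] by simp
  have fcb_lim: "(\<lambda>N. fcb N z) \<longlonglongrightarrow> f ^ 3"
    using tendsto_add[OF fcb[OF z] tendsto_power[OF m_lim, of 3]] by simp
  have f0: "f \<noteq> 0" using Im_semicircle_pos[OF z] by (auto simp: f_def)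
  have gap: "Im (w - 1 / f) > 0" if "Im w \<ge> 0" for w
    using that Im_inverse_semicircle[OF z] by (simp add: f_def)
  have nz: "w - 1 / f \<noteq> 0" if "Im w \<ge> 0" for w
    using gap[OF that] by (metis less_irrefl zero_complex.sel(2))
  have ff: "f - 1 / f \<noteq> 0" by (rule nz) (use Im_semicircle_pos[OF z] in \<open>simp add: f_def\<close>)
  have e1: "f - 1 / f = - (1 - f\<^sup>2) / f" using f0 by (simp add: field_simps power2_eq_square)
  then have f1: "1 - f\<^sup>2 \<noteq> 0" using ff by auto
  \<comment> \<open>Dividing the quadratic by its second factor gives
    \<open>mb - f = \<rho> W\<close> exactly, so the expansion needs only the limit of
    \<open>\<rho>\<close> and no rate.\<close>
  define \<rho> where "\<rho> N = 1 / (mb N z - 1 / f)" for N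
  define \<rho>0 where "\<rho>0 = 1 / (f - 1 / f)"
  have \<rho>0: "\<rho>0 = - f / (1 - f\<^sup>2)" unfolding \<rho>0_def e1 using f0 f1 by (simp add: field_simps)
  have \<rho>_lim: "\<rho> \<longlonglongrightarrow> \<rho>0" unfolding \<rho>_def[abs_def] \<rho>0_def by (intro tendsto_intros m_lim ff)
  define W where "W N = (mb N z)\<^sup>2 + z * mb N z + 1" for N
  define E where "E N = W N + of_real (r N) * (psq N z + of_real \<kappa> * pdg N z) - of_real (c N) * fcb N z" for N
  define T where "T N = mb N z - f * (1 - of_real (c N) * (f ^ 3 / (1 - f\<^sup>2))
      + of_real (r N) * (f\<^sup>2 / (1 - f\<^sup>2)\<^sup>2 + of_real \<kappa> * (f\<^sup>2 / (1 - f\<^sup>2))))" for N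
  \<comment> \<open>Each coefficient is paired with its own limit before \<open>c\<close> and
    \<open>r\<close> are compared with \<open>\<epsilon>\<close>;
    \<open>\<rho>0 = - f / (1 - f^2)\<close> converts those limits into the claimed
    coefficients.\<close>
  have T_eq: "T N = of_real (c N) * (\<rho> N * fcb N z - \<rho>0 * f ^ 3)
      - of_real (r N) * (\<rho> N * (psq N z + of_real \<kappa> * pdg N z) - \<rho>0 * (L + of_real \<kappa> * f\<^sup>2)) + \<rho> N * E N" if "N > 0" for N
  proof -
    have t1: "mb N z - f = \<rho> N * W N"
      using nz[OF Im_nonneg[OF z that]] unfolding W_def semicircle_factor[OF z] f_def[symmetric] \<rho>_def by simp
    have t2: "W N = E N - of_real (r N) * (psq N z + of_real \<kappa> * pdg N z) + of_real (c N) * fcb N z"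
      by (simp add: E_def)
    have t3: "T N = (mb N z - f) - (of_real (c N) * (\<rho>0 * f ^ 3) - of_real (r N) * (\<rho>0 * (L + of_real \<kappa> * f\<^sup>2)))"
    proof -
      have a1: "f * (f ^ 3 / (1 - f\<^sup>2)) = - (\<rho>0 * f ^ 3)" unfolding \<rho>0 by simp
      have a2: "f * (f\<^sup>2 / (1 - f\<^sup>2)\<^sup>2 + of_real \<kappa> * (f\<^sup>2 / (1 - f\<^sup>2))) = - (\<rho>0 * (L + of_real \<kappa> * f\<^sup>2))"
        unfolding \<rho>0 L_def using f1 by (simp add: power2_eq_square distrib_left)
      have "T N = mb N z - f + of_real (c N) * (f * (f ^ 3 / (1 - f\<^sup>2)))
          - of_real (r N) * (f * (f\<^sup>2 / (1 - f\<^sup>2)\<^sup>2 + of_real \<kappa> * (f\<^sup>2 / (1 - f\<^sup>2))))"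
        unfolding T_def by (simp add: algebra_simps)
      then show ?thesis unfolding a1 a2 by (simp add: algebra_simps)
    qed
    show ?thesis unfolding t3 t1 t2 by (simp add: algebra_simps)
  qed
  define b where "b N = cmod (\<rho> N * fcb N z - \<rho>0 * f ^ 3)
      + cmod (\<rho> N * (psq N z + of_real \<kappa> * pdg N z) - \<rho>0 * (L + of_real \<kappa> * f\<^sup>2)) + cmod (\<rho> N) * d N z" for N
  have "b \<longlonglongrightarrow> cmod (\<rho>0 * f ^ 3 - \<rho>0 * f ^ 3)
      + cmod (\<rho>0 * (L + of_real \<kappa> * f\<^sup>2) - \<rho>0 * (L + of_real \<kappa> * f\<^sup>2)) + cmod \<rho>0 * 0"
    unfolding b_def[abs_def] by (intro tendsto_intros \<rho>_lim fcb_lim psq_lim pdg_lim d[OF z])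
  then have b0: "b \<longlonglongrightarrow> 0" by simp
  have T_le: "cmod (T N) \<le> \<epsilon> N * b N" if N: "N > 0" for N
  proof -
    have c: "c N \<le> \<epsilon> N" "r N \<le> \<epsilon> N" unfolding \<epsilon>(2) by auto
    define A1 where "A1 = \<rho> N * fcb N z - \<rho>0 * f ^ 3"
    define A2 where "A2 = \<rho> N * (psq N z + of_real \<kappa> * pdg N z) - \<rho>0 * (L + of_real \<kappa> * f\<^sup>2)"
    have "cmod (T N) \<le> cmod (of_real (c N) * A1) + cmod (of_real (r N) * A2) + cmod (\<rho> N * E N)"
      unfolding T_eq[OF N] A1_def[symmetric] A2_def[symmetric]
      using norm_triangle_ineq[of "of_real (c N) * A1 - of_real (r N) * A2" "\<rho> N * E N"]
        norm_triangle_ineq4[of "of_real (c N) * A1" "of_real (r N) * A2"] by linarith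
    also have "\<dots> = c N * cmod A1 + r N * cmod A2 + cmod (\<rho> N) * cmod (E N)"
      using c0(2) r0(2) by (simp add: norm_mult)
    also have "\<dots> \<le> \<epsilon> N * cmod A1 + \<epsilon> N * cmod A2 + cmod (\<rho> N) * (\<epsilon> N * d N z)"
      using c eq[OF z N] unfolding E_def W_def by (intro add_mono mult_right_mono mult_left_mono) auto
    finally show ?thesis unfolding b_def A1_def A2_def by (simp add: algebra_simps)
  qed
  have "T \<in> o(\<lambda>N. complex_of_real (\<epsilon> N))"
  proof (rule smalloI_tendsto)
    show "eventually (\<lambda>N. complex_of_real (\<epsilon> N) \<noteq> 0) sequentially"
      using N0
    proof eventually_elim
      case (elim N)
      then show ?case using \<epsilon>(1)[OF elim] by simp
    qed
    have "eventually (\<lambda>N. norm (T N / complex_of_real (\<epsilon> N)) \<le> b N) sequentially"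
      using N0
    proof eventually_elim
      case (elim N)
      then show ?case using T_le[OF elim] \<epsilon>(1)[OF elim] by (simp add: norm_divide pos_divide_le_eq mult.commute)
    qed
    then show "((\<lambda>N. T N / complex_of_real (\<epsilon> N)) \<longlongrightarrow> 0) sequentially"
      by (rule Lim_null_comparison[OF _ b0])
  qed
  then show ?thesis unfolding T_def[abs_def] .
qed

section \<open>Normalized spectral averages\<close>

text \<open>\<open>quadratic_Im\<close> applied to the unit vector at \<open>k\<close>. It places
  the mean trace in the closed upper half-plane, where the stability estimate holds.\<close>

lemma (in resolvent_fun) diagonal_Im_nonneg:
  assumes k: "k < n" shows "Im (G k k) \<ge> 0"
proof -
  define x :: "nat \<Rightarrow> real" where "x i = (if i = k then 1 else 0)" for i
  have x: "complex_of_real (x i) = (if i = k then 1 else 0)" for i by (simp add: x_def)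
  have app: "app (\<lambda>i. of_real (x i)) j = G j k" for j
    unfolding app_def x using k by (rule sum_delta_mult)
  have "(\<Sum>i<n. of_real (x i) * G i k) = (\<Sum>i<n. G i k * (if i = k then 1 else 0))"
    by (intro sum.cong refl) (simp add: x mult.commute)
  also have "\<dots> = G k k" using k by (rule sum_delta_mult)
  finally have "Im (G k k) = Im z * (\<Sum>j<n. (cmod (G j k))\<^sup>2)"
    using quadratic_Im[of x] unfolding app by simp
  then show ?thesis using Im_z by (simp add: sum_nonneg)
qed

context sample_cov
begin

definition c where "c = sqrt (real n / real m)"
definition r where "r = 1 / real n"

lemma c_pos: "c > 0" and r_pos: "r > 0" using n_pos m_pos by (simp_all add: c_def r_def)

lemma n_eq: "real n = 1 / r" using n_pos by (simp add: r_def)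

text \<open>With \<open>n_eq\<close> and \<open>m_eq\<close> this expresses all scales by the two
  small parameters \<open>c\<close> and \<open>r\<close>, so that error terms can be compared as
  monomials.\<close>

lemma a_eq: "a = c * r"
  using n_pos m_pos by (simp add: a_def c_def r_def real_sqrt_divide real_sqrt_mult field_simps)

lemma m_eq: "real m = 1 / (c\<^sup>2 * r)"
  using n_pos m_pos by (simp add: c_def r_def)

definition mean_st where "mean_st z = mean_tr z / of_nat n"
definition mean_sq where "mean_sq z = (\<integral>x. tr_sq (Gr z {..<m} x) \<partial>joint_law) / of_nat n"
definition mean_dg where "mean_dg z = (\<integral>x. dg_sq (Gr z {..<m} x) \<partial>joint_law) / of_nat n"
definition mean_cube where "mean_cube z = (\<integral>x. (tr (Gr z {..<m} x)) ^ 3 \<partial>joint_law) / (of_nat n) ^ 3"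

lemma mean_bounds:
  assumes z: "Im z > 0"
  shows "Im (mean_st z) \<ge> 0" "cmod (mean_sq z) \<le> 1 / (Im z)\<^sup>2" "cmod (mean_dg z) \<le> 1 / (Im z)\<^sup>2"
    "cmod (mean_cube z) \<le> 1 / (Im z) ^ 3"
proof -
  have "Im (mean_tr z) = (\<integral>x. Im (tr (Gr z {..<m} x)) \<partial>joint_law)"
    unfolding mean_tr_def using traces_integrable(1)[OF order_refl z, of 1] by simp
  also have "\<dots> \<ge> 0"
  proof (rule integral_nonneg_AE, rule AE_I2)
    fix x
    interpret resolvent_fun n "gram {..<m} x" z "Gr z {..<m} x" by (rule resolvent_fun_Gr[OF z])
    show "0 \<le> Im trace" unfolding trace_def Im_sum by (intro sum_nonneg diagonal_Im_nonneg) auto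
  qed
  finally show "Im (mean_st z) \<ge> 0" by (simp add: mean_st_def)
  have "cmod (\<integral>x. tr_sq (Gr z {..<m} x) \<partial>joint_law) \<le> real n / (Im z)\<^sup>2"
    by (rule Q.integral_cmod_le_bound[OF traces_measurable(2)[OF order_refl z] traces_bounded(2)[OF z]])
  then show "cmod (mean_sq z) \<le> 1 / (Im z)\<^sup>2"
    using n_pos by (simp add: mean_sq_def norm_divide pos_divide_le_eq)
  have "cmod (\<integral>x. dg_sq (Gr z {..<m} x) \<partial>joint_law) \<le> real n / (Im z)\<^sup>2"
    by (rule Q.integral_cmod_le_bound[OF traces_measurable(3)[OF order_refl z] traces_bounded(3)[OF z]])
  then show "cmod (mean_dg z) \<le> 1 / (Im z)\<^sup>2"
    using n_pos by (simp add: mean_dg_def norm_divide pos_divide_le_eq)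
  have "cmod (\<integral>x. (tr (Gr z {..<m} x)) ^ 3 \<partial>joint_law) \<le> (real n / Im z) ^ 3"
    using traces_measurable(1)[OF order_refl z] traces_bounded(1)[OF z]
    by (intro Q.integral_cmod_le_bound) (auto simp: norm_power intro!: power_mono)
  then show "cmod (mean_cube z) \<le> 1 / (Im z) ^ 3"
    using n_pos by (simp add: mean_cube_def norm_divide norm_power power_divide pos_divide_le_eq)
qed

text \<open>The bound of \<open>variance_trace\<close> divided by \<open>n^2\<close>. Both terms are
  negligible against \<open>max c r\<close> once \<open>c\<close> and \<open>r\<close> tend to
  zero.\<close>

definition var_bound where
  "var_bound z = 146 * v * r\<^sup>2 / (Im z) ^ 4 + 2304 * c\<^sup>2 * r / (Im z) ^ 6"

lemma normalized_variance:
  assumes z: "Im z > 0"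
  shows "(\<integral>x. (cmod (tr (Gr z {..<m} x) - mean_tr z))\<^sup>2 \<partial>joint_law) / (real n)\<^sup>2 \<le> var_bound z"
proof -
  have "(\<integral>x. (cmod (tr (Gr z {..<m} x) - mean_tr z))\<^sup>2 \<partial>joint_law) / (real n)\<^sup>2
    \<le> real m * (146 * v * a\<^sup>2 * real n / (Im z) ^ 4 + 2304 * a ^ 4 * (real n) ^ 4 / (Im z) ^ 6) / (real n)\<^sup>2"
    by (intro divide_right_mono variance_trace[OF z]) simp
  also have "\<dots> = var_bound z"
    unfolding var_bound_def n_eq m_eq a_eq using c_pos r_pos z
    by (simp add: field_simps power2_eq_square power4_eq_xxxx)
  finally show ?thesis .
qed

text \<open>The total error after division by \<open>max c r\<close>. Every summand retains a factor
  \<open>c\<close>, \<open>sqrt r\<close>, \<open>r\<close> or \<open>tail n\<close>, so it vanishes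
  in the limit.\<close>

definition rate where
  "rate z = 352 * c / (Im z) ^ 4 + 12 * sqrt (v * r / (Im z)\<^sup>2) / (Im z)\<^sup>2 + 20 * tail n / (Im z)\<^sup>2 + c * tail n / (Im z) ^ 3
    + 6 * (1 + v) * c / (Im z) ^ 3 + 2 / Im z * (c / (Im z)\<^sup>2 + 6 * (1 + v) * c\<^sup>2 / (Im z) ^ 3)
    + r * (3 + 2 * \<bar>\<kappa>\<bar>) / (Im z)\<^sup>2 + 3 * c / (Im z) ^ 3 + 146 * v * r / (Im z) ^ 4 + 2304 * c\<^sup>2 / (Im z) ^ 6"

text \<open>A row error is scaled by \<open>m a / n = r / c\<close>. In each resulting monomial one
  factor \<open>c\<close> or \<open>r\<close> is singled out and bounded by the maximum, and the
  rest is collected in \<open>rate\<close>.\<close>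

lemma error_le_rate:
  assumes z: "Im z > 0"
  shows "real m * a * row_error z / real n + var_bound z \<le> max c r * rate z"
proof -
  define \<eta> where "\<eta> = Im z"
  define s where "s = sqrt (v * r / \<eta>\<^sup>2)"
  define t where "t = tail n"
  define w where "w = 1 + v"
  define k where "k = 3 + 2 * \<bar>\<kappa>\<bar>"
  have \<eta>: "\<eta> > 0" using z by (simp add: \<eta>_def)
  have nn: "s \<ge> 0" "t \<ge> 0" "w \<ge> 0" "k \<ge> 0" "v \<ge> 0"
    using v_ge r_pos by (auto simp: s_def t_def w_def k_def tail_nonneg)
  have sq: "sqrt (v * real n / \<eta>\<^sup>2) = s / r"
  proof -
    have "v * real n / \<eta>\<^sup>2 = (v * r / \<eta>\<^sup>2) / r\<^sup>2"
      unfolding n_eq using r_pos by (simp add: power2_eq_square)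
    then have "sqrt (v * real n / \<eta>\<^sup>2) = sqrt (v * r / \<eta>\<^sup>2) / sqrt (r\<^sup>2)"
      using real_sqrt_divide[of "v * r / \<eta>\<^sup>2" "r\<^sup>2"] by (simp only:)
    then show ?thesis using r_pos by (simp add: s_def[symmetric])
  qed
  have R4: "R4_err z = 6 * w * c\<^sup>2 / \<eta> ^ 3"
    unfolding R4_err_def n_eq a_eq w_def \<eta>_def using r_pos by (simp add: power_mult_distrib power_divide)
  have R3: "R3_error z = 352 * c ^ 3 / (r * \<eta> ^ 4) + 12 * c\<^sup>2 * s / (r * \<eta>\<^sup>2) + (20 * c / \<eta>\<^sup>2 + c\<^sup>2 / \<eta> ^ 3) * t"
    unfolding R3_error_def \<eta>_def[symmetric] sq t_def[symmetric] unfolding n_eq a_eq using r_pos \<eta>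
    by (simp add: field_simps power2_eq_square power3_eq_cube power4_eq_xxxx)
  have row: "row_error z = 352 * c ^ 3 / (r * \<eta> ^ 4) + 12 * c\<^sup>2 * s / (r * \<eta>\<^sup>2) + 20 * c * t / \<eta>\<^sup>2 + c\<^sup>2 * t / \<eta> ^ 3
     + 6 * w * c\<^sup>2 / \<eta> ^ 3 + 2 * c / \<eta> * (c / \<eta>\<^sup>2 + 6 * w * c\<^sup>2 / \<eta> ^ 3) + c * r * k / \<eta>\<^sup>2 + 3 * c\<^sup>2 / \<eta> ^ 3"
    unfolding row_error_def R3 R4 \<eta>_def[symmetric] k_def[symmetric] unfolding n_eq a_eq using r_pos \<eta>
    by (simp add: power_mult_distrib power_divide distrib_left distrib_right ac_simps)
  have pre: "real m * a / real n = r / c"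
    unfolding m_eq a_eq n_eq using r_pos c_pos by (simp add: power2_eq_square)
  have "real m * a * row_error z / real n = r / c * row_error z"
    unfolding pre[symmetric] by simp
  also have "\<dots> = c * (352 * c / \<eta> ^ 4) + c * (12 * s / \<eta>\<^sup>2) + r * (20 * t / \<eta>\<^sup>2) + r * (c * t / \<eta> ^ 3)
     + r * (6 * w * c / \<eta> ^ 3) + r * (2 / \<eta> * (c / \<eta>\<^sup>2 + 6 * w * c\<^sup>2 / \<eta> ^ 3)) + r * (r * k / \<eta>\<^sup>2) + r * (3 * c / \<eta> ^ 3)"
    unfolding row using r_pos c_pos
    by (simp add: distrib_left power2_eq_square power3_eq_cube power4_eq_xxxx ac_simps)
  finally have E: "real m * a * row_error z / real n + var_bound z
     = c * (352 * c / \<eta> ^ 4) + c * (12 * s / \<eta>\<^sup>2) + r * (20 * t / \<eta>\<^sup>2) + r * (c * t / \<eta> ^ 3)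
     + r * (6 * w * c / \<eta> ^ 3) + r * (2 / \<eta> * (c / \<eta>\<^sup>2 + 6 * w * c\<^sup>2 / \<eta> ^ 3)) + r * (r * k / \<eta>\<^sup>2) + r * (3 * c / \<eta> ^ 3)
     + r * (146 * v * r / \<eta> ^ 4) + r * (2304 * c\<^sup>2 / \<eta> ^ 6)"
    by (simp add: var_bound_def \<eta>_def power2_eq_square ac_simps)
  let ?\<epsilon> = "max c r"
  have mono: "c * y \<le> ?\<epsilon> * y" "r * y \<le> ?\<epsilon> * y" if "y \<ge> 0" for y
    using that by (auto intro!: mult_right_mono)
  have "real m * a * row_error z / real n + var_bound z
     \<le> ?\<epsilon> * (352 * c / \<eta> ^ 4) + ?\<epsilon> * (12 * s / \<eta>\<^sup>2) + ?\<epsilon> * (20 * t / \<eta>\<^sup>2) + ?\<epsilon> * (c * t / \<eta> ^ 3)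
     + ?\<epsilon> * (6 * w * c / \<eta> ^ 3) + ?\<epsilon> * (2 / \<eta> * (c / \<eta>\<^sup>2 + 6 * w * c\<^sup>2 / \<eta> ^ 3)) + ?\<epsilon> * (r * k / \<eta>\<^sup>2) + ?\<epsilon> * (3 * c / \<eta> ^ 3)
     + ?\<epsilon> * (146 * v * r / \<eta> ^ 4) + ?\<epsilon> * (2304 * c\<^sup>2 / \<eta> ^ 6)"
    unfolding E using nn \<eta> c_pos r_pos
    by (intro add_mono mono) (auto intro!: divide_nonneg_nonneg mult_nonneg_nonneg add_nonneg_nonneg)
  also have "\<dots> = ?\<epsilon> * rate z"
    unfolding rate_def \<eta>_def[symmetric] s_def[symmetric] t_def[symmetric] w_def[symmetric] k_def[symmetric]
    by (simp only: distrib_left)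
  finally show ?thesis .
qed

text \<open>The self-consistent equation divided by \<open>n\<close>, combined with replacing the
  mean of the squared trace by the square of its mean. The two errors are exactly those added in
  \<open>error_le_rate\<close>.\<close>

lemma normalized_equation:
  assumes z: "Im z > 0"
  shows "cmod ((mean_st z)\<^sup>2 + z * mean_st z + 1 + of_real r * (mean_sq z + of_real \<kappa> * mean_dg z) - of_real c * mean_cube z)
    \<le> max c r * rate z"
proof -
  define F where "F x = tr (Gr z {..<m} x)" for x
  define I2 where "I2 = (\<integral>x. tr_sq (Gr z {..<m} x) \<partial>joint_law)"
  define I4 where "I4 = (\<integral>x. dg_sq (Gr z {..<m} x) \<partial>joint_law)"
  define K where "K = (\<integral>x. F x ^ 3 \<partial>joint_law)"
  define S where "S = (\<integral>x. (F x)\<^sup>2 \<partial>joint_law)"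
  define W where "W = (\<integral>x. (F x - mean_tr z)\<^sup>2 \<partial>joint_law)"
  note FI = traces_integrable(1)[OF order_refl z, folded F_def]
  have F1: "integrable joint_law F" using FI[of 1] by simp
  have mF: "mean_tr z = (\<integral>x. F x \<partial>joint_law)" by (simp add: mean_tr_def F_def)
  \<comment> \<open>\<open>W\<close> is a variance without modulus, since the equation contains
    complex squares; its norm is at most the true variance.\<close>
  have W_eq: "W = S - (mean_tr z)\<^sup>2"
  proof -
    have "W = (\<integral>x. (F x)\<^sup>2 - 2 * mean_tr z * F x + (mean_tr z)\<^sup>2 \<partial>joint_law)"
      unfolding W_def by (intro Bochner_Integration.integral_cong refl) (simp add: power2_eq_square algebra_simps)
    also have "\<dots> = S - 2 * mean_tr z * mean_tr z + (mean_tr z)\<^sup>2"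
      using FI[of 2] F1 by (simp add: S_def mF Q.prob_space)
    finally show ?thesis by (simp add: power2_eq_square)
  qed
  have W_le: "cmod W / (real n)\<^sup>2 \<le> var_bound z"
  proof -
    have "cmod W \<le> (\<integral>x. cmod ((F x - mean_tr z)\<^sup>2) \<partial>joint_law)" unfolding W_def by (rule integral_norm_bound)
    then have "cmod W / (real n)\<^sup>2 \<le> (\<integral>x. (cmod (F x - mean_tr z))\<^sup>2 \<partial>joint_law) / (real n)\<^sup>2"
      by (intro divide_right_mono) (auto simp: norm_power)
    then show ?thesis using normalized_variance[OF z] unfolding F_def by linarith
  qed
  have I: "(\<integral>x. (F x)\<^sup>2 + tr_sq (Gr z {..<m} x) + of_real \<kappa> * dg_sq (Gr z {..<m} x) \<partial>joint_law) = S + I2 + of_real \<kappa> * I4"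
    unfolding S_def I2_def I4_def using FI[of 2] traces_integrable(2,3)[OF order_refl z] by simp
  define X where "X = of_nat n + z * mean_tr z + of_real (real m * a\<^sup>2) * (S + I2 + of_real \<kappa> * I4) - of_real (real m * a ^ 3) * K"
  have X_le: "cmod X \<le> real m * a * row_error z"
    using self_consistent_equation[OF z] unfolding X_def F_def[symmetric] I K_def .
  have nr: "complex_of_nat n = 1 / of_real r" using n_eq by (metis of_real_1 of_real_divide of_real_of_nat_eq)
  have ma: "real m * a\<^sup>2 = r" unfolding m_eq a_eq using c_pos r_pos by (simp add: power2_eq_square field_simps)
  have ma3: "real m * a ^ 3 = c * r\<^sup>2" unfolding m_eq a_eq using c_pos r_pos by (simp add: power2_eq_square power3_eq_cube field_simps)
  have r0: "complex_of_real r \<noteq> 0" using r_pos by simp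
  have "(mean_st z)\<^sup>2 + z * mean_st z + 1 + of_real r * (mean_sq z + of_real \<kappa> * mean_dg z) - of_real c * mean_cube z
     = X * of_real r - W * (of_real r)\<^sup>2"
    unfolding X_def ma ma3 W_eq mean_st_def mean_sq_def mean_dg_def mean_cube_def I2_def[symmetric] I4_def[symmetric] F_def[symmetric] K_def[symmetric] nr
    using r0 by (simp add: field_simps power2_eq_square power3_eq_cube)
  then have "cmod ((mean_st z)\<^sup>2 + z * mean_st z + 1 + of_real r * (mean_sq z + of_real \<kappa> * mean_dg z) - of_real c * mean_cube z)
     \<le> cmod (X * of_real r) + cmod (W * (of_real r)\<^sup>2)"
    by (simp only: norm_triangle_ineq4)
  also have "\<dots> = cmod X / real n + cmod W / (real n)\<^sup>2"
    unfolding n_eq using r_pos by (simp add: norm_mult norm_power power_divide)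
  also have "\<dots> \<le> real m * a * row_error z / real n + var_bound z"
    by (intro add_mono divide_right_mono X_le W_le) auto
  also have "\<dots> \<le> max c r * rate z" by (rule error_le_rate[OF z])
  finally show ?thesis .
qed

text \<open>Exchangeability makes \<open>mean_st\<close> the mean of every diagonal entry, so the
  difference is an average of complex variances. The smallness of \<open>c\<close> is the condition
  of \<open>entry_update_sq_le\<close>.\<close>

lemma mean_dg_close:
  assumes z: "Im z > 0" and small: "4 * c \<le> Im z"
  shows "cmod (mean_dg z - (mean_st z)\<^sup>2) \<le> 4 * (1 + v) * r / (Im z) ^ 4 + 16 * tail n / (Im z) ^ 4"
proof -
  let ?b = "4 * (1 + v) * r / (Im z) ^ 4 + 16 * tail n / (Im z) ^ 4"
  have sm: "4 * a * real n \<le> Im z" using small r_pos unfolding a_eq n_eq by simp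
  have b: "real m * (4 * (1 + v) * a\<^sup>2 / (Im z) ^ 4 + 16 * a\<^sup>2 * real n * tail n / (Im z) ^ 4) = ?b"
  proof -
    have "real m * (4 * (1 + v) * a\<^sup>2 / (Im z) ^ 4 + 16 * a\<^sup>2 * real n * tail n / (Im z) ^ 4)
        = (real m * a\<^sup>2) * (4 * (1 + v) / (Im z) ^ 4 + 16 * real n * tail n / (Im z) ^ 4)"
      by (simp add: algebra_simps)
    also have "real m * a\<^sup>2 = r" unfolding m_eq a_eq using c_pos r_pos by (simp add: power2_eq_square field_simps)
    also have "r * (4 * (1 + v) / (Im z) ^ 4 + 16 * real n * tail n / (Im z) ^ 4) = ?b"
    proof -
      have "r * (16 * real n * tail n / (Im z) ^ 4) = 16 * tail n / (Im z) ^ 4" using n_pos by (simp add: r_def)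
      moreover have "r * (4 * (1 + v) / (Im z) ^ 4) = 4 * (1 + v) * r / (Im z) ^ 4" by simp
      ultimately show ?thesis unfolding distrib_left[of r] by (simp only:)
    qed
    finally show ?thesis .
  qed
  have each: "cmod ((\<integral>x. (Gr z {..<m} x k k)\<^sup>2 \<partial>joint_law) - (mean_st z)\<^sup>2) \<le> ?b" if k: "k < n" for k
  proof -
    define F where "F x = Gr z {..<m} x k k" for x
    have Fm: "F \<in> borel_measurable joint_law" unfolding F_def[abs_def] by (rule Gr_measurable[OF order_refl z k k])
    have Fb: "cmod (F x) \<le> 1 / Im z" for x
      unfolding F_def by (rule resolvent_fun.entry_norm[OF resolvent_fun_Gr[OF z] k k])
    have FI: "integrable joint_law F" by (rule Q.integrable_bounded_complex(1)[OF Fm Fb])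
    have F2: "integrable joint_law (\<lambda>x. (F x)\<^sup>2)"
      using Fm Fb by (intro Q.integrable_bounded_complex(1)[where B="(1 / Im z)\<^sup>2"]) (auto simp: norm_power simp del: power_divide intro!: power_mono)
    have mean: "(\<integral>x. F x \<partial>joint_law) = mean_st z"
      unfolding F_def mean_st_def by (rule mean_diagonal[OF z k])
    have "(\<integral>x. (F x - mean_st z)\<^sup>2 \<partial>joint_law) = (\<integral>x. (F x)\<^sup>2 - 2 * mean_st z * F x + (mean_st z)\<^sup>2 \<partial>joint_law)"
      by (intro Bochner_Integration.integral_cong refl) (simp add: power2_eq_square algebra_simps)
    also have "\<dots> = (\<integral>x. (F x)\<^sup>2 \<partial>joint_law) - (mean_st z)\<^sup>2"
      using FI F2 mean by (simp add: Q.prob_space power2_eq_square)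
    finally have "cmod ((\<integral>x. (F x)\<^sup>2 \<partial>joint_law) - (mean_st z)\<^sup>2) = cmod (\<integral>x. (F x - mean_st z)\<^sup>2 \<partial>joint_law)" by simp
    also have "\<dots> \<le> (\<integral>x. (cmod (F x - mean_st z))\<^sup>2 \<partial>joint_law)"
      using integral_norm_bound[of joint_law "\<lambda>x. (F x - mean_st z)\<^sup>2"] by (simp add: norm_power)
    also have "\<dots> \<le> ?b"
      using variance_diagonal[OF z k sm] unfolding b F_def[symmetric] mean .
    finally show ?thesis unfolding F_def .
  qed
  have "(\<integral>x. dg_sq (Gr z {..<m} x) \<partial>joint_law) = (\<Sum>k<n. \<integral>x. (Gr z {..<m} x k k)\<^sup>2 \<partial>joint_law)"
    unfolding resolvent_fun.diag_sq_def[OF resolvent_fun_Gr[OF z]]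
  proof (rule Bochner_Integration.integral_sum)
    fix k assume "k \<in> {..<n}"
    then have k: "k < n" by simp
    show "integrable joint_law (\<lambda>x. (Gr z {..<m} x k k)\<^sup>2)"
      using Gr_measurable[OF order_refl z k k] resolvent_fun.entry_norm[OF resolvent_fun_Gr[OF z] k k]
      by (intro Q.integrable_bounded_complex(1)[where B="(1 / Im z)\<^sup>2"]) (auto simp: norm_power simp del: power_divide intro!: power_mono)
  qed
  then have "mean_dg z - (mean_st z)\<^sup>2 = (\<Sum>k<n. (\<integral>x. (Gr z {..<m} x k k)\<^sup>2 \<partial>joint_law) - (mean_st z)\<^sup>2) / of_nat n"
    using n_pos by (simp add: mean_dg_def sum_subtractf diff_divide_distrib)
  then have "cmod (mean_dg z - (mean_st z)\<^sup>2) = cmod (\<Sum>k<n. (\<integral>x. (Gr z {..<m} x k k)\<^sup>2 \<partial>joint_law) - (mean_st z)\<^sup>2) / real n"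
    by (simp add: norm_divide)
  also have "\<dots> \<le> (\<Sum>k<n. ?b) / real n"
    by (intro divide_right_mono order_trans[OF norm_sum sum_mono] each) auto
  also have "\<dots> = ?b" using n_pos by simp
  finally show ?thesis .
qed

text \<open>On the disc of radius \<open>1 / Im z\<close> the cube is Lipschitz, and the mean
  absolute deviation is at most the root of the variance.\<close>

lemma mean_cube_close:
  assumes z: "Im z > 0"
  shows "cmod (mean_cube z - (mean_st z) ^ 3) \<le> 3 / (Im z)\<^sup>2 * sqrt (var_bound z)"
proof -
  define F where "F x = tr (Gr z {..<m} x)" for x
  define D where "D x = (F x - mean_tr z) / of_nat n" for x
  have Fm: "F \<in> borel_measurable joint_law" unfolding F_def[abs_def] by (rule traces_measurable[OF order_refl z])
  have Fb: "cmod (F x) \<le> real n / Im z" for x unfolding F_def by (rule traces_bounded[OF z])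
  have mb: "cmod (mean_tr z) \<le> real n / Im z"
    unfolding mean_tr_def F_def[symmetric] by (rule Q.integral_cmod_le_bound[OF Fm Fb])
  have F1: "integrable joint_law F" and F3: "integrable joint_law (\<lambda>x. F x ^ 3)"
    unfolding F_def[abs_def]
    using traces_integrable(1)[OF order_refl z, of 1] traces_integrable(1)[OF order_refl z, of 3] by simp_all
  have DI: "integrable joint_law D" unfolding D_def[abs_def] using F1 by simp
  have D2: "integrable joint_law (\<lambda>x. (cmod (D x))\<^sup>2)"
  proof (rule Q.integrable_bounded_complex(2))
    show "D \<in> borel_measurable joint_law" using DI by (rule borel_measurable_integrable)
    fix x
    have "cmod (F x - mean_tr z) \<le> 2 * (real n / Im z)"
      using Fb[of x] mb norm_triangle_ineq4[of "F x" "mean_tr z"] by simp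
    then show "cmod (D x) \<le> 2 * (real n / Im z) / real n"
      unfolding D_def norm_divide norm_of_nat by (intro divide_right_mono) auto
  qed
  have "(\<integral>x. (cmod (D x))\<^sup>2 \<partial>joint_law) \<le> var_bound z"
    using normalized_variance[OF z] by (simp add: D_def F_def norm_divide power_divide)
  then have ED: "(\<integral>x. cmod (D x) \<partial>joint_law) \<le> sqrt (var_bound z)"
    by (rule Q.integral_abs_le_sqrt[OF DI D2])
  have "mean_cube z - (mean_st z) ^ 3 = (\<integral>x. (F x / of_nat n) ^ 3 - (mean_tr z / of_nat n) ^ 3 \<partial>joint_law)"
    using F3 by (simp add: mean_cube_def mean_st_def F_def power_divide Q.prob_space)
  then have "cmod (mean_cube z - (mean_st z) ^ 3) \<le> (\<integral>x. cmod ((F x / of_nat n) ^ 3 - (mean_tr z / of_nat n) ^ 3) \<partial>joint_law)"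
    by (simp only: integral_norm_bound)
  also have "\<dots> \<le> (\<integral>x. 3 * (1 / Im z)\<^sup>2 * cmod (D x) \<partial>joint_law)"
  proof (rule integral_mono)
    show "integrable joint_law (\<lambda>x. cmod ((F x / of_nat n) ^ 3 - (mean_tr z / of_nat n) ^ 3))"
      using F3 by (simp add: power_divide)
    show "integrable joint_law (\<lambda>x. 3 * (1 / Im z)\<^sup>2 * cmod (D x))" using DI by simp
    fix x
    have "cmod (F x / of_nat n) \<le> 1 / Im z" "cmod (mean_tr z / of_nat n) \<le> 1 / Im z"
      using Fb[of x] mb n_pos by (simp_all add: norm_divide pos_divide_le_eq)
    from norm_diff_cube_le[OF this]
    show "cmod ((F x / of_nat n) ^ 3 - (mean_tr z / of_nat n) ^ 3) \<le> 3 * (1 / Im z)\<^sup>2 * cmod (D x)"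
      unfolding D_def diff_divide_distrib .
  qed
  also have "\<dots> = 3 * (1 / Im z)\<^sup>2 * (\<integral>x. cmod (D x) \<partial>joint_law)" by simp
  also have "\<dots> \<le> 3 * (1 / Im z)\<^sup>2 * sqrt (var_bound z)" by (intro mult_left_mono ED) simp
  finally show ?thesis by (simp add: power_divide)
qed

lemma normalized_difference_quotient:
  assumes "Im z > 0" "Im z \<le> Im z'"
  shows "cmod (mean_st z' - mean_st z - (z' - z) * mean_sq z) \<le> (cmod (z' - z))\<^sup>2 * (1 / (Im z) ^ 3)"
proof -
  have "mean_st z' - mean_st z - (z' - z) * mean_sq z
     = (mean_tr z' - mean_tr z - (z' - z) * (\<integral>x. tr_sq (Gr z {..<m} x) \<partial>joint_law)) / of_nat n"
    by (simp add: mean_st_def mean_sq_def diff_divide_distrib)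
  then have "cmod (mean_st z' - mean_st z - (z' - z) * mean_sq z)
     = cmod (mean_tr z' - mean_tr z - (z' - z) * (\<integral>x. tr_sq (Gr z {..<m} x) \<partial>joint_law)) / real n"
    by (simp only: norm_divide norm_of_nat)
  also have "\<dots> \<le> ((cmod (z' - z))\<^sup>2 * real n / (Im z) ^ 3) / real n"
    by (intro divide_right_mono trace_difference_quotient assms) simp
  finally show ?thesis using n_pos by simp
qed

section \<open>From the given random entries to the product law of rows\<close>

lemma distr_rows:
  assumes P: "prob_space P"
    and indep: "prob_space.indep_vars P (\<lambda>_. borel) (\<lambda>(j, k). X j k) ({..<m} \<times> {..<n})"
    and ident: "\<And>j k. j < m \<Longrightarrow> k < n \<Longrightarrow> distr P borel (X j k) = \<mu>"
  shows "(\<lambda>\<omega>. \<lambda>j\<in>{..<m}. \<lambda>k\<in>{..<n}. X j k \<omega>) \<in> measurable P joint_law"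
    and "distr P joint_law (\<lambda>\<omega>. \<lambda>j\<in>{..<m}. \<lambda>k\<in>{..<n}. X j k \<omega>) = joint_law"
proof -
  interpret P: prob_space P by fact
  let ?B = "Pi\<^sub>M {..<n} (\<lambda>_. borel :: real measure)"
  have rv: "X j k \<in> borel_measurable P" if "j < m" "k < n" for j k
    using indep that unfolding P.indep_vars_def by auto
  have rowB: "sets (row_law n) = sets ?B"
    unfolding row_law_def by (intro sets_PiM_cong) auto
  have row_m: "(\<lambda>\<omega>. \<lambda>k\<in>{..<n}. X j k \<omega>) \<in> measurable P ?B" if "j < m" for j
    using rv[OF that] by (intro measurable_restrict) auto
  \<comment> \<open>Independence is given for pairs \<open>(j, k)\<close>; for fixed
    \<open>j\<close> it is carried along the bijection between \<open>{j} \<times> K\<close> and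
    \<open>K\<close>.\<close>
  have ind_row: "P.indep_vars (\<lambda>_. borel) (\<lambda>k. X j k) {..<n}" if j: "j < m" for j
  proof -
    have "P.indep_vars (\<lambda>_. borel) (\<lambda>(j, k). X j k) ({j} \<times> {..<n})"
      by (rule P.indep_vars_subset[OF indep]) (use j in auto)
    then have s: "P.indep_sets (\<lambda>(j, k). {X j k -` A \<inter> space P |A. A \<in> sets borel}) ({j} \<times> {..<n})"
      unfolding P.indep_vars_def2 by (simp add: case_prod_beta')
    have "P.indep_sets (\<lambda>k. {X j k -` A \<inter> space P |A. A \<in> sets borel}) {..<n}"
    proof (rule P.indep_setsI)
      fix k assume "k \<in> {..<n}"
      then show "{X j k -` A \<inter> space P |A. A \<in> sets borel} \<subseteq> P.events"
        using rv[OF j, of k] by (auto intro: measurable_sets)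
    next
      fix A K assume K: "K \<noteq> {}" "K \<subseteq> {..<n}" "finite K" and A: "\<forall>k\<in>K. A k \<in> {X j k -` A \<inter> space P |A. A \<in> sets borel}"
      have "P.prob (\<Inter>p\<in>{j} \<times> K. A (snd p)) = (\<Prod>p\<in>{j} \<times> K. P.prob (A (snd p)))"
        by (rule P.indep_setsD[OF s]) (use K A in auto)
      moreover have "(\<Inter>p\<in>{j} \<times> K. A (snd p)) = (\<Inter>k\<in>K. A k)" by auto
      moreover have "(\<Prod>p\<in>{j} \<times> K. P.prob (A (snd p))) = (\<Prod>k\<in>K. P.prob (A k))"
        by (rule prod.reindex_bij_witness[of _ "\<lambda>k. (j, k)" snd]) auto
      ultimately show "P.prob (\<Inter> (A ` K)) = (\<Prod>k\<in>K. P.prob (A k))" by simp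
    qed
    then show ?thesis unfolding P.indep_vars_def2 using rv[OF j] by auto
  qed
  have row_d: "distr P ?B (\<lambda>\<omega>. \<lambda>k\<in>{..<n}. X j k \<omega>) = row_law n" if j: "j < m" for j
  proof -
    have "distr P ?B (\<lambda>\<omega>. \<lambda>k\<in>{..<n}. X j k \<omega>) = (\<Pi>\<^sub>M k\<in>{..<n}. distr P borel (X j k))"
      by (rule P.indep_vars_iff_distr_eq_PiM'[THEN iffD1, OF _ _ ind_row[OF j]]) (use n_pos rv[OF j] in auto)
    also have "\<dots> = row_law n" unfolding row_law_def by (intro PiM_cong) (use ident[OF j] in auto)
    finally show ?thesis .
  qed
  \<comment> \<open>Rows are blocks over disjoint index sets and hence independent. Reindexing each
    block from pairs to column numbers turns it into a row vector.\<close>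
  have "P.indep_vars (\<lambda>j. Pi\<^sub>M ({j} \<times> {..<n}) (\<lambda>_. borel)) (\<lambda>j \<omega>. restrict (\<lambda>i. (case i of (j, k) \<Rightarrow> X j k) \<omega>) ({j} \<times> {..<n})) {..<m}"
    by (rule P.indep_vars_restrict[OF indep]) (auto simp: disjoint_family_on_def)
  then have "P.indep_vars (\<lambda>j. ?B) (\<lambda>j \<omega>. (\<lambda>f. \<lambda>k\<in>{..<n}. f (j, k)) (restrict (\<lambda>i. (case i of (j, k) \<Rightarrow> X j k) \<omega>) ({j} \<times> {..<n}))) {..<m}"
    by (rule P.indep_vars_compose2) (intro measurable_restrict measurable_component_singleton, auto)
  moreover have "(\<lambda>k\<in>{..<n}. restrict (\<lambda>i. (case i of (j, k) \<Rightarrow> X j k) \<omega>) ({j} \<times> {..<n}) (j, k)) = (\<lambda>k\<in>{..<n}. X j k \<omega>)" for j \<omega>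
    by (intro restrict_ext) auto
  ultimately have ind: "P.indep_vars (\<lambda>j. ?B) (\<lambda>j \<omega>. \<lambda>k\<in>{..<n}. X j k \<omega>) {..<m}" by simp
  have jB: "sets joint_law = sets (Pi\<^sub>M {..<m} (\<lambda>_. ?B))"
    unfolding joint_law_def by (intro sets_PiM_cong rowB refl)
  have "(\<lambda>\<omega>. \<lambda>j\<in>{..<m}. \<lambda>k\<in>{..<n}. X j k \<omega>) \<in> measurable P (Pi\<^sub>M {..<m} (\<lambda>_. ?B))"
    by (intro measurable_restrict row_m) auto
  then show "(\<lambda>\<omega>. \<lambda>j\<in>{..<m}. \<lambda>k\<in>{..<n}. X j k \<omega>) \<in> measurable P joint_law"
    by (simp only: measurable_cong_sets[OF refl jB])
  have "distr P (Pi\<^sub>M {..<m} (\<lambda>_. ?B)) (\<lambda>\<omega>. \<lambda>j\<in>{..<m}. \<lambda>k\<in>{..<n}. X j k \<omega>)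
      = (\<Pi>\<^sub>M j\<in>{..<m}. distr P ?B (\<lambda>\<omega>. \<lambda>k\<in>{..<n}. X j k \<omega>))"
    by (rule P.indep_vars_iff_distr_eq_PiM'[THEN iffD1, OF _ _ ind]) (use m_pos row_m in auto)
  also have "\<dots> = joint_law" unfolding joint_law_def by (intro PiM_cong refl) (simp add: row_d)
  also have "distr P (Pi\<^sub>M {..<m} (\<lambda>_. ?B)) (\<lambda>\<omega>. \<lambda>j\<in>{..<m}. \<lambda>k\<in>{..<n}. X j k \<omega>) = distr P joint_law (\<lambda>\<omega>. \<lambda>j\<in>{..<m}. \<lambda>k\<in>{..<n}. X j k \<omega>)"
    by (intro distr_cong jB[symmetric] refl)
  finally show "distr P joint_law (\<lambda>\<omega>. \<lambda>j\<in>{..<m}. \<lambda>k\<in>{..<n}. X j k \<omega>) = joint_law" .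
qed

lemma renorm_cov_eq: "renorm_cov m n x = Matrix.mat n n (\<lambda>(k, l). gram {..<m} x k l)"
proof (rule eq_matI)
  \<comment> \<open>The two normalizations \<open>sqrt (m / n) / m = 1 / sqrt (m n)\<close> and
    \<open>sqrt (m / n) = a m\<close> identify the shift by the identity with the shift
    \<open>m\<close> inside \<open>gram\<close>.\<close>
  have coef: "sqrt (real m / real n) * (1 / real m) = a" "sqrt (real m / real n) = a * real m"
  proof -
    have "sqrt (real m / real n) = sqrt (real m) / sqrt (real n)" by (simp add: real_sqrt_divide)
    moreover have "a * real m = sqrt (real m) / sqrt (real n)"
      unfolding a_def using m_pos n_pos by (simp add: real_sqrt_mult real_div_sqrt divide_divide_eq_left[symmetric] flip: divide_divide_eq_left)
    ultimately show 2: "sqrt (real m / real n) = a * real m" by simp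
    show "sqrt (real m / real n) * (1 / real m) = a" unfolding 2 using m_pos by simp
  qed
  fix k l assume "k < dim_row (Matrix.mat n n (\<lambda>(k, l). gram {..<m} x k l))" "l < dim_col (Matrix.mat n n (\<lambda>(k, l). gram {..<m} x k l))"
  then have kl: "k < n" "l < n" by auto
  define S where "S = (\<Sum>j<m. x j k * x j l)"
  have "((Matrix.mat m n (\<lambda>(j, k). x j k))\<^sup>T * Matrix.mat m n (\<lambda>(j, k). x j k)) $$ (k, l) = S"
    using kl by (auto simp: scalar_prod_def S_def lessThan_atLeast0 intro!: sum.cong)
  then have "renorm_cov m n x $$ (k, l) = sqrt (real m / real n) * ((1 / real m) * S - (if k = l then 1 else 0))"
    using kl by (simp add: renorm_cov_def Let_def)
  also have "\<dots> = (sqrt (real m / real n) * (1 / real m)) * S - sqrt (real m / real n) * (if k = l then 1 else 0)"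
    by (simp add: right_diff_distrib)
  also have "\<dots> = gram {..<m} x k l"
    unfolding coef(1) unfolding coef(2) gram_def S_def[symmetric] by (simp add: right_diff_distrib)
  finally show "renorm_cov m n x $$ (k, l) = Matrix.mat n n (\<lambda>(k, l). gram {..<m} x k l) $$ (k, l)"
    using kl by simp
qed (simp_all add: renorm_cov_def Let_def)

lemma expected_stieltjes_eq:
  assumes P: "prob_space P"
    and indep: "prob_space.indep_vars P (\<lambda>_. borel) (\<lambda>(j, k). X j k) ({..<m} \<times> {..<n})"
    and ident: "\<And>j k. j < m \<Longrightarrow> k < n \<Longrightarrow> distr P borel (X j k) = \<mu>"
    and z: "Im z > 0"
  shows "expected_stieltjes P m n X z = mean_st z"
proof -
  let ?Y = "\<lambda>\<omega>. \<lambda>j\<in>{..<m}. \<lambda>k\<in>{..<n}. X j k \<omega>"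
  have tr: "mat_trace (resolvent (renorm_cov m n (\<lambda>j k. X j k \<omega>)) z) = tr (Gr z {..<m} (?Y \<omega>))" for \<omega>
  proof -
    let ?x = "\<lambda>j k. X j k \<omega>"
    have dim: "dim_row (resolvent (Matrix.mat n n (\<lambda>(k, l). gram {..<m} ?x k l)) z) = n"
      using resolvent_carrier[of n "gram {..<m} ?x", OF gram_sym z] by auto
    have "tr (Gr z {..<m} ?x) = (\<Sum>k<n. Gr z {..<m} ?x k k)"
      by (rule resolvent_fun.trace_def[OF resolvent_fun_Gr[OF z]])
    then have "mat_trace (resolvent (renorm_cov m n ?x) z) = tr (Gr z {..<m} ?x)"
      unfolding renorm_cov_eq mat_trace_def dim by (simp only: Gr_def resolvent_entry_def)
    also have "\<dots> = tr (Gr z {..<m} (?Y \<omega>))"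
    \<comment> \<open>The restricted array is needed because points of a product space are
      extensional; both arrays agree at all indices that the Gram matrix reads.\<close>
    proof (rule resolvent_fun_traces_unique(1)[OF resolvent_fun_Gr[OF z]])
      show "resolvent_fun n (gram {..<m} ?x) z (Gr z {..<m} (?Y \<omega>))"
        by (rule resolvent_fun_cong[OF resolvent_fun_Gr[OF z]]) (auto simp: gram_def)
    qed
    finally show ?thesis .
  qed
  have d: "distr P joint_law ?Y = joint_law" by (rule distr_rows(2)[OF P indep]) (rule ident)
  have "(\<integral>\<omega>. tr (Gr z {..<m} (?Y \<omega>)) \<partial>P) = (\<integral>x. tr (Gr z {..<m} x) \<partial>distr P joint_law ?Y)"
    by (rule integral_distr[symmetric, OF distr_rows(1)[OF P indep ident] traces_measurable(1)[OF order_refl z]])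
  also have "\<dots> = mean_tr z" unfolding d mean_tr_def ..
  finally show ?thesis unfolding expected_stieltjes_def tr mean_st_def by simp
qed

end

section \<open>The expansion\<close>

theorem theorem1p1:
  fixes P :: "nat \<Rightarrow> 'a measure"
    and M :: "nat \<Rightarrow> nat"
    and X :: "nat \<Rightarrow> nat \<Rightarrow> nat \<Rightarrow> 'a \<Rightarrow> real"
    and \<mu> :: "real measure"
    and \<delta> :: real
    and z :: complex
  assumes M_pos: "\<And>N. N > 0 \<Longrightarrow> M N > 0"
    and ratio: "(\<lambda>N. real N / real (M N)) \<longlonglongrightarrow> 0"
    and prob: "\<And>N. N > 0 \<Longrightarrow> prob_space (P N)"
    and indep: "\<And>N. N > 0 \<Longrightarrow>
      prob_space.indep_vars (P N) (\<lambda>_. borel) (\<lambda>(j, k). X N j k) ({..<M N} \<times> {..<N})"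
    and ident: "\<And>N j k. N > 0 \<Longrightarrow> j < M N \<Longrightarrow> k < N \<Longrightarrow> distr (P N) borel (X N j k) = \<mu>"
    and mean: "prob_space.expectation \<mu> (\<lambda>x. x) = 0"
    and variance: "prob_space.variance \<mu> (\<lambda>x. x) = 1"
    and delta: "\<delta> > 0"
    and moment: "integrable \<mu> (\<lambda>x. \<bar>x\<bar> powr (5 + \<delta>))"
    and z: "Im z > 0"
  shows "let f = semicircle_stieltjes z in
         (\<lambda>N. expected_stieltjes (P N) (M N) N (X N) z
            - f * (1 - of_real (sqrt (real N / real (M N))) * (f ^ 3 / (1 - f\<^sup>2))
                   + (1 / of_nat N) * (f\<^sup>2 / (1 - f\<^sup>2)\<^sup>2
                        + of_real (kappa4 \<mu>) * (f\<^sup>2 / (1 - f\<^sup>2)))))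
         \<in> o(\<lambda>N. complex_of_real (max (sqrt (real N / real (M N))) (1 / real N)))"
proof -
  \<comment> \<open>The case \<open>N = 1\<close> already shows that \<open>\<mu>\<close> is a Borel
    probability law, as the distribution of the entry \<open>(0, 0)\<close>; positivity of
    \<open>M 1\<close> guarantees that this entry exists.\<close>
  have mu: "standardized_law \<mu>"
  proof (intro standardized_law.intro standardized_law_axioms.intro)
    interpret P1: prob_space "P 1" by (rule prob) simp
    have "(\<lambda>(j, k). X 1 j k) (0, 0) \<in> borel_measurable (P 1)"
      using indep[of 1] M_pos[of 1] unfolding P1.indep_vars_def by auto
    then have "X 1 0 0 \<in> borel_measurable (P 1)" by simp
    then have ps: "prob_space (distr (P 1) borel (X 1 0 0))" by (rule P1.prob_space_distr)
    have d: "distr (P 1) borel (X 1 0 0) = \<mu>" by (rule ident) (use M_pos[of 1] in auto)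
    show "prob_space \<mu>" using ps unfolding d .
    show sets: "sets \<mu> = sets borel" unfolding d[symmetric] by (rule sets_distr)
    interpret prob_space \<mu> by fact
    show "(\<integral>x. x \<partial>\<mu>) = 0" using mean .
    show "(\<integral>x. x\<^sup>2 \<partial>\<mu>) = 1" using variance unfolding mean by simp
    show "integrable \<mu> (\<lambda>x. x ^ 4)"
    proof (rule Bochner_Integration.integrable_bound)
      show "integrable \<mu> (\<lambda>x. 1 + \<bar>x\<bar> powr (5 + \<delta>))" using moment by simp
      show "(\<lambda>x. x ^ 4) \<in> borel_measurable \<mu>" using sets by (simp cong: measurable_cong_sets)
      have "\<bar>x\<bar> ^ 4 \<le> 1 + \<bar>x\<bar> powr (5 + \<delta>)" for x :: real
      proof (cases "\<bar>x\<bar> \<le> 1")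
        case True
        then have "\<bar>x\<bar> ^ 4 \<le> 1" by (intro power_le_one) auto
        then show ?thesis using powr_ge_zero[of "\<bar>x\<bar>" "5 + \<delta>"] by linarith
      next
        case False
        then have "\<bar>x\<bar> ^ 4 = \<bar>x\<bar> powr 4" using powr_realpow[of "\<bar>x\<bar>" 4] by simp
        also have "\<dots> \<le> \<bar>x\<bar> powr (5 + \<delta>)" using False delta by (intro powr_mono) auto
        finally show ?thesis by simp
      qed
      then show "AE x in \<mu>. norm (x ^ 4) \<le> norm (1 + \<bar>x\<bar> powr (5 + \<delta>))"
        by (intro AE_I2) (simp add: power_abs)
    qed
  qed
  then interpret standardized_law \<mu> .
  have sc: "sample_cov \<mu> N (M N)" if "N > 0" for N
    using that M_pos by (intro sample_cov.intro sample_cov_axioms.intro mu) auto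
  define c where "c N = sqrt (real N / real (M N))" for N
  define r where "r N = 1 / real N" for N
  have c_eq: "sample_cov.c N (M N) = c N" and r_eq: "sample_cov.r N = r N" if "N > 0" for N
    using sample_cov.c_def[OF sc[OF that]] sample_cov.r_def[OF sc[OF that]] by (simp_all add: c_def r_def)
  define mb where "mb N = sample_cov.mean_st \<mu> N (M N)" for N
  define p2 where "p2 N = sample_cov.mean_sq \<mu> N (M N)" for N
  define p4 where "p4 N = sample_cov.mean_dg \<mu> N (M N)" for N
  define f3 where "f3 N = sample_cov.mean_cube \<mu> N (M N)" for N
  define t where "t N = tail N" for N
  define d where "d N z = 352 * c N / (Im z) ^ 4 + 12 * sqrt (v * r N / (Im z)\<^sup>2) / (Im z)\<^sup>2 + 20 * t N / (Im z)\<^sup>2 + c N * t N / (Im z) ^ 3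
    + 6 * (1 + v) * c N / (Im z) ^ 3 + 2 / Im z * (c N / (Im z)\<^sup>2 + 6 * (1 + v) * (c N)\<^sup>2 / (Im z) ^ 3)
    + r N * (3 + 2 * \<bar>\<kappa>\<bar>) / (Im z)\<^sup>2 + 3 * c N / (Im z) ^ 3 + 146 * v * r N / (Im z) ^ 4 + 2304 * (c N)\<^sup>2 / (Im z) ^ 6" for N and z :: complex
  have rate: "sample_cov.rate \<mu> N (M N) z = d N z" if "N > 0" for N z
    unfolding sample_cov.rate_def[OF sc[OF that]] d_def t_def c_eq[OF that] r_eq[OF that] ..
  have c0: "c \<longlonglongrightarrow> 0"
    using tendsto_real_sqrt[OF ratio] unfolding c_def[abs_def] by simp
  have r0: "r \<longlonglongrightarrow> 0" unfolding r_def[abs_def] by (rule lim_const_over_n)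
  have cr_nonneg: "c N \<ge> 0" "r N \<ge> 0" for N by (simp_all add: c_def r_def)
  have t0: "t \<longlonglongrightarrow> 0" unfolding t_def by (rule tail_tendsto)
  have pos: "eventually (\<lambda>N. N > (0::nat)) sequentially" by (rule eventually_gt_at_top)
  have main: "(\<lambda>N. mb N z - semicircle_stieltjes z * (1 - of_real (c N) * (semicircle_stieltjes z ^ 3 / (1 - (semicircle_stieltjes z)\<^sup>2))
      + of_real (r N) * ((semicircle_stieltjes z)\<^sup>2 / (1 - (semicircle_stieltjes z)\<^sup>2)\<^sup>2 + of_real \<kappa> * ((semicircle_stieltjes z)\<^sup>2 / (1 - (semicircle_stieltjes z)\<^sup>2)))))
    \<in> o(\<lambda>N. complex_of_real (max (c N) (r N)))"
  \<comment> \<open>The sum in \<open>B\<close> is a common bound for the normalized square,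
    diagonal and cubic averages, whose own bounds have different powers of
    \<open>Im z\<close>.\<close>
  proof (rule stieltjes_expansion[where d = d and B = "\<lambda>z. 1 / (Im z)\<^sup>2 + 1 / (Im z) ^ 3" and K = "\<lambda>z. 1 / (Im z) ^ 3"
        and psq = p2 and pdg = p4 and fcb = f3])
    fix z :: complex assume z: "Im z > 0"
    {
      fix N :: nat assume N: "N > 0"
      interpret S: sample_cov \<mu> N "M N" by (rule sc[OF N])
      note b = S.mean_bounds[OF z]
      have nn: "0 \<le> 1 / (Im z)\<^sup>2" "0 \<le> 1 / (Im z) ^ 3" using z by auto
      show "Im (mb N z) \<ge> 0" unfolding mb_def by (rule b)
      show "cmod (p2 N z) \<le> 1 / (Im z)\<^sup>2 + 1 / (Im z) ^ 3"
        "cmod (p4 N z) \<le> 1 / (Im z)\<^sup>2 + 1 / (Im z) ^ 3"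
        "cmod (f3 N z) \<le> 1 / (Im z)\<^sup>2 + 1 / (Im z) ^ 3"
        unfolding p2_def p4_def f3_def using b nn by linarith+
      show "cmod ((mb N z)\<^sup>2 + z * mb N z + 1 + of_real (r N) * (p2 N z + of_real \<kappa> * p4 N z) - of_real (c N) * f3 N z)
          \<le> max (c N) (r N) * d N z"
        using S.normalized_equation[OF z] unfolding mb_def p2_def p4_def f3_def rate[OF N] c_eq[OF N] r_eq[OF N] .
      show "cmod (mb N z' - mb N z - (z' - z) * p2 N z) \<le> (cmod (z' - z))\<^sup>2 * (1 / (Im z) ^ 3)" if "Im z \<le> Im z'" for z'
        using S.normalized_difference_quotient[OF z that] unfolding mb_def p2_def .
    }
    have "(\<lambda>N. d N z) \<longlonglongrightarrow> 352 * 0 / (Im z) ^ 4 + 12 * sqrt (v * 0 / (Im z)\<^sup>2) / (Im z)\<^sup>2 + 20 * 0 / (Im z)\<^sup>2 + 0 * 0 / (Im z) ^ 3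
      + 6 * (1 + v) * 0 / (Im z) ^ 3 + 2 / Im z * (0 / (Im z)\<^sup>2 + 6 * (1 + v) * 0\<^sup>2 / (Im z) ^ 3)
      + 0 * (3 + 2 * \<bar>\<kappa>\<bar>) / (Im z)\<^sup>2 + 3 * 0 / (Im z) ^ 3 + 146 * v * 0 / (Im z) ^ 4 + 2304 * 0\<^sup>2 / (Im z) ^ 6"
      unfolding d_def by (intro tendsto_intros c0 r0 t0) (use z in auto)
    then show "(\<lambda>N. d N z) \<longlonglongrightarrow> 0" by simp
    \<comment> \<open>The diagonal estimate applies only once \<open>c\<close> is small compared
      with \<open>Im z\<close>, which holds for large \<open>N\<close> since the ratio tends to
      zero.\<close>
    have "eventually (\<lambda>N. 4 * c N \<le> Im z) sequentially"
    proof -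
      have "eventually (\<lambda>N. c N < Im z / 4) sequentially" by (rule order_tendstoD(2)[OF c0]) (use z in simp)
      then show ?thesis by eventually_elim simp
    qed
    with pos have "eventually (\<lambda>N. norm (p4 N z - (mb N z)\<^sup>2) \<le> 4 * (1 + v) * r N / (Im z) ^ 4 + 16 * t N / (Im z) ^ 4) sequentially"
    proof eventually_elim
      case (elim N)
      interpret S: sample_cov \<mu> N "M N" by (rule sc[OF elim(1)])
      show ?case
        using S.mean_dg_close[OF z] elim(2) unfolding c_eq[OF elim(1)] r_eq[OF elim(1)] p4_def mb_def t_def by simp
    qed
    moreover have "(\<lambda>N. 4 * (1 + v) * r N / (Im z) ^ 4 + 16 * t N / (Im z) ^ 4) \<longlonglongrightarrow> 0"
    proof -
      have "(\<lambda>N. 4 * (1 + v) * r N / (Im z) ^ 4 + 16 * t N / (Im z) ^ 4) \<longlonglongrightarrow> 4 * (1 + v) * 0 / (Im z) ^ 4 + 16 * 0 / (Im z) ^ 4"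
        by (intro tendsto_intros r0 t0) (use z in auto)
      then show ?thesis by simp
    qed
    ultimately show "(\<lambda>N. p4 N z - (mb N z)\<^sup>2) \<longlonglongrightarrow> 0"
      by (rule Lim_null_comparison)
    have "eventually (\<lambda>N. norm (f3 N z - (mb N z) ^ 3)
        \<le> 3 / (Im z)\<^sup>2 * sqrt (146 * v * (r N)\<^sup>2 / (Im z) ^ 4 + 2304 * (c N)\<^sup>2 * r N / (Im z) ^ 6)) sequentially"
      using pos
    proof eventually_elim
      case (elim N)
      interpret S: sample_cov \<mu> N "M N" by (rule sc[OF elim])
      show ?case
        using S.mean_cube_close[OF z] unfolding S.var_bound_def c_eq[OF elim] r_eq[OF elim] f3_def mb_def .
    qed
    moreover have "(\<lambda>N. 3 / (Im z)\<^sup>2 * sqrt (146 * v * (r N)\<^sup>2 / (Im z) ^ 4 + 2304 * (c N)\<^sup>2 * r N / (Im z) ^ 6)) \<longlonglongrightarrow> 0"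
    proof -
      have "(\<lambda>N. 146 * v * (r N)\<^sup>2 / (Im z) ^ 4 + 2304 * (c N)\<^sup>2 * r N / (Im z) ^ 6)
          \<longlonglongrightarrow> 146 * v * 0\<^sup>2 / (Im z) ^ 4 + 2304 * 0\<^sup>2 * 0 / (Im z) ^ 6"
        by (intro tendsto_add tendsto_divide tendsto_mult tendsto_power tendsto_const r0 c0) (use z in auto)
      from tendsto_mult_left[OF tendsto_real_sqrt[OF this], of "3 / (Im z)\<^sup>2"] show ?thesis by simp
    qed
    ultimately show "(\<lambda>N. f3 N z - (mb N z) ^ 3) \<longlonglongrightarrow> 0"
      by (rule Lim_null_comparison)
  next
    show "0 < max (c N) (r N)" if "N > 0" for N using that by (simp add: r_def less_max_iff_disj)
  qed (use c0 r0 z cr_nonneg in auto)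
  \<comment> \<open>The model is available only for \<open>N > 0\<close>; agreement for almost all
    \<open>N\<close> is enough, as the little-o class depends only on the behaviour at
    infinity.\<close>
  have "eventually (\<lambda>N. expected_stieltjes (P N) (M N) N (X N) z - T N = mb N z - T N) sequentially" for T :: "nat \<Rightarrow> complex"
    using pos
  proof eventually_elim
    case (elim N)
    interpret S: sample_cov \<mu> N "M N" by (rule sc[OF elim])
    have "expected_stieltjes (P N) (M N) N (X N) z = mb N z"
      unfolding mb_def
    proof (rule S.expected_stieltjes_eq)
      show "prob_space (P N)" by (rule prob[OF elim])
      show "prob_space.indep_vars (P N) (\<lambda>_. borel) (\<lambda>(j, k). X N j k) ({..<M N} \<times> {..<N})" by (rule indep[OF elim])
      show "distr (P N) borel (X N j k) = \<mu>" if "j < M N" "k < N" for j k by (rule ident[OF elim that])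
      show "Im z > 0" by (rule z)
    qed
    then show ?case by simp
  qed
  from landau_o.small.in_cong[OF this, THEN iffD2, OF main] show ?thesis
    unfolding Let_def c_def r_def of_real_divide of_real_1 of_real_of_nat_eq .
qed

end
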